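(* Let $d_u>0$, $d_v\ge 0$, $U_0>0$, $V_0>0$. The unique weak solution $w$ of Problem $(P_2^{limit})$ has a self-similar form: there exist a function $f:\mathbb{R}^+\to\mathbb{R}$ and a positive constant $a>0$ such that, for every $T>0$, $$w(x,t)=f\left(\frac{x}{\sqrt t}\right),\quad (x,t)\in (0,\infty)\times(0,T),$$ and the free boundary $x=\xi(t)$ separating the region where $w>0$ (namely $x<\xi(t)$) from the region where $w<0$ (namely $x>\xi(t)$) is $\xi(t)=a\sqrt t$, $t\in[0,T]$. If $d_v>0$, then $a>0$ is the unique root of the equation $$d_uU_0\int_a^\infty e^{\frac{a^2-s^2}{4d_v}}\,ds=d_vV_0\int_{0}^a e^{\frac{a^2-s^2}{4d_u}}\,ds,$$ and $$f(\eta)=\begin{cases}U_0\left(1-\dfrac{\int_{0}^{\eta}e^{-\frac{s^2}{4d_u}}\,ds}{\int_{0}^{a}e^{-\frac{s^2}{4d_u}}\,ds}\right), & \eta\le a,\\[3mm] -V_0\left(1-\dfrac{\int_{\eta}^{\infty}e^{-\frac{s^2}{4d_v}}\,ds}{\int_{a}^{\infty}e^{-\frac{s^2}{4d_v}}\,ds}\right), & \eta>a.\end{cases}$$ If $d_v=0$, then $a>0$ is the unique root of the equation $$U_0=\frac{V_0a}{2d_u}\int_{0}^a e^{\frac{a^2-s^2}{4d_u}}\,ds,$$ and $$f(\eta)=\begin{cases}U_0\left(1-\dfrac{\int_{0}^{\eta}e^{-\frac{s^2}{4d_u}}\,ds}{\int_{0}^{a}e^{-\frac{s^2}{4d_u}}\,ds}\right),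 & \eta\le a,\\[3mm] -V_0, & \eta>a.\end{cases}$$
   Context: Here $\mathbb{R}^+=[0,\infty)$ and $S_T=(0,\infty)\times(0,T)$. Define $\mathcal{D}(s)=d_us$ if $s\ge0$ and $\mathcal{D}(s)=d_vs$ if $s<0$. Problem $(P_2^{limit})$ is $$w_t=\mathcal{D}(w)_{xx}\ \text{ in }(0,\infty)\times(0,\infty),\qquad w(x,0)=w_0(x):=-V_0\ \text{ for }x>0,\qquad w(0,t)=U_0\ \text{ for }t\in(0,\infty).$$ A weak solution of $(P_2^{limit})$ is a function $w\in L^\infty(\mathbb{R}^+\times\mathbb{R}^+)$ such that for all $T>0$, $$\iint_{S_T}\bigl(w\psi_t+\mathcal{D}(w)\psi_{xx}\bigr)\,dx\,dt=-d_uU_0\int_0^T\psi_x(0,t)\,dt-\int_0^\infty w_0(x)\psi(x,0)\,dx$$ for all $\psi\in\hat{\mathcal{F}}_T$, the set of functions $\psi$ of class $C^{2,1}$ ($C^2$ in $x$, $C^1$ in $t$) on $\overline{S_T}$ with $\psi(\cdot,T)=0$, $\psi(0,t)=0$ for $t\in(0,T)$, and $\operatorname{supp}\psi\subset[0,J]\times[0,T]$ for some $J>0$. Equalities of $w$ are almost everywhere. *)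

theory Defs
  imports "HOL-Analysis.Analysis"
begin

definition strip :: "real \<Rightarrow> (real \<times> real) set" where
  "strip T = {0<..} \<times> {0<..<T}"

definition closed_strip :: "real \<Rightarrow> (real \<times> real) set" where
  "closed_strip T = {0..} \<times> {0..T}"

definition quadrant :: "(real \<times> real) set" where
  "quadrant = {0..} \<times> {0..}"

definition diffusion :: "real \<Rightarrow> real \<Rightarrow> real \<Rightarrow> real" where
  "diffusion d\<^sub>u d\<^sub>v s = (if 0 \<le> s then d\<^sub>u * s else d\<^sub>v * s)"

definition initial_datum :: "real \<Rightarrow> real \<Rightarrow> real" where
  "initial_datum V\<^sub>0 x = - V\<^sub>0"

text \<open>
  \<open>\<psi>\<close> is of class \<open>C\<^sup>2\<close> in \<open>x\<close> and \<open>C\<^sup>1\<close> in \<open>t\<close> up to the boundary of the strip. The functions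
  \<open>\<psi>x\<close>, \<open>\<psi>xx\<close>, \<open>\<psi>t\<close> are the partial derivatives, one-sided at boundary points; for \<open>0 < T\<close> they
  are determined by \<open>\<psi>\<close> on the closed strip.
\<close>
definition C21_on_closed_strip ::
  "real \<Rightarrow> (real \<Rightarrow> real \<Rightarrow> real) \<Rightarrow> (real \<Rightarrow> real \<Rightarrow> real) \<Rightarrow> (real \<Rightarrow> real \<Rightarrow> real)
    \<Rightarrow> (real \<Rightarrow> real \<Rightarrow> real) \<Rightarrow> bool" where
  "C21_on_closed_strip T \<psi> \<psi>x \<psi>xx \<psi>t \<longleftrightarrow>
     (\<forall>(x, t) \<in> closed_strip T.
        ((\<lambda>y. \<psi> y t) has_real_derivative \<psi>x x t) (at x within {0..}) \<and>
        ((\<lambda>y. \<psi>x y t) has_real_derivative \<psi>xx x t) (at x within {0..}) \<and>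
        ((\<lambda>s. \<psi> x s) has_real_derivative \<psi>t x t) (at t within {0..T})) \<and>
     continuous_on (closed_strip T) (\<lambda>(x, t). \<psi> x t) \<and>
     continuous_on (closed_strip T) (\<lambda>(x, t). \<psi>x x t) \<and>
     continuous_on (closed_strip T) (\<lambda>(x, t). \<psi>xx x t) \<and>
     continuous_on (closed_strip T) (\<lambda>(x, t). \<psi>t x t)"

definition test_function ::
  "real \<Rightarrow> (real \<Rightarrow> real \<Rightarrow> real) \<Rightarrow> (real \<Rightarrow> real \<Rightarrow> real) \<Rightarrow> (real \<Rightarrow> real \<Rightarrow> real)
    \<Rightarrow> (real \<Rightarrow> real \<Rightarrow> real) \<Rightarrow> bool" where
  "test_function T \<psi> \<psi>x \<psi>xx \<psi>t \<longleftrightarrow>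
     C21_on_closed_strip T \<psi> \<psi>x \<psi>xx \<psi>t \<and>
     (\<forall>x\<ge>0. \<psi> x T = 0) \<and>
     (\<forall>t\<in>{0<..<T}. \<psi> 0 t = 0) \<and>
     (\<exists>J>0. closure {(x, t) \<in> closed_strip T. \<psi> x t \<noteq> 0} \<subseteq> {0..J} \<times> {0..T})"

definition Linfty_quadrant :: "(real \<Rightarrow> real \<Rightarrow> real) \<Rightarrow> bool" where
  "Linfty_quadrant w \<longleftrightarrow>
     (\<lambda>(x, t). w x t) \<in> borel_measurable (lebesgue_on quadrant) \<and>
     (\<exists>C. AE (x, t) in lebesgue_on quadrant. \<bar>w x t\<bar> \<le> C)"

definition weak_solution ::
  "real \<Rightarrow> real \<Rightarrow> real \<Rightarrow> real \<Rightarrow> (real \<Rightarrow> real \<Rightarrow> real) \<Rightarrow> bool" where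
  "weak_solution d\<^sub>u d\<^sub>v U\<^sub>0 V\<^sub>0 w \<longleftrightarrow>
     Linfty_quadrant w \<and>
     (\<forall>T>0. \<forall>\<psi> \<psi>x \<psi>xx \<psi>t. test_function T \<psi> \<psi>x \<psi>xx \<psi>t \<longrightarrow>
        (LINT (x, t)|lebesgue_on (strip T). w x t * \<psi>t x t + diffusion d\<^sub>u d\<^sub>v (w x t) * \<psi>xx x t)
        = - d\<^sub>u * U\<^sub>0 * (LINT t|lebesgue_on {0<..<T}. \<psi>x 0 t)
          - (LINT x|lebesgue_on {0<..}. initial_datum V\<^sub>0 x * \<psi> x 0))"

text \<open>
  As \<open>w\<close> is only an almost-everywhere class, the signs on the two sides of the curve \<open>x = \<xi> t\<close> are
  required almost everywhere; continuity of \<open>\<xi>\<close> then makes the curve unique on \<open>[0, T]\<close>.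
\<close>
definition free_boundary :: "real \<Rightarrow> (real \<Rightarrow> real \<Rightarrow> real) \<Rightarrow> (real \<Rightarrow> real) \<Rightarrow> bool" where
  "free_boundary T w \<xi> \<longleftrightarrow>
     continuous_on {0..T} \<xi> \<and>
     (AE (x, t) in lebesgue_on (strip T). (x < \<xi> t \<longrightarrow> 0 < w x t) \<and> (\<xi> t < x \<longrightarrow> w x t < 0))"

end

(*
Uniqueness is an energy argument. If z is the difference of two weak solutions and Z that of their
images under the monotone diffusion function D, testing with products phi(x) Theta(t) shows that
Y(x,t) = int_0^t Z(x,s) ds agrees a.e. with int_0^x (x - y) z(y,t) dy + alpha(t) x, so that Y_xx = z
weakly and Y(0,t) = 0. With P = Y_x one has formally
  d/dt (1/2) int P^2 e^(-x) dx = - int Z (z - P) e^(-x) dx,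
and z Z >= c Z^2 bounds the right-hand side by (1/(4c)) int P^2 e^(-x) dx. A backward difference
quotient in time and the weight e^(-t/c) make this rigorous and give P = 0, hence z = 0.

Existence: for w = f(x / sqrt t) the test integral splits into int D(w) psi_xx - w (x psi)_x / (2t),
which for each t is a boundary term by the equation (D(f)' + eta f / 2)' = f / 2, and
int w (psi_t + (x psi)_x / (2t)), which is a total derivative along the rays x = eta sqrt t, on which
w is constant. The interface equation for a makes D(f)' + eta f / 2 continuous across eta = a.
*)
theory Submission
  imports Defs
begin

text \<open>The energy is placed on P rather than on Z because D is constant on the negative numbers
  when \<open>d\<^sub>v = 0\<close>: there Z = 0 says nothing about z, while P = 0 for all x yields
  z = 0 by differentiation in x. The inequality z Z >= c Z^2, with c = 1 / max(d_u, d_v), survives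
  this degeneracy. The linear term \<alpha>(t) x is the price of the boundary condition: test
  functions vanish at x = 0, so phi'' ranges only over functions h with int y h(y) dy = 0, and these
  cannot see multiples of x. The weight e^(-x) is there because z is only bounded, so that P may
  grow linearly. All functions are extended by zero to t <= 0; a backward difference then leaves no
  boundary term at t = 0. In the existence part the transport integrand carries a factor 1/t. The
  identities are therefore first proved on (eps, T), and the initial datum appears in the limit eps
  -> 0 as the value of f at infinity.\<close>

abbreviation lborel\<^sub>2 :: "(real \<times> real) measure" where
  "lborel\<^sub>2 \<equiv> lborel \<Otimes>\<^sub>M lborel"

section \<open>Integration on the line and the plane\<close>

text \<open>Added to the \<open>measurable\<close> rules for each concrete two-variable function, so
  that curried applications are handled automatically while the hypotheses speak about
  \<open>case_prod f\<close> on the product space.\<close>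

lemma measurable_app2:
  fixes f :: "real \<Rightarrow> real \<Rightarrow> real"
  assumes "case_prod f \<in> borel_measurable lborel\<^sub>2"
    and [measurable]: "g \<in> borel_measurable M" "h \<in> borel_measurable M"
  shows "(\<lambda>x. f (g x) (h x)) \<in> borel_measurable M"
proof -
  have [measurable]: "case_prod f \<in> borel_measurable (borel \<Otimes>\<^sub>M borel)"
    using assms(1) by (simp add: measurable_def sets_pair_measure_cong[of lborel borel lborel borel] space_pair_measure)
  have "(\<lambda>x. case_prod f (g x, h x)) \<in> borel_measurable M"
    by measurable
  then show ?thesis by simp
qed

lemma borel_measurable_interval_integral:
  fixes k :: "'a \<Rightarrow> real \<Rightarrow> real" and l u :: "'a \<Rightarrow> real"
  assumes [measurable]: "(\<lambda>p. k (fst p) (snd p)) \<in> borel_measurable (N \<Otimes>\<^sub>M lborel)"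
    "l \<in> borel_measurable N" "u \<in> borel_measurable N"
  shows "(\<lambda>a. \<integral>y. indicator {l a<..<u a} y * k a y \<partial>lborel) \<in> borel_measurable N"
proof -
  have [measurable]: "case_prod k \<in> borel_measurable (N \<Otimes>\<^sub>M lborel)"
    using assms(1) by (simp add: case_prod_beta')
  \<comment> \<open>The indicator becomes a condition on the pair of \<open>a\<close> and
    \<open>y\<close>, so the moving endpoints enter as measurable predicates.\<close>
  have "(\<lambda>a. \<integral>y. (if l a < y \<and> y < u a then k a y else 0) \<partial>lborel) \<in> borel_measurable N" by measurable
  also have "(\<lambda>a. \<integral>y. (if l a < y \<and> y < u a then k a y else 0) \<partial>lborel) = (\<lambda>a. \<integral>y. indicator {l a<..<u a} y * k a y \<partial>lborel)"
    by (auto intro!: ext Bochner_Integration.integral_cong simp: indicator_def)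
  finally show ?thesis .
qed

lemma integrable_bounded_support:
  fixes f :: "'a::euclidean_space \<Rightarrow> real"
  assumes f: "f \<in> borel_measurable lborel" and le: "\<And>x. \<bar>f x\<bar> \<le> K"
    and supp: "\<And>x. x \<notin> cbox a b \<Longrightarrow> f x = 0"
  shows "integrable lborel f"
proof (rule Bochner_Integration.integrable_bound[where f="\<lambda>x. K * indicator (cbox a b) x"])
  show "integrable lborel (\<lambda>x. K * indicator (cbox a b) x)"
    by (intro integrable_mult_right integrable_real_indicator) (auto simp: emeasure_lborel_cbox_eq)
  show "AE x in lborel. norm (f x) \<le> norm (K * indicator (cbox a b) x)"
    using le supp by (auto simp: indicator_def intro!: AE_I2 order_trans[OF le])
qed (use f in simp)

lemma integral_cbox_eq_lborel:
  fixes f :: "'a::euclidean_space \<Rightarrow> real"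
  assumes "integrable lborel (\<lambda>x. indicator (cbox a b) x * f x)"
  shows "f integrable_on cbox a b" "integral (cbox a b) f = (\<integral>x. indicator (cbox a b) x * f x \<partial>lborel)"
proof -
  have "set_integrable lborel (cbox a b) f"
    using assms by (simp add: set_integrable_def)
  from set_borel_integral_eq_integral[OF this]
  show "f integrable_on cbox a b" "integral (cbox a b) f = (\<integral>x. indicator (cbox a b) x * f x \<partial>lborel)"
    by (simp_all add: set_lebesgue_integral_def)
qed

text \<open>By Lebesgue differentiation, at almost every \<open>x\<close> the averages over cubes
  with lower corner \<open>x\<close> converge to \<open>f x\<close>, and all of these averages are
  zero.\<close>

lemma AE_zero_of_box_integrals:
  fixes f :: "'a::euclidean_space \<Rightarrow> real"
  assumes int: "\<And>a b. integrable lborel (\<lambda>x. indicator (cbox a b) x * f x)"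
    and zero: "\<And>a b. (\<integral>x. indicator (cbox a b) x * f x \<partial>lborel) = 0"
  shows "AE x in lborel. f x = 0"
proof -
  obtain N where N: "negligible N"
    and lim: "\<And>x e. \<lbrakk>x \<notin> N; 0 < e\<rbrakk> \<Longrightarrow> \<exists>d>0. \<forall>h. 0 < h \<and> h < d \<longrightarrow>
                 norm (integral (cbox x (x + h *\<^sub>R One)) f /\<^sub>R h ^ DIM('a) - f x) < e"
    using integrable_ccontinuous_explicit[OF integral_cbox_eq_lborel(1)[OF int]] by metis
  have z: "f x = 0" if xN: "x \<notin> N" for x
  proof (rule ccontr)
    assume "f x \<noteq> 0"
    then obtain d where "d > 0" and d: "\<forall>h. 0 < h \<and> h < d \<longrightarrow>
                 norm (integral (cbox x (x + h *\<^sub>R One)) f /\<^sub>R h ^ DIM('a) - f x) < \<bar>f x\<bar>"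
      using lim[OF xN, of "\<bar>f x\<bar>"] by auto
    then show False
      using d[rule_format, of "d/2"] by (simp add: integral_cbox_eq_lborel(2)[OF int] zero)
  qed
  have "AE x in lebesgue. f x = 0"
    using N z by (auto simp: negligible_iff_null_sets intro!: AE_I'[of N])
  then show ?thesis by (simp add: AE_completion_iff)
qed

text \<open>Differentiation over [t - h, t], obtained from forward intervals by the reflection
  \<open>g\<close>. The vanishing for \<open>x \<le> 0\<close> makes the formula for
  \<open>F t - F (t - h)\<close> correct also when \<open>t - h < 0\<close>.\<close>

lemma lebesgue_differentiation_backward:
  fixes f F :: "real \<Rightarrow> real"
  assumes f[measurable]: "f \<in> borel_measurable lborel" and le: "\<And>x. \<bar>f x\<bar> \<le> M"
    and zero: "\<And>x. x \<le> 0 \<Longrightarrow> f x = 0"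
  defines "F \<equiv> \<lambda>t. \<integral>s. indicator {0<..<t} s * f s \<partial>lborel"
  shows "AE t in lborel. (\<lambda>n. (F t - F (t - 1 / Suc n)) * Suc n) \<longlonglongrightarrow> f t"
proof -
  have M0: "0 \<le> M" using le[of 0] by linarith
  define g where "g x = f (- x)" for x
  have [measurable]: "g \<in> borel_measurable lborel" unfolding g_def by measurable
  have int: "integrable lborel (\<lambda>x. indicator (cbox a b) x * g x)" for a b
    using M0
    by (intro integrable_bounded_support[where K=M and a=a and b=b]) (auto simp: g_def indicator_def le)
  obtain N where N: "negligible N"
    and lim: "\<And>x e. \<lbrakk>x \<notin> N; 0 < e\<rbrakk> \<Longrightarrow> \<exists>d>0. \<forall>h. 0 < h \<and> h < d \<longrightarrow>
                 norm (integral (cbox x (x + h *\<^sub>R One)) g /\<^sub>R h ^ DIM(real) - g x) < e"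
    using integrable_ccontinuous_explicit[OF integral_cbox_eq_lborel(1)[OF int]] by metis
  have intf: "integrable lborel (\<lambda>s. indicator {a<..<b} s * f s)" for a b
    using M0
    by (intro integrable_bounded_support[where K=M and a=a and b=b]) (auto simp: indicator_def le)
  have avg: "(F t - F (t - h)) / h = integral (cbox (-t) (-t + h)) g / h" if "h > 0" for t h
  proof -
    have "F t - F (t - h) = (\<integral>s. indicator {0<..<t} s * f s - indicator {0<..<t-h} s * f s \<partial>lborel)"
      unfolding F_def by (rule Bochner_Integration.integral_diff[symmetric]) (rule intf)+
    also have "\<dots> = (\<integral>s. indicator {t-h..t} s * f s \<partial>lborel)"
    proof (rule integral_cong_AE)
      have "AE s in lborel. s \<noteq> t" "AE s in lborel. s \<noteq> t - h" by (rule AE_lborel_singleton)+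
      then show "AE s in lborel. indicator {0<..<t} s * f s - indicator {0<..<t-h} s * f s = indicator {t-h..t} s * f s"
        by eventually_elim (use \<open>h > 0\<close> zero in \<open>auto simp: indicator_def\<close>)
    qed auto
    also have "\<dots> = (\<integral>s. indicator {-t..-t+h} s * g s \<partial>lborel)"
      by (subst lborel_integral_real_affine[where c="-1" and t=0])
         (auto simp: g_def indicator_def intro!: Bochner_Integration.integral_cong)
    also have "\<dots> = integral (cbox (-t) (-t+h)) g"
      using integral_cbox_eq_lborel(2)[OF int, of "-t" "-t+h"] by simp
    finally show ?thesis by simp
  qed
  have "(\<lambda>n. (F t - F (t - 1 / Suc n)) * Suc n) \<longlonglongrightarrow> f t" if t: "- t \<notin> N" for t
  proof (rule LIMSEQ_I)
    fix e :: real assume "e > 0"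
    from lim[OF t this] obtain d where "d > 0" and d: "\<And>h. 0 < h \<Longrightarrow> h < d \<Longrightarrow> \<bar>integral {-t..-t + h} g / h - g (-t)\<bar> < e"
      by (auto simp: divide_inverse mult.commute)
    obtain n0 where n0: "1 / Suc n0 < d" using nat_approx_posE[OF \<open>d > 0\<close>] by metis
    have "norm ((F t - F (t - 1 / Suc n)) * Suc n - f t) < e" if "n \<ge> n0" for n
    proof -
      have "1 / Suc n \<le> 1 / Suc n0" using that by (simp add: frac_le)
      then have h: "0 < 1 / real (Suc n)" "1 / real (Suc n) < d" using n0 by auto
      show ?thesis using d[OF h] avg[OF h(1), of t] by (simp add: g_def)
    qed
    then show "\<exists>no. \<forall>n\<ge>no. norm ((F t - F (t - 1 / Suc n)) * Suc n - f t) < e" by blast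
  qed
  moreover have "AE t in lborel. - t \<notin> N"
  proof -
    have "AE x in lborel. x \<notin> N"
      using N AE_not_in[of N lebesgue] by (simp add: negligible_iff_null_sets AE_completion_iff)
    \<comment> \<open>\<open>N\<close> is only Lebesgue-null; a Borel null set containing it can be
      pulled back along the reflection.\<close>
    then obtain N' where N': "N' \<in> null_sets lborel" "N \<subseteq> N'"
      by (auto simp: eventually_ae_filter)
    have [measurable]: "N' \<in> sets borel" using N' by auto
    have "AE x in distr lborel borel uminus. x \<notin> N'"
      using AE_not_in[OF N'(1)] unfolding lborel_distr_uminus by simp
    then have "AE x in lborel. - x \<notin> N'"
      by (subst (asm) AE_distr_iff) auto
    then show ?thesis using N' by (auto elim!: eventually_mono)
  qed
  ultimately show ?thesis by (auto elim!: eventually_mono)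
qed

section \<open>Continuous approximations of indicators of intervals and boxes\<close>

definition plateau :: "real \<Rightarrow> real \<Rightarrow> nat \<Rightarrow> real \<Rightarrow> real" where
  "plateau a b n x = max 0 (min 1 (real n * min (x - a) (b - x)))"

lemma plateau_bounds: "0 \<le> plateau a b n x" "plateau a b n x \<le> 1" "\<bar>plateau a b n x\<bar> \<le> 1"
  by (auto simp: plateau_def)

lemma plateau_eq_0:
  assumes "x \<notin> {a<..<b}"
  shows "plateau a b n x = 0"
proof -
  have "min (x - a) (b - x) \<le> 0" using assms by auto
  then have "real n * min (x - a) (b - x) \<le> 0" by (intro mult_nonneg_nonpos) auto
  then show ?thesis by (simp add: plateau_def)
qed

lemma continuous_plateau: "continuous_on A (plateau a b n)"
  unfolding plateau_def by (intro continuous_intros)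

lemma plateau_LIMSEQ: "(\<lambda>n. plateau a b n x) \<longlonglongrightarrow> indicator {a<..<b} x"
proof (cases "x \<in> {a<..<b}")
  case True
  define m where "m = min (x - a) (b - x)"
  have "m > 0" using True by (auto simp: m_def)
  then obtain n0 where n0: "1 / Suc n0 < m" using nat_approx_posE by metis
  have "plateau a b n x = 1" if "n \<ge> Suc n0" for n
  proof -
    have "1 < real (Suc n0) * m" using n0 by (simp add: field_simps)
    also have "\<dots> \<le> real n * m" using that \<open>m > 0\<close> by (intro mult_right_mono) auto
    finally show ?thesis by (simp add: plateau_def m_def)
  qed
  then have "eventually (\<lambda>n. plateau a b n x = 1) sequentially"
    by (auto simp: eventually_sequentially)
  then show ?thesis using True by (simp add: tendsto_eventually)
qed (simp add: plateau_eq_0)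

lemma AE_off_axes: "AE p::real\<times>real in lborel. fst p \<noteq> c \<and> snd p \<noteq> c"
proof -
  have "negligible {p::real\<times>real. p \<bullet> (1,0) = c}" "negligible {p::real\<times>real. p \<bullet> (0,1) = c}"
    by (intro negligible_standard_hyperplane; simp add: Basis_prod_def)+
  then have "AE p in lebesgue. p \<notin> {p::real\<times>real. p \<bullet> (1,0) = c} \<and> p \<notin> {p::real\<times>real. p \<bullet> (0,1) = c}"
    by (intro AE_conjI AE_not_in) (auto simp: negligible_iff_null_sets)
  then show ?thesis by (simp add: AE_completion_iff inner_prod_def)
qed

text \<open>Products of plateaus, trapezoids of slope \<open>n\<close> inside an open interval, tend
  to the indicator of an open box, so the integral of \<open>F\<close> over every box vanishes.
  Being continuous, they are admissible in the separated weak form. That form tests only inside the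
  open quadrant, hence the boxes are clipped at 0, where \<open>F\<close> vanishes anyway.\<close>

lemma box_integral_zero_of_plateaus:
  fixes F :: "real \<Rightarrow> real \<Rightarrow> real"
  assumes [measurable]: "case_prod F \<in> borel_measurable lborel\<^sub>2"
    and bdd: "\<And>r. \<exists>K. \<forall>x t. \<bar>x\<bar> \<le> r \<longrightarrow> \<bar>t\<bar> \<le> r \<longrightarrow> \<bar>F x t\<bar> \<le> K"
    and supp: "\<And>x t. x \<le> 0 \<or> t \<le> 0 \<Longrightarrow> F x t = 0"
    and zero: "\<And>a b c d n. 0 \<le> a \<Longrightarrow> 0 \<le> c \<Longrightarrow>
        (\<integral>p. F (fst p) (snd p) * (plateau a b n (fst p) * plateau c d n (snd p)) \<partial>lborel\<^sub>2) = 0"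
  shows "AE p in lborel\<^sub>2. F (fst p) (snd p) = 0"
proof -
  have [measurable]: "(\<lambda>p. F (fst p) (snd p)) \<in> borel_measurable lborel"
    using assms(1) by (simp add: case_prod_beta' lborel_prod)
  have int: "integrable lborel (\<lambda>p. indicator (cbox a b) p * F (fst p) (snd p))" for a b :: "real \<times> real"
  proof -
    have "bounded (cbox a b)" by simp
    then obtain r where r: "\<And>p. p \<in> cbox a b \<Longrightarrow> norm p \<le> r" unfolding bounded_iff by blast
    obtain K where K: "\<And>x t. \<bar>x\<bar> \<le> r \<Longrightarrow> \<bar>t\<bar> \<le> r \<Longrightarrow> \<bar>F x t\<bar> \<le> K" using bdd by metis
    have "\<bar>F (fst p) (snd p)\<bar> \<le> K" if "p \<in> cbox a b" for p
      using r[OF that] norm_fst_le[of "fst p" "snd p"] norm_snd_le[of "snd p" "fst p"] by (intro K) auto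
    then have "\<bar>indicator (cbox a b) p * F (fst p) (snd p)\<bar> \<le> \<bar>K\<bar>" for p
      by (auto simp: indicator_def intro: order_trans[OF _ abs_ge_self])
    then show ?thesis
      by (intro integrable_bounded_support[where K="\<bar>K\<bar>" and a=a and b=b]) auto
  qed
  have "AE p in lborel. F (fst p) (snd p) = 0"
  proof (rule AE_zero_of_box_integrals[OF int])
    fix a b :: "real \<times> real"
    obtain a1 a2 b1 b2 where ab: "a = (a1, a2)" "b = (b1, b2)" by (metis surj_pair)
    let ?f = "\<lambda>p. F (fst p) (snd p)"
    let ?s = "\<lambda>n p. ?f p * (plateau (max a1 0) b1 n (fst p) * plateau (max a2 0) b2 n (snd p))"
    have [measurable]: "plateau u v n \<in> borel_measurable borel" for u v n
      by (intro borel_measurable_continuous_onI continuous_plateau)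
    have "(\<lambda>n. \<integral>p. ?s n p \<partial>lborel) \<longlonglongrightarrow> (\<integral>p. indicator (cbox a b) p * ?f p \<partial>lborel)"
    proof (rule integral_dominated_convergence[where w="\<lambda>p. \<bar>indicator (cbox a b) p * ?f p\<bar>"])
      \<comment> \<open>On the edges of the box all plateaus vanish while the closed box contains
        them; the edges form a null set.\<close>
      show "AE p in lborel. (\<lambda>n. ?s n p) \<longlonglongrightarrow> indicator (cbox a b) p * ?f p"
        using AE_off_axes[of a1] AE_off_axes[of a2] AE_off_axes[of b1] AE_off_axes[of b2]
      proof eventually_elim
        case (elim p)
        have "(\<lambda>n. ?s n p) \<longlonglongrightarrow> ?f p * (indicator {max a1 0<..<b1} (fst p) * indicator {max a2 0<..<b2} (snd p))"
          by (intro tendsto_intros plateau_LIMSEQ)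
        also have "?f p * (indicator {max a1 0<..<b1} (fst p) * indicator {max a2 0<..<b2} (snd p)) =
            indicator (cbox a b) p * ?f p"
          using elim supp[of "fst p" "snd p"] by (cases p) (auto simp: indicator_def ab)
        finally show ?case .
      qed
      show "AE p in lborel. norm (?s n p) \<le> \<bar>indicator (cbox a b) p * ?f p\<bar>" for n
      proof (rule AE_I2)
        fix p :: "real \<times> real"
        show "norm (?s n p) \<le> \<bar>indicator (cbox a b) p * ?f p\<bar>"
        proof (cases "p \<in> cbox a b")
          case True
          have "\<bar>plateau (max a1 0) b1 n (fst p) * plateau (max a2 0) b2 n (snd p)\<bar> \<le> 1 * 1"
            unfolding abs_mult by (intro mult_mono plateau_bounds) auto
          then show ?thesis using True by (simp add: abs_mult mult_left_le)
        next
          case False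
          then show ?thesis using plateau_eq_0[of "fst p" "max a1 0" b1 n] plateau_eq_0[of "snd p" "max a2 0" b2 n]
            by (cases p) (auto simp: ab)
        qed
      qed
    qed (use int in \<open>auto simp: borel_prod[symmetric] lborel_prod[symmetric]\<close>)
    moreover have "(\<integral>p. ?s n p \<partial>lborel) = 0" for n
      using zero[of "max a1 0" "max a2 0" b1 n b2] by (simp add: lborel_prod)
    ultimately show "(\<integral>p. indicator (cbox a b) p * ?f p \<partial>lborel) = 0"
      by (simp add: LIMSEQ_const_iff)
  qed
  then show ?thesis unfolding lborel_prod .
qed

section \<open>Exponential weights\<close>

lemma exponential_tail:
  fixes c a :: real
  assumes c: "c > 0"
  shows "integrable lborel (\<lambda>y. indicator {a<..} y * exp (- (c * y)))"
    and "(\<integral>y. indicator {a<..} y * exp (- (c * y)) \<partial>lborel) = exp (- (c * a)) / c"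
proof -
  have hi: "((\<lambda>y. exp (- (c * y))) has_integral exp (- (c * a)) / c) {a..}"
    using has_integral_exp_minus_to_infinity[OF c, of a] by simp
  then have "(\<lambda>y. exp (- (c * y))) absolutely_integrable_on {a..}"
    by (intro nonnegative_absolutely_integrable_1) (auto simp: integrable_on_def)
  then have "integrable lborel (\<lambda>y. indicator {a..} y * exp (- (c * y)))"
    unfolding set_integrable_def by (subst (asm) integrable_completion) auto
  then have si: "set_integrable lborel {a..} (\<lambda>y. exp (- (c * y)))"
    by (simp add: set_integrable_def)
  have ae: "AE y in lborel. indicator {a..} y * exp (- (c * y)) = indicator {a<..} y * exp (- (c * y))"
    using AE_lborel_singleton[of a] by eventually_elim (auto simp: indicator_def)
  show "integrable lborel (\<lambda>y. indicator {a<..} y * exp (- (c * y)))"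
    using si ae unfolding set_integrable_def by (subst integrable_cong_AE[symmetric]) auto
  have "(\<integral>y. indicator {a<..} y * exp (- (c * y)) \<partial>lborel) = (\<integral>y. indicator {a..} y * exp (- (c * y)) \<partial>lborel)"
    using ae by (intro integral_cong_AE) (auto elim!: eventually_mono)
  also have "\<dots> = exp (- (c * a)) / c"
    using set_borel_integral_eq_integral(2)[OF si] integral_unique[OF hi] by (simp add: set_lebesgue_integral_def)
  finally show "(\<integral>y. indicator {a<..} y * exp (- (c * y)) \<partial>lborel) = exp (- (c * a)) / c" .
qed

lemma integrable_tensor:
  fixes f g :: "real \<Rightarrow> real"
  assumes "integrable lborel f" "integrable lborel g"
  shows "integrable lborel\<^sub>2 (\<lambda>p. f (fst p) * g (snd p))"
proof -
  have [measurable]: "f \<in> borel_measurable borel" "g \<in> borel_measurable borel"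
    using assms by (auto dest: borel_measurable_integrable)
  have "integrable lborel\<^sub>2 (\<lambda>(x, y). f x * g y)"
  proof (rule lborel_pair.Fubini_integrable)
    have "integrable lborel (\<lambda>x. \<bar>f x\<bar> * (\<integral>y. \<bar>g y\<bar> \<partial>lborel))"
      using assms by (intro integrable_mult_left) auto
    then show "integrable lborel (\<lambda>x. \<integral>y. norm (case (x, y) of (x, y) \<Rightarrow> f x * g y) \<partial>lborel)"
      by (simp add: abs_mult)
  qed (use assms in auto)
  then show ?thesis by (simp add: case_prod_beta')
qed

lemma integrable_exponential_bound:
  fixes k :: "real \<Rightarrow> real \<Rightarrow> real"
  assumes k: "case_prod k \<in> borel_measurable lborel\<^sub>2" and c: "c > 0" "d > 0"
    and le: "\<And>x y. \<bar>k x y\<bar> \<le> C * ((indicator {0<..} x * exp (- (c * x))) * (indicator {0<..} y * exp (- (d * y))))"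
  shows "integrable lborel\<^sub>2 (case_prod k)"
proof (rule Bochner_Integration.integrable_bound[OF _ k])
  show "integrable lborel\<^sub>2 (\<lambda>p. C * ((indicator {0<..} (fst p) * exp (- (c * fst p))) * (indicator {0<..} (snd p) * exp (- (d * snd p)))))"
    by (intro integrable_mult_right integrable_tensor exponential_tail c)
  show "AE p in lborel\<^sub>2. norm (case_prod k p) \<le> norm (C * ((indicator {0<..} (fst p) * exp (- (c * fst p))) * (indicator {0<..} (snd p) * exp (- (d * snd p)))))"
    using order_trans[OF le abs_ge_self] by (auto intro!: AE_I2)
qed

text \<open>Absorbs linear growth into an exponential of any positive rate; the factors 5, 3 and 1 +
  8 in the estimates below are \<open>1 + 1/c\<close> for the rates 1/4, 1/2 and 1/8.\<close>

lemma linear_le_exp: "c > 0 \<Longrightarrow> 0 \<le> x \<Longrightarrow> 1 + x \<le> (1 + 1/c) * exp (c * x)" for c x :: real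
proof -
  assume c: "c > 0" and x: "0 \<le> x"
  have "1 + x \<le> (1 + 1/c) * (1 + c * x)" using c x by (simp add: field_simps)
  also have "\<dots> \<le> (1 + 1/c) * exp (c * x)" using c by (intro mult_left_mono exp_ge_add_one_self) auto
  finally show ?thesis .
qed

text \<open>Fubini on the triangle \<open>a < x < y\<close>. The single weight e^(-y) has to control
  growth in both variables, and it can because \<open>x < y\<close> allows half of it to be given to
  \<open>x\<close>.\<close>

lemma exponential_swap:
  fixes g k :: "real \<Rightarrow> real"
  assumes g[measurable]: "g \<in> borel_measurable lborel" and k[measurable]: "k \<in> borel_measurable lborel"
    and gb: "\<And>x. 0 < x \<Longrightarrow> \<bar>g x\<bar> \<le> K * (1 + x)" and kb: "\<And>y. 0 < y \<Longrightarrow> \<bar>k y\<bar> \<le> C * (1 + y)"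
    and a: "0 \<le> a"
  shows "(\<integral>x. indicator {a<..} x * g x * (\<integral>y. indicator {x<..} y * (exp (- y) * k y) \<partial>lborel) \<partial>lborel)
     = (\<integral>y. indicator {a<..} y * exp (- y) * (k y * (\<integral>x. indicator {a<..<y} x * g x \<partial>lborel)) \<partial>lborel)"
proof -
  define h where "h x y = (if a < x \<and> x < y then g x * (exp (- y) * k y) else 0)" for x y
  have [measurable]: "case_prod h \<in> borel_measurable lborel\<^sub>2"
    unfolding h_def by measurable
  have KC: "K \<ge> 0" "C \<ge> 0" using gb[of 1] kb[of 1] by (auto intro: order_trans[of _ "\<bar>_\<bar> / 2"])
  have "integrable lborel\<^sub>2 (case_prod h)"
  proof (rule integrable_exponential_bound[where c="1/4" and d="1/4" and C="25 * (K * C)"])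
    fix x y
    have "\<bar>g x * (exp (- y) * k y)\<bar> \<le> 25 * (K * C) * (exp (- (1/4 * x)) * exp (- (1/4 * y)))" if "a < x" "x < y"
    proof -
      have xy: "0 < x" "0 < y" using that a by auto
      have "\<bar>g x * (exp (- y) * k y)\<bar> = \<bar>g x\<bar> * \<bar>k y\<bar> * exp (- y)" by (simp add: abs_mult)
      \<comment> \<open>Since \<open>x < y\<close>, e^(-y) \<le> e^(-x/2 - y/2); half of each of
        these rates then absorbs the linear factors.\<close>
      also have "\<dots> \<le> (K * (1 + x)) * (C * (1 + y)) * exp (- (1/2 * x) - 1/2 * y)"
        using xy that KC by (intro mult_mono gb kb mult_nonneg_nonneg) auto
      also have "\<dots> \<le> (K * (5 * exp (1/4 * x))) * (C * (5 * exp (1/4 * y))) * exp (- (1/2 * x) - 1/2 * y)"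
        using linear_le_exp[of "1/4" x] linear_le_exp[of "1/4" y] xy KC
        by (intro mult_mono mult_right_mono mult_left_mono mult_nonneg_nonneg) auto
      also have "\<dots> = 25 * (K * C) * (exp (1/4 * x) * exp (1/4 * y) * exp (- (1/2 * x) - 1/2 * y))" by simp
      also have "exp (1/4 * x) * exp (1/4 * y) * exp (- (1/2 * x) - 1/2 * y) = exp (- (1/4 * x)) * exp (- (1/4 * y))"
        by (simp flip: exp_add)
      finally show ?thesis .
    qed
    then show "\<bar>h x y\<bar> \<le> 25 * (K * C) * ((indicator {0<..} x * exp (- (1/4 * x))) * (indicator {0<..} y * exp (- (1/4 * y))))"
      using a KC by (auto simp: h_def indicator_def)
  qed auto
  then have "(\<integral>y. \<integral>x. h x y \<partial>lborel \<partial>lborel) = (\<integral>x. \<integral>y. h x y \<partial>lborel \<partial>lborel)"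
    by (rule lborel_pair.Fubini_integral)
  moreover have "(\<integral>y. h x y \<partial>lborel) = indicator {a<..} x * g x * (\<integral>y. indicator {x<..} y * (exp (- y) * k y) \<partial>lborel)" for x
    unfolding integral_mult_right_zero[symmetric]
    by (intro Bochner_Integration.integral_cong) (auto simp: h_def indicator_def)
  moreover have "(\<integral>x. h x y \<partial>lborel) = indicator {a<..} y * exp (- y) * (k y * (\<integral>x. indicator {a<..<y} x * g x \<partial>lborel))" for y
    unfolding integral_mult_right_zero[symmetric]
    by (intro Bochner_Integration.integral_cong) (auto simp: h_def indicator_def)
  ultimately show ?thesis by simp
qed

lemma exponential_weight_integrable:
  fixes k :: "real \<Rightarrow> real"
  assumes k[measurable]: "k \<in> borel_measurable lborel" and kb: "\<And>y. 0 < y \<Longrightarrow> \<bar>k y\<bar> \<le> C * (1 + y)"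
    and a: "0 \<le> a"
  shows "integrable lborel (\<lambda>y. indicator {a<..} y * (exp (- y) * k y))"
proof (rule Bochner_Integration.integrable_bound)
  have C: "C \<ge> 0" using kb[of 1] by (auto intro: order_trans[of _ "\<bar>_\<bar> / 2"])
  show "integrable lborel (\<lambda>y. (C * 3) * (indicator {a<..} y * exp (- (1/2 * y))))"
    by (intro integrable_mult_right exponential_tail) auto
  show "AE y in lborel. norm (indicator {a<..} y * (exp (- y) * k y)) \<le> norm ((C * 3) * (indicator {a<..} y * exp (- (1/2 * y))))"
  proof (rule AE_I2)
    fix y :: real
    have "\<bar>exp (- y) * k y\<bar> \<le> (C * 3) * exp (- (1/2 * y))" if "a < y"
    proof -
      have "\<bar>exp (- y) * k y\<bar> = \<bar>k y\<bar> * exp (- y)" by (simp add: abs_mult)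
      also have "\<dots> \<le> (C * (3 * exp (1/2 * y))) * exp (- y)"
        using linear_le_exp[of "1/2" y] that a C order_trans[OF kb[of y], of "C * (3 * exp (1/2 * y))"]
        by (intro mult_right_mono) (auto intro: mult_left_mono)
      also have "\<dots> = (C * 3) * (exp (1/2 * y) * exp (- y))" by simp
      also have "exp (1/2 * y) * exp (- y) = exp (- (1/2 * y))" by (simp flip: exp_add)
      finally show ?thesis .
    qed
    then show "norm (indicator {a<..} y * (exp (- y) * k y)) \<le> norm ((C * 3) * (indicator {a<..} y * exp (- (1/2 * y))))"
      using C by (auto simp: indicator_def)
  qed
qed auto

text \<open>Formally int e^(-x) u' P = - int u (e^(-x) P)' with u' = p and P' = z; there are no
  boundary terms because u(0) = 0 and the exponential beats the growth of u P. As \<open>p\<close>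
  and \<open>z\<close> are merely measurable, \<open>exponential_swap\<close> is applied twice
  instead of differentiating.\<close>

lemma exponential_integration_by_parts:
  fixes p z P u :: "real \<Rightarrow> real"
  assumes p[measurable]: "p \<in> borel_measurable lborel" and z[measurable]: "z \<in> borel_measurable lborel"
    and pb: "\<And>x. 0 < x \<Longrightarrow> \<bar>p x\<bar> \<le> K * (1 + x)" and zb: "\<And>x. \<bar>z x\<bar> \<le> M"
    and P: "\<And>x. P x = \<alpha> + (\<integral>y. indicator {0<..<x} y * z y \<partial>lborel)"
    and u: "\<And>x. u x = (\<integral>y. indicator {0<..<x} y * p y \<partial>lborel)"
  shows "(\<integral>x. indicator {0<..} x * exp (- x) * (p x * P x) \<partial>lborel)
     = - (\<integral>x. indicator {0<..} x * exp (- x) * (u x * (z x - P x)) \<partial>lborel)"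
proof -
  have M: "M \<ge> 0" using zb[of 0] by linarith
  have [measurable]: "P \<in> borel_measurable lborel"
    unfolding case_prod_beta' P by (intro borel_measurable_add borel_measurable_interval_integral; measurable)
  have iz: "integrable lborel (\<lambda>y. indicator {a<..<b} y * z y)" for a b
    by (rule integrable_bounded_support[where K=M and a=a and b=b]) (use M zb in \<open>auto simp: indicator_def\<close>)
  have Pd: "P y = P x + (\<integral>s. indicator {x<..<y} s * z s \<partial>lborel)" if "0 < x" "x < y" for x y
  proof -
    have "AE s in lborel. indicator {0<..<y} s * z s = indicator {0<..<x} s * z s + indicator {x<..<y} s * z s"
      using AE_lborel_singleton[of x] by eventually_elim (use that in \<open>auto simp: indicator_def\<close>)
    then have "(\<integral>s. indicator {0<..<y} s * z s \<partial>lborel) = (\<integral>s. indicator {0<..<x} s * z s + indicator {x<..<y} s * z s \<partial>lborel)"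
      by (intro integral_cong_AE) auto
    then show ?thesis by (simp add: P iz)
  qed
  have Pb: "\<bar>P x\<bar> \<le> (\<bar>\<alpha>\<bar> + M) * (1 + x)" if "0 < x" for x
  proof -
    have iM: "integrable lborel (\<lambda>s. M * indicator {0<..<x} s)"
      by (intro integrable_mult_right integrable_real_indicator) (use that in auto)
    have "\<bar>\<integral>s. indicator {0<..<x} s * z s \<partial>lborel\<bar> \<le> (\<integral>s. \<bar>indicator {0<..<x} s * z s\<bar> \<partial>lborel)"
      by (rule integral_abs_bound)
    also have "\<dots> \<le> (\<integral>s. M * indicator {0<..<x} s \<partial>lborel)"
      by (rule integral_mono[OF integrable_abs[OF iz] iM]) (use zb M in \<open>simp add: indicator_def\<close>)
    also have "\<dots> = M * x" using that by simp
    finally have "\<bar>P x\<bar> \<le> \<bar>\<alpha>\<bar> + M * x" unfolding P by linarith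
    also have "\<dots> \<le> (\<bar>\<alpha>\<bar> + M) * (1 + x)" using that M by (simp add: algebra_simps)
    finally show ?thesis .
  qed
  have zb': "\<bar>z x\<bar> \<le> M * (1 + x)" if "0 < x" for x
    using zb[of x] mult_left_mono[of 1 "1 + x" M] M that by simp
  have zPb: "\<bar>z x - P x\<bar> \<le> (\<bar>\<alpha>\<bar> + 2 * M) * (1 + x)" if "0 < x" for x
    using zb'[OF that] Pb[OF that] by (simp add: algebra_simps)
  \<comment> \<open>Integrated form of (e^(-y) P)' = e^(-y) (z - P), from \<open>x\<close> to
    infinity.\<close>
  have *: "exp (- x) * P x = - (\<integral>y. indicator {x<..} y * (exp (- y) * (z y - P y)) \<partial>lborel)" if x: "0 < x" for x
  proof -
    have i1: "integrable lborel (\<lambda>y. indicator {x<..} y * (exp (- y) * z y))"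
      by (rule exponential_weight_integrable[OF z zb']) (use x in auto)
    have i2: "integrable lborel (\<lambda>y. indicator {x<..} y * (exp (- y) * P y))"
      by (rule exponential_weight_integrable[OF _ Pb]) (use x in auto)
    have i3: "integrable lborel (\<lambda>y. indicator {x<..} y * exp (- y))"
      using exponential_tail(1)[of 1 x] by simp
    let ?k = "\<lambda>y. \<integral>s. indicator {x<..<y} s * z s \<partial>lborel"
    have i4: "integrable lborel (\<lambda>y. indicator {x<..} y * exp (- y) * ?k y)"
    proof -
      have "integrable lborel (\<lambda>y. indicator {x<..} y * (exp (- y) * P y) - P x * (indicator {x<..} y * exp (- y)))"
        by (intro Bochner_Integration.integrable_diff i2 integrable_mult_right i3)
      also have "(\<lambda>y. indicator {x<..} y * (exp (- y) * P y) - P x * (indicator {x<..} y * exp (- y))) = (\<lambda>y. indicator {x<..} y * exp (- y) * ?k y)"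
        using Pd[OF x] by (auto simp: indicator_def algebra_simps)
      finally show ?thesis .
    qed
    have "(\<integral>y. indicator {x<..} y * (exp (- y) * P y) \<partial>lborel)
       = (\<integral>y. P x * (indicator {x<..} y * exp (- y)) + indicator {x<..} y * exp (- y) * ?k y \<partial>lborel)"
      using Pd[OF x] by (intro Bochner_Integration.integral_cong) (auto simp: indicator_def algebra_simps)
    also have "\<dots> = P x * exp (- x) + (\<integral>y. indicator {x<..} y * exp (- y) * ?k y \<partial>lborel)"
      using exponential_tail(2)[of 1 x] i3 i4 by simp
    also have "(\<integral>y. indicator {x<..} y * exp (- y) * ?k y \<partial>lborel)
        = (\<integral>s. indicator {x<..} s * z s * (\<integral>y. indicator {s<..} y * exp (- y) \<partial>lborel) \<partial>lborel)"
      using exponential_swap[where g=z and k="\<lambda>_. 1" and C=1 and a=x, OF z _ zb'] x by simp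
    also have "\<dots> = (\<integral>y. indicator {x<..} y * (exp (- y) * z y) \<partial>lborel)"
      using exponential_tail(2)[of 1] by (simp add: mult_ac)
    finally show ?thesis using i1 i2 by (simp add: right_diff_distrib mult_ac)
  qed
  have "(\<integral>x. indicator {0<..} x * exp (- x) * (p x * P x) \<partial>lborel)
      = (\<integral>x. - (indicator {0<..} x * p x * (\<integral>y. indicator {x<..} y * (exp (- y) * (z y - P y)) \<partial>lborel)) \<partial>lborel)"
  proof (rule Bochner_Integration.integral_cong)
    fix x
    have "exp (- x) * (p x * P x) = p x * (exp (- x) * P x)" by simp
    then show "indicator {0<..} x * exp (- x) * (p x * P x) =
        - (indicator {0<..} x * p x * (\<integral>y. indicator {x<..} y * (exp (- y) * (z y - P y)) \<partial>lborel))"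
      using *[of x] by (cases "0 < x") auto
  qed simp
  \<comment> \<open>Second exchange, with \<open>g = p\<close>: the inner integral of
    \<open>p\<close> over (0, y) is \<open>u y\<close>.\<close>
  also have "\<dots> = - (\<integral>x. indicator {0<..} x * exp (- x) * ((z x - P x) * u x) \<partial>lborel)"
    using exponential_swap[where g=p and k="\<lambda>y. z y - P y" and a=0, OF p _ pb zPb] by (simp add: u)
  finally show ?thesis by (simp add: mult_ac)
qed

section \<open>Translations and limits of difference quotients\<close>

lemma AE_lborel_translate:
  fixes c :: "'a::euclidean_space"
  assumes "AE p in lborel. Q p"
  shows "AE p in lborel. Q (p - c)"
proof -
  obtain N where N: "N \<in> null_sets lborel" "{p. \<not> Q p} \<subseteq> N"
    using assms by (auto simp: eventually_ae_filter)
  have [measurable]: "N \<in> sets borel" using N by auto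
  have "AE x in distr lborel borel ((+) (- c)). x \<notin> N"
    using AE_not_in[OF N(1)] unfolding lborel_distr_plus by simp
  then have "AE x in lborel. - c + x \<notin> N"
    by (subst (asm) AE_distr_iff) auto
  then show ?thesis using N by (auto elim!: eventually_mono)
qed

text \<open>Convergence with countable quantifiers only, so that the set of points of convergence is
  measurable and statements on almost every line can be turned into statements on almost all of the
  plane.\<close>

lemma LIMSEQ_iff_inverse_Suc:
  fixes a :: "nat \<Rightarrow> real"
  shows "a \<longlonglongrightarrow> l \<longleftrightarrow> (\<forall>k. \<exists>N. \<forall>n\<ge>N. \<bar>a n - l\<bar> < 1 / Suc k)"
proof
  assume "\<forall>k. \<exists>N. \<forall>n\<ge>N. \<bar>a n - l\<bar> < 1 / Suc k"
  then show "a \<longlonglongrightarrow> l"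
    unfolding LIMSEQ_def dist_real_def by (metis nat_approx_posE order_less_trans)
qed (auto simp: LIMSEQ_def dist_real_def)

lemma exp_difference_quotient_LIMSEQ:
  "(\<lambda>n. real (Suc n) * (1 - exp (- (\<mu> / Suc n)))) \<longlonglongrightarrow> \<mu>"
proof -
  have "((\<lambda>x. 1 - exp (- (\<mu> * x))) has_real_derivative \<mu>) (at 0)"
    by (auto intro!: derivative_eq_intros)
  then have "((\<lambda>h. (1 - exp (- (\<mu> * h))) / h) \<longlongrightarrow> \<mu>) (at 0)"
    by (simp add: DERIV_def)
  moreover have "filterlim (\<lambda>n. 1 / real (Suc n)) (at 0) sequentially"
    using LIMSEQ_Suc[OF lim_1_over_n] by (auto simp: filterlim_at)
  ultimately have "(\<lambda>n. (1 - exp (- (\<mu> * (1 / real (Suc n))))) / (1 / real (Suc n))) \<longlonglongrightarrow> \<mu>"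
    by (rule filterlim_compose)
  then show ?thesis by (simp add: mult.commute)
qed

section \<open>The energy argument\<close>

definition poly_bounded :: "nat \<Rightarrow> (real \<Rightarrow> real \<Rightarrow> real) \<Rightarrow> bool" where
  "poly_bounded n k \<longleftrightarrow> (\<exists>C\<ge>0. \<forall>x>0. \<forall>t>0. \<bar>k x t\<bar> \<le> C * ((1 + x) * (1 + t)) ^ n)"

lemma poly_bounded_mono:
  assumes "poly_bounded n k" "n \<le> m"
  shows "poly_bounded m k"
proof -
  obtain C where C: "C \<ge> 0" "\<And>x t. 0 < x \<Longrightarrow> 0 < t \<Longrightarrow> \<bar>k x t\<bar> \<le> C * ((1 + x) * (1 + t)) ^ n"
    using assms(1) unfolding poly_bounded_def by blast
  have "\<bar>k x t\<bar> \<le> C * ((1 + x) * (1 + t)) ^ m" if "0 < x" "0 < t" for x t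
  proof -
    have "1 * 1 \<le> (1 + x) * (1 + t)" using that by (intro mult_mono) auto
    then have "((1 + x) * (1 + t)) ^ n \<le> ((1 + x) * (1 + t)) ^ m"
      using assms(2) by (intro power_increasing) auto
    then show ?thesis using C(1) order_trans[OF C(2)[OF that]] by (auto intro: mult_left_mono)
  qed
  then show ?thesis unfolding poly_bounded_def using C(1) by blast
qed

lemma poly_bounded_mult:
  assumes "poly_bounded n k" "poly_bounded m l"
  shows "poly_bounded (n + m) (\<lambda>x t. k x t * l x t)"
proof -
  obtain C where C: "C \<ge> 0" "\<And>x t. 0 < x \<Longrightarrow> 0 < t \<Longrightarrow> \<bar>k x t\<bar> \<le> C * ((1 + x) * (1 + t)) ^ n"
    using assms(1) unfolding poly_bounded_def by blast
  obtain D where D: "D \<ge> 0" "\<And>x t. 0 < x \<Longrightarrow> 0 < t \<Longrightarrow> \<bar>l x t\<bar> \<le> D * ((1 + x) * (1 + t)) ^ m"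
    using assms(2) unfolding poly_bounded_def by blast
  have "\<bar>k x t * l x t\<bar> \<le> (C * D) * ((1 + x) * (1 + t)) ^ (n + m)" if "0 < x" "0 < t" for x t
    using mult_mono[OF C(2)[OF that] D(2)[OF that]] C(1) that by (simp add: abs_mult power_add mult_ac)
  then show ?thesis unfolding poly_bounded_def using C(1) D(1) by (intro exI[of _ "C * D"]) auto
qed

lemma poly_bounded_diff:
  assumes "poly_bounded n k" "poly_bounded n l"
  shows "poly_bounded n (\<lambda>x t. k x t - l x t)"
proof -
  obtain C where C: "C \<ge> 0" "\<And>x t. 0 < x \<Longrightarrow> 0 < t \<Longrightarrow> \<bar>k x t\<bar> \<le> C * ((1 + x) * (1 + t)) ^ n"
    using assms(1) unfolding poly_bounded_def by blast
  obtain D where D: "D \<ge> 0" "\<And>x t. 0 < x \<Longrightarrow> 0 < t \<Longrightarrow> \<bar>l x t\<bar> \<le> D * ((1 + x) * (1 + t)) ^ n"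
    using assms(2) unfolding poly_bounded_def by blast
  have "\<bar>k x t - l x t\<bar> \<le> (C + D) * ((1 + x) * (1 + t)) ^ n" if "0 < x" "0 < t" for x t
    using C(2)[OF that] D(2)[OF that] by (simp add: distrib_right)
  then show ?thesis unfolding poly_bounded_def using C(1) D(1) by (intro exI[of _ "C + D"]) auto
qed

lemma poly_bounded_shift:
  assumes "poly_bounded n k" "0 < h" "\<And>x t. t \<le> 0 \<Longrightarrow> k x t = 0"
  shows "poly_bounded n (\<lambda>x t. k x (t - h))"
proof -
  obtain C where C: "C \<ge> 0" "\<And>x t. 0 < x \<Longrightarrow> 0 < t \<Longrightarrow> \<bar>k x t\<bar> \<le> C * ((1 + x) * (1 + t)) ^ n"
    using assms(1) unfolding poly_bounded_def by blast
  have "\<bar>k x (t - h)\<bar> \<le> C * ((1 + x) * (1 + t)) ^ n" if "0 < x" "0 < t" for x t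
  proof (cases "0 < t - h")
    case True
    have "((1 + x) * (1 + (t - h))) ^ n \<le> ((1 + x) * (1 + t)) ^ n"
      using that True assms(2) by (intro power_mono mult_mono) auto
    then show ?thesis using C(1) order_trans[OF C(2)[OF that(1) True]] by (auto intro: mult_left_mono)
  qed (use assms(3) C(1) that in auto)
  then show ?thesis unfolding poly_bounded_def using C(1) by blast
qed

text \<open>Half of the decay in each variable pays for the polynomial: the linear bounds with rates
  1/8 and \<mu>/8, raised to the fourth power, cost e^(x/2) and e^(\<mu> t/2). Degree 4 covers all
  products in the energy argument; the largest is \<open>U\<close> (degree 2) times
  \<open>z - P\<close> (degree 1).\<close>

lemma integrable_exponential_poly_bounded:
  assumes km: "case_prod k \<in> borel_measurable lborel\<^sub>2" and kb: "poly_bounded 4 k" and \<mu>: "\<mu> > 0"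
  shows "integrable lborel\<^sub>2
    (\<lambda>(x, t). (indicator {0<..} x * exp (- x)) * (indicator {0<..} t * exp (- (\<mu> * t))) * k x t)"
proof -
  note [measurable (raw)] = measurable_app2[OF km]
  obtain C where C: "C \<ge> 0" "\<And>x t. 0 < x \<Longrightarrow> 0 < t \<Longrightarrow> \<bar>k x t\<bar> \<le> C * ((1 + x) * (1 + t)) ^ 4"
    using kb unfolding poly_bounded_def by blast
  define L where "L = C * ((1 + 8) * (1 + 8 / \<mu>)) ^ 4"
  show ?thesis
  proof (rule integrable_exponential_bound[where c="1/2" and d="\<mu>/2" and C=L])
    fix x t :: real
    have "\<bar>exp (- x) * exp (- (\<mu> * t)) * k x t\<bar> \<le> L * (exp (- (1/2 * x)) * exp (- (\<mu>/2 * t)))" if xt: "0 < x" "0 < t"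
    proof -
      have "((1 + x) * (1 + t)) ^ 4 \<le> (((1 + 8) * exp (1/8 * x)) * ((1 + 8 / \<mu>) * exp (\<mu>/8 * t))) ^ 4"
        using linear_le_exp[of "1/8" x] linear_le_exp[of "\<mu>/8" t] xt \<mu> by (intro power_mono mult_mono) auto
      also have "\<dots> = ((1 + 8) * (1 + 8 / \<mu>)) ^ 4 * ((exp (1/8 * x)) ^ 4 * (exp (\<mu>/8 * t)) ^ 4)"
        unfolding power_mult_distrib by (simp only: mult_ac)
      also have "(exp (1/8 * x)) ^ 4 = exp (1/2 * x)" by (simp flip: exp_of_nat_mult)
      also have "(exp (\<mu>/8 * t)) ^ 4 = exp (\<mu>/2 * t)" by (simp flip: exp_of_nat_mult)
      finally have *: "((1 + x) * (1 + t)) ^ 4 \<le> ((1 + 8) * (1 + 8 / \<mu>)) ^ 4 * (exp (1/2 * x) * exp (\<mu>/2 * t))" .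
      have "\<bar>k x t\<bar> \<le> C * ((1 + x) * (1 + t)) ^ 4" using C(2)[OF xt] .
      also have "\<dots> \<le> C * (((1 + 8) * (1 + 8 / \<mu>)) ^ 4 * (exp (1/2 * x) * exp (\<mu>/2 * t)))"
        by (rule mult_left_mono[OF * C(1)])
      finally have "\<bar>k x t\<bar> \<le> L * (exp (1/2 * x) * exp (\<mu>/2 * t))" by (simp add: L_def mult.assoc)
      then have "exp (- x) * exp (- (\<mu> * t)) * \<bar>k x t\<bar> \<le> exp (- x) * exp (- (\<mu> * t)) * (L * (exp (1/2 * x) * exp (\<mu>/2 * t)))"
        by (rule mult_left_mono) auto
      also have "\<dots> = L * ((exp (- x) * exp (1/2 * x)) * (exp (- (\<mu> * t)) * exp (\<mu>/2 * t)))" by simp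
      also have "exp (- x) * exp (1/2 * x) = exp (- (1/2 * x))" by (simp flip: exp_add)
      also have "exp (- (\<mu> * t)) * exp (\<mu>/2 * t) = exp (- (\<mu>/2 * t))" by (simp flip: exp_add)
      finally show ?thesis by (simp add: abs_mult)
    qed
    then show "\<bar>(indicator {0<..} x * exp (- x)) * (indicator {0<..} t * exp (- (\<mu> * t))) * k x t\<bar>
        \<le> L * ((indicator {0<..} x * exp (- (1/2 * x))) * (indicator {0<..} t * exp (- (\<mu>/2 * t))))"
      by (auto simp: indicator_def)
  qed (use \<mu> in auto)
qed

lemma integral_interval_bound:
  fixes a b C :: real and g :: "real \<Rightarrow> real"
  assumes gb: "\<And>y. a < y \<Longrightarrow> y < b \<Longrightarrow> \<bar>g y\<bar> \<le> C" and C: "0 \<le> C" and ab: "a \<le> b"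
    and [measurable]: "g \<in> borel_measurable lborel"
  shows "\<bar>\<integral>y. indicator {a<..<b} y * g y \<partial>lborel\<bar> \<le> C * (b - a)"
proof -
  have i1: "integrable lborel (\<lambda>y. indicator {a<..<b} y * g y)"
    by (rule integrable_bounded_support[where K=C and a=a and b=b]) (use assms in \<open>auto simp: indicator_def\<close>)
  have i2: "integrable lborel (\<lambda>y. C * indicator {a<..<b} y)"
    by (intro integrable_mult_right integrable_real_indicator) (use ab in auto)
  have "\<bar>\<integral>y. indicator {a<..<b} y * g y \<partial>lborel\<bar> \<le> (\<integral>y. \<bar>indicator {a<..<b} y * g y\<bar> \<partial>lborel)"
    by (rule integral_abs_bound)
  also have "\<dots> \<le> (\<integral>y. C * indicator {a<..<b} y \<partial>lborel)"
    by (rule integral_mono[OF integrable_abs[OF i1] i2]) (use gb C in \<open>auto simp: indicator_def\<close>)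
  also have "\<dots> = C * (b - a)" using ab by simp
  finally show ?thesis .
qed

text \<open>With U_x = P and U = Y almost everywhere, formally int P P_t e^(-x) = - int U_t (z - P)
  e^(-x) = - int Z (z - P) e^(-x). Besides \<open>mono\<close>, the hypothesis \<open>YU\<close> is
  the link between \<open>z\<close> and \<open>Z\<close>: it is what lets U_t be replaced by
  Z.\<close>

lemma energy_uniqueness:
  fixes z Z Y P U :: "real \<Rightarrow> real \<Rightarrow> real" and \<alpha> :: "real \<Rightarrow> real"
  assumes zm: "case_prod z \<in> borel_measurable lborel\<^sub>2"
    and Zm: "case_prod Z \<in> borel_measurable lborel\<^sub>2"
    and zb: "\<And>x t. \<bar>z x t\<bar> \<le> M" and Zb: "\<And>x t. \<bar>Z x t\<bar> \<le> M"
    and z0: "\<And>x t. t \<le> 0 \<Longrightarrow> z x t = 0" and Z0: "\<And>x t. t \<le> 0 \<Longrightarrow> Z x t = 0"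
    and c: "c > 0" and mono: "\<And>x t. c * (Z x t)\<^sup>2 \<le> z x t * Z x t"
    and \<alpha>m[measurable]: "\<alpha> \<in> borel_measurable lborel"
    and \<alpha>b: "\<And>t. \<bar>\<alpha> t\<bar> \<le> A * (1 + \<bar>t\<bar>)" and \<alpha>0: "\<And>t. t \<le> 0 \<Longrightarrow> \<alpha> t = 0"
    and Y: "\<And>x t. Y x t = (\<integral>s. indicator {0<..<t} s * Z x s \<partial>lborel)"
    and P: "\<And>x t. P x t = \<alpha> t + (\<integral>y. indicator {0<..<x} y * z y t \<partial>lborel)"
    and U: "\<And>x t. U x t = (\<integral>y. indicator {0<..<x} y * P y t \<partial>lborel)"
    and YU: "AE p in lborel\<^sub>2. 0 < fst p \<longrightarrow> Y (fst p) (snd p) = U (fst p) (snd p)"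
  shows "AE p in lborel\<^sub>2. 0 < fst p \<longrightarrow> P (fst p) (snd p) = 0"
proof -
  note [measurable (raw)] = measurable_app2[OF zm] measurable_app2[OF Zm]
  have M: "M \<ge> 0" using zb[of 0 0] by linarith
  have A: "A \<ge> 0" using \<alpha>b[of 0] by simp
  \<comment> \<open>For E = int P^2 e^(-x) the formal estimate is E' \<le> E / (2c); a time weight
    of rate 1/c decays faster than E can grow, which forces the weighted energy to vanish.\<close>
  define \<mu> where "\<mu> = 1 / c"
  have \<mu>: "\<mu> > 0" using c by (simp add: \<mu>_def)
  have Pm: "case_prod P \<in> borel_measurable lborel\<^sub>2"
    unfolding case_prod_beta' P by (intro borel_measurable_add borel_measurable_interval_integral; measurable)
  note [measurable (raw)] = measurable_app2[OF Pm]
  have Um: "case_prod U \<in> borel_measurable lborel\<^sub>2"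
    unfolding case_prod_beta' U by (intro borel_measurable_add borel_measurable_interval_integral; measurable)
  have Ym: "case_prod Y \<in> borel_measurable lborel\<^sub>2"
    unfolding case_prod_beta' Y by (intro borel_measurable_add borel_measurable_interval_integral; measurable)
  note [measurable (raw)] = measurable_app2[OF Um] measurable_app2[OF Ym]
  have Pb: "\<bar>P x t\<bar> \<le> (A + M) * (1 + x) * (1 + \<bar>t\<bar>)" if "0 < x" for x t
  proof -
    have "\<bar>P x t\<bar> \<le> A * (1 + \<bar>t\<bar>) + M * x"
      using \<alpha>b[of t] integral_interval_bound[of 0 x "\<lambda>y. z y t" M] that M zb unfolding P by fastforce
    also have "\<dots> \<le> (A + M) * (1 + x) * (1 + \<bar>t\<bar>)" using A M that by (simp add: algebra_simps)
    finally show ?thesis .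
  qed
  have int_P: "integrable lborel (\<lambda>y. indicator {0<..<x} y * P y t)" for x t
  proof (rule integrable_bounded_support[where K="\<bar>(A + M) * (1 + x) * (1 + \<bar>t\<bar>)\<bar>" and a=0 and b=x])
    show "\<bar>indicator {0<..<x} y * P y t\<bar> \<le> \<bar>(A + M) * (1 + x) * (1 + \<bar>t\<bar>)\<bar>" for y
    proof (cases "y \<in> {0<..<x}")
      case True
      then have "\<bar>P y t\<bar> \<le> (A + M) * (1 + y) * (1 + \<bar>t\<bar>)" by (intro Pb) auto
      also have "\<dots> \<le> (A + M) * (1 + x) * (1 + \<bar>t\<bar>)"
        using True A M by (intro mult_right_mono mult_left_mono) auto
      finally show ?thesis using True by simp
    qed simp
  qed auto
  have P0: "P x t = 0" if "t \<le> 0" for x t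
    using that by (simp add: P z0 \<alpha>0)
  define \<rho> where "\<rho> x t = (indicator {0<..} x * exp (- x)) * (indicator {0<..} t * exp (- (\<mu> * t)))" for x t :: real
  have \<rho>m: "case_prod \<rho> \<in> borel_measurable lborel\<^sub>2"
    unfolding \<rho>_def by measurable
  note [measurable (raw)] = measurable_app2[OF \<rho>m]
  have \<rho>0: "\<rho> x t \<ge> 0" for x t by (auto simp: \<rho>_def)
  have int_\<rho>: "integrable lborel\<^sub>2 (\<lambda>(x, t). \<rho> x t * k x t)"
    if "case_prod k \<in> borel_measurable lborel\<^sub>2" "poly_bounded n k" "n \<le> 4" for k n
    unfolding \<rho>_def using integrable_exponential_poly_bounded[OF that(1) poly_bounded_mono[OF that(2,3)] \<mu>] .
  have U0: "U x t = 0" if "t \<le> 0" for x t using P0[OF that] by (simp add: U)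
  have Y0: "Y x t = 0" if "t \<le> 0" for x t using that by (simp add: Y)
  have pz: "poly_bounded 0 z" and pZ: "poly_bounded 0 Z"
    unfolding poly_bounded_def using zb Zb M by auto
  have pP: "poly_bounded 1 P"
  proof -
    have "\<bar>P x t\<bar> \<le> (A + M) * ((1 + x) * (1 + t)) ^ 1" if "0 < x" "0 < t" for x t
      using Pb[of x t] that by (simp add: mult.assoc)
    then show ?thesis unfolding poly_bounded_def using A M by (intro exI[of _ "A + M"]) auto
  qed
  have pY: "poly_bounded 1 Y"
  proof -
    have "\<bar>Y x t\<bar> \<le> M * ((1 + x) * (1 + t)) ^ 1" if "0 < x" "0 < t" for x t
    proof -
      have "\<bar>Y x t\<bar> \<le> M * t" using integral_interval_bound[of 0 t "Z x" M] that M Zb unfolding Y by fastforce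
      also have "\<dots> \<le> M * ((1 + x) * (1 + t))" using that M by (intro mult_left_mono) (auto simp: algebra_simps)
      finally show ?thesis by simp
    qed
    then show ?thesis unfolding poly_bounded_def using M by blast
  qed
  have pU: "poly_bounded 2 U"
  proof -
    have "\<bar>U x t\<bar> \<le> (A + M) * ((1 + x) * (1 + t)) ^ 2" if "0 < x" "0 < t" for x t
    proof -
      have "\<bar>U x t\<bar> \<le> (A + M) * (1 + x) * (1 + t) * (x - 0)"
        unfolding U
      proof (rule integral_interval_bound)
        fix y assume y: "0 < y" "y < x"
        have "\<bar>P y t\<bar> \<le> (A + M) * (1 + y) * (1 + \<bar>t\<bar>)" using y by (intro Pb) auto
        also have "\<dots> \<le> (A + M) * (1 + x) * (1 + t)"
          using y that A M by (intro mult_mono) auto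
        finally show "\<bar>P y t\<bar> \<le> (A + M) * (1 + x) * (1 + t)" .
      qed (use that A M in auto)
      also have "\<dots> \<le> ((A + M) * (1 + x) * (1 + t)) * ((1 + x) * (1 + t))"
        using that A M by (intro mult_left_mono) (auto simp: algebra_simps)
      finally show ?thesis by (simp add: power2_eq_square mult_ac)
    qed
    then show ?thesis unfolding poly_bounded_def using A M by (intro exI[of _ "A + M"]) auto
  qed
  have pzP: "poly_bounded 1 (\<lambda>x t. z x t - P x t)"
    by (rule poly_bounded_diff[OF poly_bounded_mono[OF pz] pP]) auto
  define J where "J k = (\<integral>p. \<rho> (fst p) (snd p) * k (fst p) (snd p) \<partial>lborel\<^sub>2)" for k
  \<comment> \<open>Integration in \<open>x\<close> is the inner one, since the integration by parts
    is done at fixed \<open>t\<close>.\<close>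
  have J_iter: "J k = (\<integral>t. (indicator {0<..} t * exp (- (\<mu> * t))) * (\<integral>x. indicator {0<..} x * exp (- x) * k x t \<partial>lborel) \<partial>lborel)"
    if "integrable lborel\<^sub>2 (\<lambda>(x, t). \<rho> x t * k x t)" for k
  proof -
    have "J k = (\<integral>t. \<integral>x. \<rho> x t * k x t \<partial>lborel \<partial>lborel)"
      unfolding J_def lborel_pair.integral_snd[OF that] by (simp add: case_prod_beta')
    moreover have "(\<integral>x. \<rho> x t * k x t \<partial>lborel) = (indicator {0<..} t * exp (- (\<mu> * t))) * (\<integral>x. indicator {0<..} x * exp (- x) * k x t \<partial>lborel)" for t
      unfolding integral_mult_right_zero[symmetric]
      by (intro Bochner_Integration.integral_cong) (auto simp: \<rho>_def)
    ultimately show ?thesis by simp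
  qed
  let ?I = "J (\<lambda>x t. (P x t)\<^sup>2)"
  have J_mono: "J k \<le> J l" if "integrable lborel\<^sub>2 (\<lambda>(x, t). \<rho> x t * k x t)"
    "integrable lborel\<^sub>2 (\<lambda>(x, t). \<rho> x t * l x t)" "\<And>x t. k x t \<le> l x t" for k l
    unfolding J_def using that(1,2)
    by (intro integral_mono) (auto simp: case_prod_beta' intro!: mult_left_mono \<rho>0 that(3))
  have iPP: "integrable lborel\<^sub>2 (\<lambda>(x, t). \<rho> x t * (P x t)\<^sup>2)"
    unfolding power2_eq_square by (rule int_\<rho>[OF _ poly_bounded_mult[OF pP pP]]) auto
  have iZzP: "integrable lborel\<^sub>2 (\<lambda>(x, t). \<rho> x t * (Z x t * (z x t - P x t)))"
    by (rule int_\<rho>[OF _ poly_bounded_mult[OF pZ pzP]]) auto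
  \<comment> \<open>Discrete energy inequality. In a^2 = b^2 + 2 (a - b) a - (a - b)^2, with a and b
    the values of \<open>P\<close> at t and t - h, the squared increment has a favourable sign and
    is dropped.\<close>
  have step: "(1 - exp (- (\<mu> * h))) * ?I \<le> - 2 * J (\<lambda>x t. (Y x t - Y x (t - h)) * (z x t - P x t))" if h: "h > 0" for h
  proof -
    define D where "D x t = P x t - P x (t - h)" for x t
    have Dm[measurable]: "case_prod D \<in> borel_measurable lborel\<^sub>2"
      unfolding D_def by measurable
    note [measurable (raw)] = measurable_app2[OF Dm]
    have pPh: "poly_bounded 1 (\<lambda>x t. P x (t - h))" by (rule poly_bounded_shift[OF pP h P0])
    have pD: "poly_bounded 1 D" unfolding D_def by (rule poly_bounded_diff[OF pP pPh])
    have iPh: "integrable lborel\<^sub>2 (\<lambda>(x, t). \<rho> x t * (P x (t - h))\<^sup>2)"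
      unfolding power2_eq_square by (rule int_\<rho>[OF _ poly_bounded_mult[OF pPh pPh]]) auto
    have iDP: "integrable lborel\<^sub>2 (\<lambda>(x, t). \<rho> x t * (D x t * P x t))"
      by (rule int_\<rho>[OF _ poly_bounded_mult[OF pD pP]]) auto
    have "?I \<le> J (\<lambda>x t. (P x (t - h))\<^sup>2 + 2 * (D x t * P x t))"
    proof (rule J_mono[OF iPP])
      show "integrable lborel\<^sub>2 (\<lambda>(x, t). \<rho> x t * ((P x (t - h))\<^sup>2 + 2 * (D x t * P x t)))"
        using Bochner_Integration.integrable_add[OF iPh integrable_mult_right[OF iDP, of 2]]
        by (simp add: case_prod_beta' algebra_simps)
      show "(P x t)\<^sup>2 \<le> (P x (t - h))\<^sup>2 + 2 * (D x t * P x t)" for x t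
        using zero_le_power2[of "D x t"] by (simp add: D_def power2_eq_square algebra_simps)
    qed
    also have "\<dots> = J (\<lambda>x t. (P x (t - h))\<^sup>2) + 2 * J (\<lambda>x t. D x t * P x t)"
    proof -
      have "(\<integral>p. \<rho> (fst p) (snd p) * ((P (fst p) (snd p - h))\<^sup>2 + 2 * (D (fst p) (snd p) * P (fst p) (snd p))) \<partial>lborel\<^sub>2)
        = (\<integral>p. \<rho> (fst p) (snd p) * (P (fst p) (snd p - h))\<^sup>2 + 2 * (\<rho> (fst p) (snd p) * (D (fst p) (snd p) * P (fst p) (snd p))) \<partial>lborel\<^sub>2)"
        by (intro Bochner_Integration.integral_cong) (auto simp: algebra_simps)
      then show ?thesis unfolding J_def using iPh iDP by (simp add: case_prod_beta')
    qed
    \<comment> \<open>Substituting t = h + s extracts the factor e^(-\<mu> h); the times -h < s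
      \<le> 0 contribute nothing because \<open>P\<close> vanishes there.\<close>
    also have "J (\<lambda>x t. (P x (t - h))\<^sup>2) = exp (- (\<mu> * h)) * ?I"
    proof -
      define m where "m t = (\<integral>x. indicator {0<..} x * exp (- x) * (P x t)\<^sup>2 \<partial>lborel)" for t
      have m0: "m t = 0" if "t \<le> 0" for t using that by (simp add: m_def P0)
      have "J (\<lambda>x t. (P x (t - h))\<^sup>2) = (\<integral>t. (indicator {0<..} t * exp (- (\<mu> * t))) * m (t - h) \<partial>lborel)"
        unfolding J_iter[OF iPh] m_def ..
      also have "\<dots> = (\<integral>s. (indicator {0<..} (h + s) * exp (- (\<mu> * (h + s)))) * m s \<partial>lborel)"
        by (subst lborel_integral_real_affine[where c=1 and t=h]) auto
      also have "\<dots> = (\<integral>s. exp (- (\<mu> * h)) * ((indicator {0<..} s * exp (- (\<mu> * s))) * m s) \<partial>lborel)"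
      proof (rule Bochner_Integration.integral_cong)
        fix s :: real
        show "(indicator {0<..} (h + s) * exp (- (\<mu> * (h + s)))) * m s = exp (- (\<mu> * h)) * ((indicator {0<..} s * exp (- (\<mu> * s))) * m s)"
          using m0[of s] h by (cases "0 < s") (auto simp: distrib_left exp_add exp_minus exp_diff field_simps)
      qed simp
      also have "\<dots> = exp (- (\<mu> * h)) * ?I"
        unfolding J_iter[OF iPP] m_def[symmetric] by simp
      finally show ?thesis .
    qed
    also have "J (\<lambda>x t. D x t * P x t) = - J (\<lambda>x t. (Y x t - Y x (t - h)) * (z x t - P x t))"
    proof -
      have pUh: "poly_bounded 2 (\<lambda>x t. U x (t - h))" by (rule poly_bounded_shift[OF pU h U0])
      have iU: "integrable lborel\<^sub>2 (\<lambda>(x, t). \<rho> x t * ((U x t - U x (t - h)) * (z x t - P x t)))"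
        by (rule int_\<rho>[OF _ poly_bounded_mult[OF poly_bounded_diff[OF pU pUh] pzP]]) auto
      \<comment> \<open>At each fixed \<open>t\<close> the increment \<open>D\<close> plays the role
        of \<open>p\<close>, and the increment of \<open>U\<close> is its primitive.\<close>
      have ibp: "(\<integral>x. indicator {0<..} x * exp (- x) * (D x t * P x t) \<partial>lborel)
          = - (\<integral>x. indicator {0<..} x * exp (- x) * ((U x t - U x (t - h)) * (z x t - P x t)) \<partial>lborel)" for t
      proof (rule exponential_integration_by_parts)
        show "\<bar>D x t\<bar> \<le> ((A + M) * (1 + \<bar>t\<bar>) + (A + M) * (1 + \<bar>t - h\<bar>)) * (1 + x)" if "0 < x" for x
        proof -
          have "\<bar>D x t\<bar> \<le> (A + M) * (1 + x) * (1 + \<bar>t\<bar>) + (A + M) * (1 + x) * (1 + \<bar>t - h\<bar>)"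
            using Pb[OF that, of t] Pb[OF that, of "t - h"] unfolding D_def by linarith
          then show ?thesis by (simp only: algebra_simps)
        qed
        show "U x t - U x (t - h) = (\<integral>y. indicator {0<..<x} y * D y t \<partial>lborel)" for x
          unfolding D_def right_diff_distrib U by (rule Bochner_Integration.integral_diff[symmetric, OF int_P int_P])
      qed (use zb P in auto)
      have "AE p in lborel\<^sub>2. 0 < fst p \<longrightarrow> Y (fst p) (snd p - h) = U (fst p) (snd p - h)"
        using AE_lborel_translate[of "\<lambda>p. 0 < fst p \<longrightarrow> Y (fst p) (snd p) = U (fst p) (snd p)" "(0, h)"] YU
        unfolding lborel_prod by simp
      \<comment> \<open>Here the increments of \<open>U\<close> are exchanged for those of
        \<open>Y\<close>, using the identity at almost every point and at its translate by
        \<open>h\<close>.\<close>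
      then have "J (\<lambda>x t. (Y x t - Y x (t - h)) * (z x t - P x t)) = J (\<lambda>x t. (U x t - U x (t - h)) * (z x t - P x t))"
        unfolding J_def using YU
        by (intro integral_cong_AE) (auto simp: \<rho>_def elim!: eventually_elim2)
      then show ?thesis unfolding J_iter[OF iU] J_iter[OF iDP] ibp by simp
    qed
    finally show ?thesis by (simp add: algebra_simps)
  qed
  \<comment> \<open>The quotients of \<open>Y\<close> with step \<open>1 / Suc n\<close> are bounded
    by \<open>M\<close>, the bound for \<open>Z\<close>, and converge to \<open>Z\<close> almost
    everywhere; dominated convergence applies.\<close>
  have lim: "(\<lambda>n. J (\<lambda>x t. ((Y x t - Y x (t - 1 / Suc n)) * Suc n) * (z x t - P x t))) \<longlonglongrightarrow> J (\<lambda>x t. Z x t * (z x t - P x t))"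
    unfolding J_def
  proof (rule integral_dominated_convergence[where w="\<lambda>p. M * \<bar>\<rho> (fst p) (snd p) * (z (fst p) (snd p) - P (fst p) (snd p))\<bar>"])
    let ?q = "\<lambda>n x t. (Y x t - Y x (t - 1 / Suc n)) * Suc n"
    have qb: "\<bar>?q n x t\<bar> \<le> M" for n x t
    proof -
      define s where "s = t - 1 / Suc n"
      have st: "s \<le> t" by (simp add: s_def)
      have i: "integrable lborel (\<lambda>y. indicator {0<..<r} y * Z x y)" for r
        by (rule integrable_bounded_support[where K=M and a=0 and b=r]) (use Zb M in \<open>auto simp: indicator_def\<close>)
      have j: "integrable lborel (\<lambda>y. M * indicator {s..<t} y)"
        by (intro integrable_mult_right integrable_real_indicator) (use st in auto)
      have "Y x t - Y x s = (\<integral>y. indicator {0<..<t} y * Z x y - indicator {0<..<s} y * Z x y \<partial>lborel)"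
        unfolding Y by (rule Bochner_Integration.integral_diff[symmetric, OF i i])
      then have "\<bar>Y x t - Y x s\<bar> \<le> (\<integral>y. \<bar>indicator {0<..<t} y * Z x y - indicator {0<..<s} y * Z x y\<bar> \<partial>lborel)"
        by (simp only: integral_abs_bound)
      also have "\<dots> \<le> (\<integral>y. M * indicator {s..<t} y \<partial>lborel)"
        by (rule integral_mono[OF integrable_abs[OF Bochner_Integration.integrable_diff[OF i i]] j])
           (use Zb M st in \<open>auto simp: indicator_def\<close>)
      also have "\<dots> = M * (t - s)" using st by simp
      finally have "\<bar>Y x t - Y x s\<bar> * Suc n \<le> M * (t - s) * Suc n" by (intro mult_right_mono) auto
      then show ?thesis by (simp add: s_def abs_mult)
    qed
    \<comment> \<open>For every \<open>x\<close> the limit holds for almost every \<open>t\<close>.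
      Passing to almost every point of the plane requires a measurable set, hence the form with
      countable quantifiers.\<close>
    have "AE p in lborel\<^sub>2. \<forall>k. \<exists>N. \<forall>n\<ge>N. \<bar>?q n (fst p) (snd p) - Z (fst p) (snd p)\<bar> < 1 / Suc k"
    proof (rule lborel_pair.AE_pair_measure)
      show "AE x in lborel. AE t in lborel. \<forall>k. \<exists>N. \<forall>n\<ge>N. \<bar>?q n (fst (x, t)) (snd (x, t)) - Z (fst (x, t)) (snd (x, t))\<bar> < 1 / Suc k"
      proof (rule AE_I2)
        fix x
        show "AE t in lborel. \<forall>k. \<exists>N. \<forall>n\<ge>N. \<bar>?q n (fst (x, t)) (snd (x, t)) - Z (fst (x, t)) (snd (x, t))\<bar> < 1 / Suc k"
          unfolding LIMSEQ_iff_inverse_Suc[symmetric] Y fst_conv snd_conv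
          by (rule lebesgue_differentiation_backward[where M=M]) (use Zb Z0 in auto)
      qed
    qed measurable
    then show "AE p in lborel\<^sub>2. (\<lambda>n. \<rho> (fst p) (snd p) * (?q n (fst p) (snd p) * (z (fst p) (snd p) - P (fst p) (snd p))))
        \<longlonglongrightarrow> \<rho> (fst p) (snd p) * (Z (fst p) (snd p) * (z (fst p) (snd p) - P (fst p) (snd p)))"
      unfolding LIMSEQ_iff_inverse_Suc[symmetric]
      by eventually_elim (intro tendsto_intros)
    show "integrable lborel\<^sub>2 (\<lambda>p. M * \<bar>\<rho> (fst p) (snd p) * (z (fst p) (snd p) - P (fst p) (snd p))\<bar>)"
      using int_\<rho>[OF _ pzP] by (intro integrable_mult_right integrable_abs) (auto simp: case_prod_beta')
    show "AE p in lborel\<^sub>2. norm (\<rho> (fst p) (snd p) * (?q n (fst p) (snd p) * (z (fst p) (snd p) - P (fst p) (snd p))))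
        \<le> M * \<bar>\<rho> (fst p) (snd p) * (z (fst p) (snd p) - P (fst p) (snd p))\<bar>" for n
    proof (rule AE_I2)
      fix p
      have "\<bar>?q n (fst p) (snd p)\<bar> * \<bar>\<rho> (fst p) (snd p) * (z (fst p) (snd p) - P (fst p) (snd p))\<bar>
        \<le> M * \<bar>\<rho> (fst p) (snd p) * (z (fst p) (snd p) - P (fst p) (snd p))\<bar>"
        by (rule mult_right_mono[OF qb]) simp
      then show "norm (\<rho> (fst p) (snd p) * (?q n (fst p) (snd p) * (z (fst p) (snd p) - P (fst p) (snd p))))
        \<le> M * \<bar>\<rho> (fst p) (snd p) * (z (fst p) (snd p) - P (fst p) (snd p))\<bar>"
        by (simp add: abs_mult mult_ac)
    qed
  qed auto
  have "\<mu> * ?I \<le> - 2 * J (\<lambda>x t. Z x t * (z x t - P x t))"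
  proof (rule LIMSEQ_le)
    show "(\<lambda>n. real (Suc n) * (1 - exp (- (\<mu> / Suc n))) * ?I) \<longlonglongrightarrow> \<mu> * ?I"
      by (intro tendsto_intros exp_difference_quotient_LIMSEQ)
    show "(\<lambda>n. - 2 * J (\<lambda>x t. ((Y x t - Y x (t - 1 / Suc n)) * Suc n) * (z x t - P x t))) \<longlonglongrightarrow> - 2 * J (\<lambda>x t. Z x t * (z x t - P x t))"
      by (intro tendsto_intros lim)
    have "real (Suc n) * (1 - exp (- (\<mu> / Suc n))) * ?I \<le> - 2 * J (\<lambda>x t. ((Y x t - Y x (t - 1 / Suc n)) * Suc n) * (z x t - P x t))" for n
    proof -
      have "real (Suc n) * ((1 - exp (- (\<mu> * (1 / Suc n)))) * ?I) \<le> real (Suc n) * (- 2 * J (\<lambda>x t. (Y x t - Y x (t - 1 / Suc n)) * (z x t - P x t)))"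
        by (intro mult_left_mono step) auto
      also have "J (\<lambda>x t. ((Y x t - Y x (t - 1 / Suc n)) * Suc n) * (z x t - P x t)) = real (Suc n) * J (\<lambda>x t. (Y x t - Y x (t - 1 / Suc n)) * (z x t - P x t))"
        unfolding J_def integral_mult_right_zero[symmetric] by (simp add: mult_ac)
      then have "real (Suc n) * (- 2 * J (\<lambda>x t. (Y x t - Y x (t - 1 / Suc n)) * (z x t - P x t))) = - 2 * J (\<lambda>x t. ((Y x t - Y x (t - 1 / Suc n)) * Suc n) * (z x t - P x t))"
        by simp
      finally show ?thesis by (simp add: mult.assoc)
    qed
    then show "\<exists>N. \<forall>n\<ge>N. real (Suc n) * (1 - exp (- (\<mu> / Suc n))) * ?I \<le> - 2 * J (\<lambda>x t. ((Y x t - Y x (t - 1 / Suc n)) * Suc n) * (z x t - P x t))"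
      by blast
  qed
  also have "- 2 * J (\<lambda>x t. Z x t * (z x t - P x t)) = 2 * J (\<lambda>x t. - (Z x t * (z x t - P x t)))"
    unfolding J_def by simp
  also have "J (\<lambda>x t. - (Z x t * (z x t - P x t))) \<le> J (\<lambda>x t. \<mu> / 4 * (P x t)\<^sup>2)"
  proof (rule J_mono)
    show "- (Z x t * (z x t - P x t)) \<le> \<mu> / 4 * (P x t)\<^sup>2" for x t
    proof -
      \<comment> \<open>Young's inequality as a completed square: - Z (z - P) \<le> - c Z^2 + Z P
        \<le> P^2 / (4c).\<close>
      have "0 \<le> c * (Z x t - P x t / (2 * c))\<^sup>2" using c by simp
      also have "\<dots> = c * (Z x t)\<^sup>2 - Z x t * P x t + (P x t)\<^sup>2 / (4 * c)"
        using c by (simp add: power2_eq_square field_simps)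
      finally show ?thesis using mono[of x t] by (simp add: \<mu>_def algebra_simps)
    qed
    show "integrable lborel\<^sub>2 (\<lambda>(x, t). \<rho> x t * (\<mu> / 4 * (P x t)\<^sup>2))"
      using integrable_mult_right[OF iPP, of "\<mu> / 4"] by (simp add: case_prod_beta' mult_ac)
    show "integrable lborel\<^sub>2 (\<lambda>(x, t). \<rho> x t * - (Z x t * (z x t - P x t)))"
      using integrable_minus[OF iZzP] by (simp add: case_prod_beta')
  qed
  also have "J (\<lambda>x t. \<mu> / 4 * (P x t)\<^sup>2) = \<mu> / 4 * ?I"
    unfolding J_def integral_mult_right_zero[symmetric] by (simp add: mult_ac)
  \<comment> \<open>The chain says that \<mu> times the energy is at most \<mu>/2 times the
    energy.\<close>
  finally have "\<mu> * ?I \<le> 0" by simp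
  then have "?I \<le> 0" using \<mu> by (simp add: mult_le_0_iff)
  moreover have "0 \<le> ?I" unfolding J_def by (intro integral_nonneg_AE AE_I2) (simp add: \<rho>0)
  ultimately have "(\<integral>p. \<rho> (fst p) (snd p) * (P (fst p) (snd p))\<^sup>2 \<partial>lborel\<^sub>2) = 0"
    unfolding J_def by simp
  then have "AE p in lborel\<^sub>2. \<rho> (fst p) (snd p) * (P (fst p) (snd p))\<^sup>2 = 0"
    using iPP by (subst (asm) integral_nonneg_eq_0_iff_AE) (auto simp: case_prod_beta' \<rho>0)
  then show ?thesis
  proof eventually_elim
    case (elim p)
    then show ?case using P0[of "snd p" "fst p"] by (cases "0 < snd p") (auto simp: \<rho>_def)
  qed
qed

section \<open>Uniqueness for the weak form with separated test functions\<close>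

lemma continuous_vanishing_bounded:
  fixes h :: "real \<Rightarrow> real"
  assumes "continuous_on UNIV h" "\<And>x. x \<notin> {0<..<R} \<Longrightarrow> h x = 0"
  obtains K where "\<And>x. \<bar>h x\<bar> \<le> K"
proof -
  have "bounded (h ` {0..R})"
    by (intro compact_imp_bounded compact_continuous_image continuous_on_subset[OF assms(1)]) auto
  then obtain K where K: "\<And>x. x \<in> {0..R} \<Longrightarrow> \<bar>h x\<bar> \<le> K" unfolding bounded_iff real_norm_def by blast
  have "\<bar>h x\<bar> \<le> max K 0" for x
    using K[of x] assms(2)[of x] by (cases "x \<in> {0<..<R}") auto
  then show ?thesis by (rule that)
qed

lemma integrable_pair_bounded_support:
  fixes f :: "real \<Rightarrow> real \<Rightarrow> real"
  assumes "case_prod f \<in> borel_measurable lborel\<^sub>2"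
    and "\<And>x y. \<bar>f x y\<bar> \<le> K" and "\<And>x y. x \<notin> {a..b} \<or> y \<notin> {c..d} \<Longrightarrow> f x y = 0"
  shows "integrable lborel\<^sub>2 (case_prod f)"
  unfolding lborel_prod
proof (rule integrable_bounded_support[where K=K and a="(a, c)" and b="(b, d)"])
  show "case_prod f p = 0" if "p \<notin> cbox (a, c) (b, d)" for p
    using assms(3)[of "fst p" "snd p"] that by (cases p) auto
qed (use assms(1,2) in \<open>auto simp: lborel_prod\<close>)

lemma integrable_of_bounded_vanishing:
  fixes f :: "real \<Rightarrow> real"
  assumes "f \<in> borel_measurable lborel" "\<And>x. \<bar>f x\<bar> \<le> K" "\<And>x. x \<notin> {a..b} \<Longrightarrow> f x = 0"
  shows "integrable lborel f"
  by (rule integrable_bounded_support[where K=K and a=a and b=b]) (use assms in auto)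

text \<open>Both sides are integrals over the triangle 0 < t < s < R, on which everything is
  bounded. The kernel \<open>\<kappa>\<close> equal to 1 moves a primitive from the test function
  onto \<open>f\<close>; the kernel with value r at r moves a double primitive.\<close>

lemma convolution_swap:
  fixes f g \<kappa> :: "real \<Rightarrow> real"
  assumes fm: "f \<in> borel_measurable lborel" and fb: "\<And>x. \<bar>f x\<bar> \<le> M" and f0: "\<And>x. x \<le> 0 \<Longrightarrow> f x = 0"
    and gm: "g \<in> borel_measurable lborel" and gb: "\<And>x. \<bar>g x\<bar> \<le> K" and g0: "\<And>x. x \<notin> {0<..<R} \<Longrightarrow> g x = 0"
    and \<kappa>: "continuous_on UNIV \<kappa>"
  shows "(\<integral>t. f t * (\<integral>s. indicator {t<..} s * (\<kappa> (s - t) * g s) \<partial>lborel) \<partial>lborel)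
       = (\<integral>s. g s * (\<integral>t. indicator {0<..<s} t * (\<kappa> (s - t) * f t) \<partial>lborel) \<partial>lborel)"
proof -
  have [measurable]: "f \<in> borel_measurable borel" "g \<in> borel_measurable borel" "\<kappa> \<in> borel_measurable borel"
    using fm gm \<kappa> by (auto intro: borel_measurable_continuous_onI)
  have "bounded (\<kappa> ` {0..R})"
    by (intro compact_imp_bounded compact_continuous_image continuous_on_subset[OF \<kappa>]) auto
  then obtain C where C: "\<And>x. x \<in> {0..R} \<Longrightarrow> \<bar>\<kappa> x\<bar> \<le> C" unfolding bounded_iff real_norm_def by blast
  have M: "0 \<le> M" "0 \<le> K" using fb[of 0] gb[of 0] by linarith+
  define k where "k t s = (if 0 < t \<and> t < s then f t * (\<kappa> (s - t) * g s) else 0)" for t s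
  have "integrable lborel\<^sub>2 (case_prod k)"
  proof (rule integrable_pair_bounded_support[where a=0 and b=R and c=0 and d=R])
    show "case_prod k \<in> borel_measurable lborel\<^sub>2" unfolding k_def by measurable
    show "\<bar>k t s\<bar> \<le> M * (\<bar>C\<bar> * K)" for t s
    proof (cases "0 < t \<and> t < s \<and> s < R")
      case True
      have "\<bar>f t\<bar> * (\<bar>\<kappa> (s - t)\<bar> * \<bar>g s\<bar>) \<le> M * (\<bar>C\<bar> * K)"
        using True M by (intro mult_mono fb gb order_trans[OF C abs_ge_self]) auto
      then show ?thesis using True by (simp add: k_def abs_mult)
    qed (use M g0[of s] in \<open>auto simp: k_def\<close>)
  qed (use g0 in \<open>auto simp: k_def\<close>)
  then have "(\<integral>s. \<integral>t. k t s \<partial>lborel \<partial>lborel) = (\<integral>t. \<integral>s. k t s \<partial>lborel \<partial>lborel)"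
    by (rule lborel_pair.Fubini_integral)
  moreover have "(\<integral>s. k t s \<partial>lborel) = f t * (\<integral>s. indicator {t<..} s * (\<kappa> (s - t) * g s) \<partial>lborel)" for t
    unfolding integral_mult_right_zero[symmetric]
    by (intro Bochner_Integration.integral_cong) (use f0[of t] in \<open>auto simp: k_def indicator_def not_less\<close>)
  moreover have "(\<integral>t. k t s \<partial>lborel) = g s * (\<integral>t. indicator {0<..<s} t * (\<kappa> (s - t) * f t) \<partial>lborel)" for s
    unfolding integral_mult_right_zero[symmetric]
    by (intro Bochner_Integration.integral_cong) (auto simp: k_def indicator_def)
  ultimately show ?thesis by simp
qed

text \<open>The hypothesis \<open>weak\<close> is the homogeneous weak form for products phi(x)
  Theta(t) with phi'' = h and Theta' = - \<theta>; the moment condition on \<open>h\<close> is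
  phi(0) = 0. Moving the primitives onto the other factor shows that \<open>Y\<close>, the time
  primitive of \<open>Z\<close>, and \<open>B\<close>, the double x-primitive of \<open>z\<close>,
  differ by \<alpha>(t) x only. Then \<open>energy_uniqueness\<close> gives \<open>P = 0\<close>,
  and differentiation in x gives \<open>z = 0\<close>.\<close>

lemma separated_weak_form_uniqueness:
  fixes z Z :: "real \<Rightarrow> real \<Rightarrow> real"
  assumes zm: "case_prod z \<in> borel_measurable lborel\<^sub>2"
    and Zm: "case_prod Z \<in> borel_measurable lborel\<^sub>2"
    and zb: "\<And>x t. \<bar>z x t\<bar> \<le> M" and Zb: "\<And>x t. \<bar>Z x t\<bar> \<le> M"
    and z0: "\<And>x t. x \<le> 0 \<or> t \<le> 0 \<Longrightarrow> z x t = 0" and Z0: "\<And>x t. x \<le> 0 \<or> t \<le> 0 \<Longrightarrow> Z x t = 0"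
    and c: "c > 0" and mono: "\<And>x t. c * (Z x t)\<^sup>2 \<le> z x t * Z x t"
    and weak: "\<And>h \<theta> R T. continuous_on UNIV h \<Longrightarrow> continuous_on UNIV \<theta> \<Longrightarrow>
        (\<And>x. x \<notin> {0<..<R} \<Longrightarrow> h x = 0) \<Longrightarrow> (\<And>t. t \<notin> {0<..<T} \<Longrightarrow> \<theta> t = 0) \<Longrightarrow>
        0 < R \<Longrightarrow> 0 < T \<Longrightarrow> (\<integral>y. y * h y \<partial>lborel) = 0 \<Longrightarrow>
        (\<integral>p. Z (fst p) (snd p) * (h (fst p) * (\<integral>s. indicator {snd p<..} s * \<theta> s \<partial>lborel))
           - z (fst p) (snd p) * ((\<integral>y. indicator {fst p<..} y * ((y - fst p) * h y) \<partial>lborel) * \<theta> (snd p))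
          \<partial>lborel\<^sub>2) = 0"
  shows "AE p in lborel\<^sub>2. z (fst p) (snd p) = 0"
proof -
  note [measurable (raw)] = measurable_app2[OF zm] measurable_app2[OF Zm]
  have M: "M \<ge> 0" using zb[of 0 0] by linarith
  define Y where "Y x t = (\<integral>s. indicator {0<..<t} s * Z x s \<partial>lborel)" for x t
  define B where "B x t = (\<integral>y. indicator {0<..<x} y * ((x - y) * z y t) \<partial>lborel)" for x t
  have Ym: "case_prod Y \<in> borel_measurable lborel\<^sub>2"
    unfolding case_prod_beta' Y_def by (intro borel_measurable_add borel_measurable_interval_integral; measurable)
  have Bm: "case_prod B \<in> borel_measurable lborel\<^sub>2"
    unfolding case_prod_beta' B_def by (intro borel_measurable_add borel_measurable_interval_integral; measurable)
  note [measurable (raw)] = measurable_app2[OF Ym] measurable_app2[OF Bm]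
  have Yb: "\<bar>Y x t\<bar> \<le> M * \<bar>t\<bar>" for x t
  proof (cases "0 \<le> t")
    case True
    then show ?thesis using integral_interval_bound[of 0 t "Z x" M] Zb M unfolding Y_def by simp
  qed (use M in \<open>simp add: Y_def mult_nonneg_nonpos\<close>)
  have Bb: "\<bar>B x t\<bar> \<le> M * x\<^sup>2" for x t
  proof (cases "0 \<le> x")
    case True
    have "\<bar>B x t\<bar> \<le> (x * M) * (x - 0)"
      unfolding B_def
    proof (rule integral_interval_bound)
      show "\<bar>(x - y) * z y t\<bar> \<le> x * M" if "0 < y" "y < x" for y
        unfolding abs_mult by (intro mult_mono zb) (use that in auto)
    qed (use True M in auto)
    then show ?thesis by (simp add: power2_eq_square mult_ac)
  qed (use M in \<open>simp add: B_def\<close>)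
  have int_prod: "integrable lborel\<^sub>2 (\<lambda>(x, t). k x t * (h x * \<theta> t))"
    if h: "continuous_on UNIV h" and \<theta>: "continuous_on UNIV \<theta>"
      and h0: "\<And>x. x \<notin> {0<..<R} \<Longrightarrow> h x = 0" and \<theta>0: "\<And>t. t \<notin> {0<..<T} \<Longrightarrow> \<theta> t = 0"
      and km: "case_prod k \<in> borel_measurable lborel\<^sub>2"
      and kb: "\<And>x t. 0 < x \<Longrightarrow> x < R \<Longrightarrow> 0 < t \<Longrightarrow> t < T \<Longrightarrow> \<bar>k x t\<bar> \<le> C" for h \<theta> :: "real \<Rightarrow> real" and k :: "real \<Rightarrow> real \<Rightarrow> real" and R T C
  proof -
    note [measurable (raw)] = measurable_app2[OF km]
    have [measurable]: "h \<in> borel_measurable borel" "\<theta> \<in> borel_measurable borel"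
      using h \<theta> by (auto intro: borel_measurable_continuous_onI)
    obtain H where H: "\<And>x. \<bar>h x\<bar> \<le> H" using continuous_vanishing_bounded[OF h h0] by blast
    obtain K where K: "\<And>x. \<bar>\<theta> x\<bar> \<le> K" using continuous_vanishing_bounded[OF \<theta> \<theta>0] by blast
    have "0 \<le> H" "0 \<le> K" using H[of 0] K[of 0] by linarith+
    show ?thesis
    proof (rule integrable_pair_bounded_support[where a=0 and b=R and c=0 and d=T])
      show "\<bar>k x t * (h x * \<theta> t)\<bar> \<le> \<bar>C\<bar> * (H * K)" for x t
      proof (cases "0 < x \<and> x < R \<and> 0 < t \<and> t < T")
        case True
        then show ?thesis unfolding abs_mult
          by (intro mult_mono H K order_trans[OF kb abs_ge_self]) (use \<open>0 \<le> H\<close> in auto)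
      next
        case False
        then have "h x * \<theta> t = 0" using h0[of x] \<theta>0[of t] by auto
        moreover have "0 \<le> \<bar>C\<bar> * (H * K)" using \<open>0 \<le> H\<close> \<open>0 \<le> K\<close> by simp
        ultimately show ?thesis by (metis abs_zero mult_zero_right)
      qed
      show "k x t * (h x * \<theta> t) = 0" if "x \<notin> {0..R} \<or> t \<notin> {0..T}" for x t
        using h0[of x] \<theta>0[of t] that by auto
    qed measurable
  qed
  have intYB: "integrable lborel\<^sub>2 (\<lambda>(x, t). Y x t * (h x * \<theta> t))"
              "integrable lborel\<^sub>2 (\<lambda>(x, t). B x t * (h x * \<theta> t))"
    if "continuous_on UNIV h" "continuous_on UNIV \<theta>"
       "\<And>x. x \<notin> {0<..<R} \<Longrightarrow> h x = 0" "\<And>t. t \<notin> {0<..<T} \<Longrightarrow> \<theta> t = 0" for h \<theta> R T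
  proof -
    have "\<bar>Y x t\<bar> \<le> M * T" if "0 < t" "t < T" for x t
      using that M by (intro order_trans[OF Yb]) (auto intro: mult_left_mono)
    then show "integrable lborel\<^sub>2 (\<lambda>(x, t). Y x t * (h x * \<theta> t))"
      by (intro int_prod[where R=R and T=T and C="M * T"] that Ym)
    have "\<bar>B x t\<bar> \<le> M * R\<^sup>2" if "0 < x" "x < R" for x t
      using that M by (intro order_trans[OF Bb]) (auto intro!: mult_left_mono power_mono)
    then show "integrable lborel\<^sub>2 (\<lambda>(x, t). B x t * (h x * \<theta> t))"
      by (intro int_prod[where R=R and T=T and C="M * R\<^sup>2"] that Bm)
  qed
  \<comment> \<open>Fubini takes both primitives off the test function: \<open>Y - B\<close> is
    orthogonal to every admissible \<open>h\<close> times \<open>\<theta>\<close>.\<close>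
  have orth: "(\<integral>p. (Y (fst p) (snd p) - B (fst p) (snd p)) * (h (fst p) * \<theta> (snd p)) \<partial>lborel\<^sub>2) = 0"
    if h: "continuous_on UNIV h" and \<theta>: "continuous_on UNIV \<theta>"
      and h0: "\<And>x. x \<notin> {0<..<R} \<Longrightarrow> h x = 0" and \<theta>0: "\<And>t. t \<notin> {0<..<T} \<Longrightarrow> \<theta> t = 0"
      and pos: "0 < R" "0 < T" and m: "(\<integral>y. y * h y \<partial>lborel) = 0" for h \<theta> R T
  proof -
    have [measurable]: "h \<in> borel_measurable borel" "\<theta> \<in> borel_measurable borel"
      using h \<theta> by (auto intro: borel_measurable_continuous_onI)
    obtain H where H: "\<And>x. \<bar>h x\<bar> \<le> H" using continuous_vanishing_bounded[OF h h0] by blast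
    obtain K where K: "\<And>x. \<bar>\<theta> x\<bar> \<le> K" using continuous_vanishing_bounded[OF \<theta> \<theta>0] by blast
    have HK: "0 \<le> H" "0 \<le> K" using H[of 0] K[of 0] by linarith+
    define \<Theta> where "\<Theta> t = (\<integral>s. indicator {t<..} s * \<theta> s \<partial>lborel)" for t
    define \<phi> where "\<phi> x = (\<integral>y. indicator {x<..} y * ((y - x) * h y) \<partial>lborel)" for x
    have \<Theta>_eq: "\<Theta> t = (\<integral>s. indicator {t<..<T} s * \<theta> s \<partial>lborel)" for t
      unfolding \<Theta>_def using \<theta>0 by (intro Bochner_Integration.integral_cong) (auto simp: indicator_def)
    have \<phi>_eq: "\<phi> x = (\<integral>y. indicator {x<..<R} y * ((y - x) * h y) \<partial>lborel)" for x
      unfolding \<phi>_def using h0 by (intro Bochner_Integration.integral_cong) (auto simp: indicator_def)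
    have [measurable]: "\<Theta> \<in> borel_measurable borel" "\<phi> \<in> borel_measurable borel"
      unfolding \<Theta>_eq[abs_def] \<phi>_eq[abs_def] by (intro borel_measurable_interval_integral; measurable)+
    have \<Theta>b: "\<bar>\<Theta> t\<bar> \<le> K * T" if "0 < t" "t < T" for t
    proof -
      have "\<bar>\<Theta> t\<bar> \<le> K * (T - t)" unfolding \<Theta>_eq
        by (rule integral_interval_bound) (use K HK that in auto)
      also have "\<dots> \<le> K * T" using that HK by (intro mult_left_mono) auto
      finally show ?thesis .
    qed
    have \<phi>b: "\<bar>\<phi> x\<bar> \<le> (R * H) * R" if "0 < x" "x < R" for x
    proof -
      have "\<bar>\<phi> x\<bar> \<le> (R * H) * (R - x)" unfolding \<phi>_eq
      proof (rule integral_interval_bound)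
        show "\<bar>(y - x) * h y\<bar> \<le> R * H" if "x < y" "y < R" for y
          unfolding abs_mult by (intro mult_mono H) (use that \<open>0 < x\<close> pos in auto)
      qed (use HK that pos in auto)
      also have "\<dots> \<le> (R * H) * R" using that HK by (intro mult_left_mono) auto
      finally show ?thesis .
    qed
    have \<Theta>0: "\<Theta> t = 0" if "T \<le> t" for t using that by (simp add: \<Theta>_eq)
    have \<phi>0: "\<phi> x = 0" if "R \<le> x" for x using that by (simp add: \<phi>_eq)
    have i1: "integrable lborel\<^sub>2 (\<lambda>(x, t). Z x t * (h x * \<Theta> t))"
    proof (rule integrable_pair_bounded_support[where a=0 and b=R and c=0 and d=T])
      show "\<bar>Z x t * (h x * \<Theta> t)\<bar> \<le> M * (H * (K * T))" for x t
      proof (cases "0 < t \<and> t < T")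
        case True
        then show ?thesis unfolding abs_mult using \<Theta>b[of t] HK M by (intro mult_mono Zb H) auto
      qed (use Z0[of x t] \<Theta>0[of t] M HK pos in auto)
      show "Z x t * (h x * \<Theta> t) = 0" if "x \<notin> {0..R} \<or> t \<notin> {0..T}" for x t
        using that Z0[of x t] \<Theta>0[of t] h0[of x] by auto
    qed measurable
    have i2: "integrable lborel\<^sub>2 (\<lambda>(x, t). z x t * (\<phi> x * \<theta> t))"
    proof (rule integrable_pair_bounded_support[where a=0 and b=R and c=0 and d=T])
      show "\<bar>z x t * (\<phi> x * \<theta> t)\<bar> \<le> M * ((R * H) * R * K)" for x t
      proof (cases "0 < x \<and> x < R")
        case True
        then show ?thesis unfolding abs_mult using \<phi>b[of x] HK M pos by (intro mult_mono zb K) auto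
      qed (use z0[of x t] \<phi>0[of x] M HK pos in auto)
      show "z x t * (\<phi> x * \<theta> t) = 0" if "x \<notin> {0..R} \<or> t \<notin> {0..T}" for x t
        using that z0[of x t] \<phi>0[of x] \<theta>0[of t] by auto
    qed measurable
    have "(\<integral>p. Y (fst p) (snd p) * (h (fst p) * \<theta> (snd p)) \<partial>lborel\<^sub>2) = (\<integral>x. \<integral>s. Y x s * (h x * \<theta> s) \<partial>lborel \<partial>lborel)"
      using lborel_pair.integral_fst[OF intYB(1)[OF h \<theta> h0 \<theta>0]] by (simp add: case_prod_beta')
    also have "\<dots> = (\<integral>x. h x * (\<integral>t. Z x t * \<Theta> t \<partial>lborel) \<partial>lborel)"
    proof (rule Bochner_Integration.integral_cong)
      fix x
      have "(\<integral>t. Z x t * \<Theta> t \<partial>lborel) = (\<integral>s. \<theta> s * Y x s \<partial>lborel)"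
        using convolution_swap[of "Z x" M \<theta> K T "\<lambda>_. 1"] Zb Z0 K \<theta>0 unfolding \<Theta>_def Y_def by simp
      then show "(\<integral>s. Y x s * (h x * \<theta> s) \<partial>lborel) = h x * (\<integral>t. Z x t * \<Theta> t \<partial>lborel)"
        by (simp add: mult_ac flip: integral_mult_right_zero)
    qed simp
    also have "\<dots> = (\<integral>x. \<integral>t. Z x t * (h x * \<Theta> t) \<partial>lborel \<partial>lborel)"
      unfolding integral_mult_right_zero[symmetric] by (simp add: mult_ac)
    also have "\<dots> = (\<integral>p. Z (fst p) (snd p) * (h (fst p) * \<Theta> (snd p)) \<partial>lborel\<^sub>2)"
      using lborel_pair.integral_fst[OF i1] by (simp add: case_prod_beta')
    finally have 1: "(\<integral>p. Y (fst p) (snd p) * (h (fst p) * \<theta> (snd p)) \<partial>lborel\<^sub>2) = \<dots>" .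
    have "(\<integral>p. B (fst p) (snd p) * (h (fst p) * \<theta> (snd p)) \<partial>lborel\<^sub>2) = (\<integral>t. \<integral>y. B y t * (h y * \<theta> t) \<partial>lborel \<partial>lborel)"
      using lborel_pair.integral_snd[OF intYB(2)[OF h \<theta> h0 \<theta>0]] by (simp add: case_prod_beta')
    also have "\<dots> = (\<integral>t. \<theta> t * (\<integral>x. z x t * \<phi> x \<partial>lborel) \<partial>lborel)"
    proof (rule Bochner_Integration.integral_cong)
      fix t
      have "(\<integral>x. z x t * \<phi> x \<partial>lborel) = (\<integral>y. h y * B y t \<partial>lborel)"
        using convolution_swap[of "\<lambda>x. z x t" M h H R "\<lambda>r. r"] zb z0 H h0 unfolding \<phi>_def B_def by simp
      then show "(\<integral>y. B y t * (h y * \<theta> t) \<partial>lborel) = \<theta> t * (\<integral>x. z x t * \<phi> x \<partial>lborel)"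
        by (simp add: mult_ac flip: integral_mult_right_zero)
    qed simp
    also have "\<dots> = (\<integral>t. \<integral>x. z x t * (\<phi> x * \<theta> t) \<partial>lborel \<partial>lborel)"
      unfolding integral_mult_right_zero[symmetric] by (simp add: mult_ac)
    also have "\<dots> = (\<integral>p. z (fst p) (snd p) * (\<phi> (fst p) * \<theta> (snd p)) \<partial>lborel\<^sub>2)"
      using lborel_pair.integral_snd[OF i2] by (simp add: case_prod_beta')
    finally have 2: "(\<integral>p. B (fst p) (snd p) * (h (fst p) * \<theta> (snd p)) \<partial>lborel\<^sub>2) = \<dots>" .
    have "0 = (\<integral>p. Z (fst p) (snd p) * (h (fst p) * \<Theta> (snd p)) - z (fst p) (snd p) * (\<phi> (fst p) * \<theta> (snd p)) \<partial>lborel\<^sub>2)"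
      using weak[OF h \<theta> h0 \<theta>0 pos m] unfolding \<Theta>_def \<phi>_def by simp
    also have "\<dots> = (\<integral>p. Y (fst p) (snd p) * (h (fst p) * \<theta> (snd p)) \<partial>lborel\<^sub>2) - (\<integral>p. B (fst p) (snd p) * (h (fst p) * \<theta> (snd p)) \<partial>lborel\<^sub>2)"
      unfolding 1 2 using i1 i2 by (simp add: case_prod_beta')
    also have "\<dots> = (\<integral>p. Y (fst p) (snd p) * (h (fst p) * \<theta> (snd p)) - B (fst p) (snd p) * (h (fst p) * \<theta> (snd p)) \<partial>lborel\<^sub>2)"
      using intYB[OF h \<theta> h0 \<theta>0] by (simp add: case_prod_beta')
    finally show ?thesis by (simp add: left_diff_distrib)
  qed
  \<comment> \<open>The test functions need \<open>\<integral>y h(y) dy = 0\<close>, so \<open>Y - B\<close> is only determined up to \<open>\<alpha>(t) x\<close>;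
    subtracting a multiple of the bump \<open>h0\<close>, for which this moment is 1, fixes \<open>\<alpha>\<close>.\<close>
  define h0 where "h0 y = 12 * max 0 (y * (1 - y))" for y :: real
  have h0c: "continuous_on UNIV h0" unfolding h0_def by (intro continuous_intros)
  have h00: "h0 x = 0" if "x \<notin> {0<..<1}" for x
    using that by (auto simp: h0_def max_def mult_le_0_iff zero_le_mult_iff not_less)
  have h0b: "\<bar>h0 x\<bar> \<le> 12" for x
  proof (cases "x \<in> {0<..<1}")
    case True
    then have "x * (1 - x) \<le> 1 * 1" by (intro mult_mono) auto
    then show ?thesis using True by (simp add: h0_def)
  qed (use h00 in auto)
  have [measurable]: "h0 \<in> borel_measurable borel"
    using h0c by (rule borel_measurable_continuous_onI)
  have ih0: "integrable lborel (\<lambda>y. y * h0 y)"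
  proof (rule integrable_of_bounded_vanishing[where K=12 and a=0 and b=1])
    show "\<bar>y * h0 y\<bar> \<le> 12" for y
    proof (cases "y \<in> {0<..<1}")
      case True
      then have "\<bar>y\<bar> * \<bar>h0 y\<bar> \<le> 1 * 12" by (intro mult_mono h0b) auto
      then show ?thesis by (simp add: abs_mult)
    qed (use h00 in auto)
  qed (use h00 in auto)
  \<comment> \<open>The factor 12 normalises: int y^2 (1 - y) dy over [0, 1] is 1/12.\<close>
  have h0m: "(\<integral>y. y * h0 y \<partial>lborel) = 1"
  proof -
    have eq: "(\<lambda>y. y * h0 y) = (\<lambda>y. indicator (cbox 0 1) y * (12 * y^2 - 12 * y^3))"
    proof
      fix y :: real
      show "y * h0 y = indicator (cbox 0 1) y * (12 * y^2 - 12 * y^3)"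
        using h00[of y] by (cases "y \<in> {0<..<1}") (auto simp: h0_def algebra_simps power2_eq_square power3_eq_cube indicator_def max_def mult_le_0_iff)
    qed
    have "((\<lambda>y::real. 12 * y^2 - 12 * y^3) has_integral (4 * 1^3 - 3 * 1^4) - (4 * 0^3 - 3 * 0^4)) {0..1}"
      by (rule fundamental_theorem_of_calculus) (auto simp flip: has_real_derivative_iff_has_vector_derivative intro!: derivative_eq_intros)
    then have "integral (cbox 0 1) (\<lambda>y::real. 12 * y^2 - 12 * y^3) = 1" by (auto simp: integral_unique)
    then show ?thesis using integral_cbox_eq_lborel(2)[of 0 "1::real" "\<lambda>y. 12 * y^2 - 12 * y^3"] ih0 unfolding eq by simp
  qed
  \<comment> \<open>If \<open>Y - B\<close> equals \<alpha>(t) x, then integrating it against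
    \<open>h0\<close>, whose first moment is 1, returns \<alpha>(t); this is the only
    candidate.\<close>
  define \<alpha> where "\<alpha> t = (\<integral>x. (Y x t - B x t) * h0 x \<partial>lborel)" for t
  have \<alpha>m[measurable]: "\<alpha> \<in> borel_measurable lborel"
    unfolding \<alpha>_def by measurable
  have \<alpha>b: "\<bar>\<alpha> t\<bar> \<le> (12 * M) * (1 + \<bar>t\<bar>)" for t
  proof -
    have "\<alpha> t = (\<integral>x. indicator {0<..<1} x * ((Y x t - B x t) * h0 x) \<partial>lborel)"
      unfolding \<alpha>_def using h00 by (intro Bochner_Integration.integral_cong) (auto simp: indicator_def)
    also have "\<bar>\<dots>\<bar> \<le> (M * (1 + \<bar>t\<bar>) * 12) * (1 - 0)"
    proof (rule integral_interval_bound)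
      fix x :: real assume x: "0 < x" "x < 1"
      have "M * x\<^sup>2 \<le> M * 1\<^sup>2" using x M by (intro mult_left_mono power_mono) auto
      then have "\<bar>Y x t - B x t\<bar> \<le> M * (1 + \<bar>t\<bar>)" using Yb[of x t] Bb[of x t] by (simp add: distrib_left)
      then show "\<bar>(Y x t - B x t) * h0 x\<bar> \<le> M * (1 + \<bar>t\<bar>) * 12"
        unfolding abs_mult by (intro mult_mono h0b) (use M in auto)
    qed (use M in auto)
    finally show ?thesis by simp
  qed
  have \<alpha>0: "\<alpha> t = 0" if "t \<le> 0" for t
    using that by (simp add: \<alpha>_def Y_def B_def z0)
  \<comment> \<open>The function is set to zero off the open quadrant, where the plateaus with
    nonnegative left ends vanish as well.\<close>
  have YB: "AE p in lborel\<^sub>2. (if 0 < fst p \<and> 0 < snd p then Y (fst p) (snd p) - B (fst p) (snd p) - \<alpha> (snd p) * fst p else 0) = 0"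
  proof (rule box_integral_zero_of_plateaus[where F="\<lambda>x t. if 0 < x \<and> 0 < t then Y x t - B x t - \<alpha> t * x else 0"])
    show "\<exists>K. \<forall>x t. \<bar>x\<bar> \<le> r \<longrightarrow> \<bar>t\<bar> \<le> r \<longrightarrow> \<bar>if 0 < x \<and> 0 < t then Y x t - B x t - \<alpha> t * x else 0\<bar> \<le> K" for r
    proof (intro exI allI impI)
      fix x t assume xt: "\<bar>x\<bar> \<le> r" "\<bar>t\<bar> \<le> r"
      have r: "0 \<le> r" using xt by simp
      have "M * \<bar>t\<bar> \<le> M * r" "M * x\<^sup>2 \<le> M * r\<^sup>2"
        using xt M abs_le_square_iff[of x r] r by (auto intro!: mult_left_mono)
      moreover have "\<bar>\<alpha> t * x\<bar> \<le> ((12 * M) * (1 + r)) * r"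
        unfolding abs_mult by (intro mult_mono order_trans[OF \<alpha>b] mult_left_mono) (use xt M r in auto)
      ultimately have "\<bar>Y x t - B x t - \<alpha> t * x\<bar> \<le> M * r + M * r\<^sup>2 + ((12 * M) * (1 + r)) * r"
        using Yb[of x t] Bb[of x t] by linarith
      moreover have "0 \<le> M * r + M * r\<^sup>2 + ((12 * M) * (1 + r)) * r" using M r by simp
      ultimately show "\<bar>if 0 < x \<and> 0 < t then Y x t - B x t - \<alpha> t * x else 0\<bar> \<le> M * r + M * r\<^sup>2 + ((12 * M) * (1 + r)) * r"
        by simp
    qed
    fix a b c d :: real and n :: nat assume ac: "0 \<le> a" "0 \<le> c"
    define R where "R = max b 1"
    define T where "T = max d 1"
    define m where "m = (\<integral>y. y * plateau a b n y \<partial>lborel)"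
    have R: "0 < R" "1 \<le> R" and T: "0 < T" by (auto simp: R_def T_def)
    have g0: "plateau a b n x = 0" if "x \<notin> {0<..<R}" for x
      using that ac by (intro plateau_eq_0) (auto simp: R_def)
    have \<theta>0: "plateau c d n t = 0" if "t \<notin> {0<..<T}" for t
      using that ac by (intro plateau_eq_0) (auto simp: T_def)
    have h0R: "h0 x = 0" if "x \<notin> {0<..<R}" for x
      using that R by (intro h00) auto
    note gc = continuous_plateau[of UNIV a b n] and \<theta>c = continuous_plateau[of UNIV c d n]
    have [measurable]: "plateau a b n \<in> borel_measurable borel" "plateau c d n \<in> borel_measurable borel"
      by (intro borel_measurable_continuous_onI gc \<theta>c)+
    let ?g = "plateau a b n" and ?\<theta> = "plateau c d n"
    have ig: "integrable lborel (\<lambda>y. y * ?g y)"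
    proof (rule integrable_of_bounded_vanishing[where K=R and a=0 and b=R])
      show "\<bar>y * ?g y\<bar> \<le> R" for y
      proof (cases "y \<in> {0<..<R}")
        case True
        then have "\<bar>y\<bar> * \<bar>?g y\<bar> \<le> R * 1" by (intro mult_mono plateau_bounds) auto
        then show ?thesis by (simp add: abs_mult)
      qed (use g0 R in auto)
    qed (use g0 in auto)
    have i\<theta>\<alpha>: "integrable lborel (\<lambda>t. \<alpha> t * ?\<theta> t)"
    proof (rule integrable_of_bounded_vanishing[where K="(12 * M) * (1 + T)" and a=0 and b=T])
      show "\<bar>\<alpha> t * ?\<theta> t\<bar> \<le> (12 * M) * (1 + T)" for t
      proof (cases "t \<in> {0<..<T}")
        case True
        then have "\<bar>\<alpha> t\<bar> * \<bar>?\<theta> t\<bar> \<le> ((12 * M) * (1 + T)) * 1"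
          using M by (intro mult_mono plateau_bounds order_trans[OF \<alpha>b] mult_left_mono) auto
        then show ?thesis by (simp add: abs_mult)
      qed (use \<theta>0 M T in auto)
    qed (use \<theta>0 in auto)
    note iYg = intYB[OF gc \<theta>c g0 \<theta>0] and iYh0 = intYB[OF h0c \<theta>c h0R \<theta>0]
    let ?D = "\<lambda>x t. Y x t - B x t"
    have iDg: "integrable lborel\<^sub>2 (\<lambda>(x, t). ?D x t * (?g x * ?\<theta> t))"
      using Bochner_Integration.integrable_diff[OF iYg] by (simp add: case_prod_beta' left_diff_distrib)
    have iDh0: "integrable lborel\<^sub>2 (\<lambda>(x, t). ?D x t * (h0 x * ?\<theta> t))"
      using Bochner_Integration.integrable_diff[OF iYh0] by (simp add: case_prod_beta' left_diff_distrib)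
    \<comment> \<open>\<open>?g - m * h0\<close> has first moment zero and is therefore admissible;
      the part with \<open>h0\<close>, integrated out in x, produces exactly the term \<alpha>(t)
      x.\<close>
    have "0 = (\<integral>p. ?D (fst p) (snd p) * ((?g (fst p) - m * h0 (fst p)) * ?\<theta> (snd p)) \<partial>lborel\<^sub>2)"
    proof (rule orth[symmetric, where R=R and T=T])
      show "(\<integral>y. y * (?g y - m * h0 y) \<partial>lborel) = 0"
      proof -
        have "(\<integral>y. y * (?g y - m * h0 y) \<partial>lborel) = (\<integral>y. y * ?g y - m * (y * h0 y) \<partial>lborel)"
          by (intro Bochner_Integration.integral_cong) (auto simp: algebra_simps)
        also have "\<dots> = m - m * 1" using ig ih0 h0m by (simp add: m_def)
        finally show ?thesis by simp
      qed
    qed (use R T g0 h0R \<theta>0 in \<open>auto intro!: continuous_intros gc \<theta>c h0c\<close>)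
    also have "\<dots> = (\<integral>p. ?D (fst p) (snd p) * (?g (fst p) * ?\<theta> (snd p)) - m * (?D (fst p) (snd p) * (h0 (fst p) * ?\<theta> (snd p))) \<partial>lborel\<^sub>2)"
      by (intro Bochner_Integration.integral_cong) (auto simp: algebra_simps)
    also have "\<dots> = (\<integral>p. ?D (fst p) (snd p) * (?g (fst p) * ?\<theta> (snd p)) \<partial>lborel\<^sub>2)
        - m * (\<integral>p. ?D (fst p) (snd p) * (h0 (fst p) * ?\<theta> (snd p)) \<partial>lborel\<^sub>2)"
      using iDg iDh0 by (simp add: case_prod_beta')
    also have "(\<integral>p. ?D (fst p) (snd p) * (h0 (fst p) * ?\<theta> (snd p)) \<partial>lborel\<^sub>2) = (\<integral>t. \<integral>x. ?D x t * (h0 x * ?\<theta> t) \<partial>lborel \<partial>lborel)"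
      using lborel_pair.integral_snd[OF iDh0] by (simp add: case_prod_beta')
    also have "\<dots> = (\<integral>t. \<alpha> t * ?\<theta> t \<partial>lborel)"
      unfolding \<alpha>_def by (simp add: mult.assoc[symmetric])
    also have "m * \<dots> = (\<integral>x. \<integral>t. (x * ?g x) * (\<alpha> t * ?\<theta> t) \<partial>lborel \<partial>lborel)"
      unfolding m_def by simp
    also have "\<dots> = (\<integral>p. (fst p * ?g (fst p)) * (\<alpha> (snd p) * ?\<theta> (snd p)) \<partial>lborel\<^sub>2)"
      using lborel_pair.integral_fst[of "\<lambda>x t. (x * ?g x) * (\<alpha> t * ?\<theta> t)"] integrable_tensor[OF ig i\<theta>\<alpha>]
      by (simp add: case_prod_beta')
    finally have "0 = (\<integral>p. ?D (fst p) (snd p) * (?g (fst p) * ?\<theta> (snd p)) - (fst p * ?g (fst p)) * (\<alpha> (snd p) * ?\<theta> (snd p)) \<partial>lborel\<^sub>2)"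
      using iDg integrable_tensor[OF ig i\<theta>\<alpha>] by (simp add: case_prod_beta')
    also have "\<dots> = (\<integral>p. (if 0 < fst p \<and> 0 < snd p then Y (fst p) (snd p) - B (fst p) (snd p) - \<alpha> (snd p) * fst p else 0) * (?g (fst p) * ?\<theta> (snd p)) \<partial>lborel\<^sub>2)"
    proof (rule Bochner_Integration.integral_cong)
      fix p :: "real \<times> real"
      show "?D (fst p) (snd p) * (?g (fst p) * ?\<theta> (snd p)) - (fst p * ?g (fst p)) * (\<alpha> (snd p) * ?\<theta> (snd p))
        = (if 0 < fst p \<and> 0 < snd p then Y (fst p) (snd p) - B (fst p) (snd p) - \<alpha> (snd p) * fst p else 0) * (?g (fst p) * ?\<theta> (snd p))"
        using g0[of "fst p"] \<theta>0[of "snd p"] by (auto simp: algebra_simps)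
    qed simp
    finally show "\<dots> = 0" by simp
  qed auto
  define P where "P x t = \<alpha> t + (\<integral>y. indicator {0<..<x} y * z y t \<partial>lborel)" for x t
  define U where "U x t = (\<integral>y. indicator {0<..<x} y * P y t \<partial>lborel)" for x t
  \<comment> \<open>The iterated x-primitive of \<open>z\<close> is \<open>B\<close> after an
    exchange of order, so \<open>U\<close> is the expression just found for
    \<open>Y\<close>.\<close>
  have U_eq: "U x t = B x t + \<alpha> t * x" if "0 < x" for x t
  proof -
    have "U x t = (\<integral>y. indicator {0<..<x} y * (\<integral>s. indicator {0<..<y} s * z s t \<partial>lborel) + \<alpha> t * indicator {0<..<x} y \<partial>lborel)"
      unfolding U_def P_def by (intro Bochner_Integration.integral_cong) (auto simp: algebra_simps)
    also have "\<dots> = (\<integral>y. indicator {0<..<x} y * (\<integral>s. indicator {0<..<y} s * z s t \<partial>lborel) \<partial>lborel) + (\<integral>y. \<alpha> t * indicator {0<..<x} y \<partial>lborel)"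
    proof (rule Bochner_Integration.integral_add)
      show "integrable lborel (\<lambda>y. \<alpha> t * indicator {0<..<x} y)"
        by (intro integrable_mult_right integrable_real_indicator) (use that in auto)
      have [measurable]: "(\<lambda>y. \<integral>s. indicator {0<..<y} s * z s t \<partial>lborel) \<in> borel_measurable borel"
        by (intro borel_measurable_interval_integral; measurable)
      show "integrable lborel (\<lambda>y. indicator {0<..<x} y * (\<integral>s. indicator {0<..<y} s * z s t \<partial>lborel))"
      proof (rule integrable_of_bounded_vanishing[where K="M * x" and a=0 and b=x])
        show "\<bar>indicator {0<..<x} y * (\<integral>s. indicator {0<..<y} s * z s t \<partial>lborel)\<bar> \<le> M * x" for y
        proof (cases "y \<in> {0<..<x}")
          case True
          then have "\<bar>\<integral>s. indicator {0<..<y} s * z s t \<partial>lborel\<bar> \<le> M * (y - 0)"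
            by (intro integral_interval_bound zb M) auto
          also have "\<dots> \<le> M * x" using True M by (intro mult_left_mono) auto
          finally show ?thesis using True by simp
        qed (use M that in auto)
      qed auto
    qed
    also have "(\<integral>y. indicator {0<..<x} y * (\<integral>s. indicator {0<..<y} s * z s t \<partial>lborel) \<partial>lborel)
        = (\<integral>s. z s t * (\<integral>y. indicator {s<..} y * indicator {0<..<x} y \<partial>lborel) \<partial>lborel)"
      using convolution_swap[of "\<lambda>s. z s t" M "indicator {0<..<x}" 1 x "\<lambda>_. 1"] zb z0 by (simp add: indicator_def)
    also have "\<dots> = B x t"
      unfolding B_def
    proof (rule Bochner_Integration.integral_cong)
      fix s
      show "z s t * (\<integral>y. indicator {s<..} y * indicator {0<..<x} y \<partial>lborel) = indicator {0<..<x} s * ((x - s) * z s t)"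
      proof (cases "0 < s")
        case True
        then have eq: "(\<lambda>y. indicator {s<..} y * indicator {0<..<x} y :: real) = indicator {s<..<x}"
          by (auto simp: indicator_def)
        show ?thesis unfolding eq using True by (cases "s < x") auto
      qed (use z0 in simp)
    qed simp
    finally show ?thesis using that by simp
  qed
  have "AE p in lborel\<^sub>2. 0 < fst p \<longrightarrow> P (fst p) (snd p) = 0"
  proof (rule energy_uniqueness[where U=U and Y=Y and P=P and z=z and Z=Z and \<alpha>=\<alpha> and M=M and c=c and A="12*M"])
    show "AE p in lborel\<^sub>2. 0 < fst p \<longrightarrow> Y (fst p) (snd p) = U (fst p) (snd p)"
      using YB
    proof eventually_elim
      case (elim p)
      show ?case
      proof (cases "0 < snd p")
        case False
        then show ?thesis by (simp add: U_eq \<alpha>0 Y_def B_def z0)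
      qed (use elim U_eq in \<open>auto split: if_splits\<close>)
    qed
  qed (use zm Zm zb Zb z0 Z0 c mono \<alpha>m \<alpha>b \<alpha>0 Y_def P_def U_def in auto)
  then have P0: "AE p in lborel\<^sub>2. 0 < fst p \<longrightarrow> P (fst p) (snd p) = 0" .
  \<comment> \<open>Countably many null sets cover all shifts by \<open>1 / Suc n\<close>. At almost
    every point \<open>P\<close> vanishes there and at the shifted points with positive x, so the
    backward quotients of \<open>F\<close>, which equals \<open>P\<close> minus \<alpha>(t), are
    eventually 0; they also converge to \<open>z\<close>.\<close>
  have "AE p in lborel\<^sub>2. \<forall>n. 0 < fst p - 1 / Suc n \<longrightarrow> P (fst p - 1 / Suc n) (snd p) = 0"
    using AE_lborel_translate[of "\<lambda>p. 0 < fst p \<longrightarrow> P (fst p) (snd p) = 0" "(1 / Suc n, 0)" for n] P0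
    unfolding lborel_prod AE_all_countable by simp
  moreover
  define F where "F x t = (\<integral>y. indicator {0<..<x} y * z y t \<partial>lborel)" for x t
  have Fm: "case_prod F \<in> borel_measurable lborel\<^sub>2"
    unfolding case_prod_beta' F_def by (intro borel_measurable_add borel_measurable_interval_integral; measurable)
  note [measurable (raw)] = measurable_app2[OF Fm]
  define Q where "Q x t \<longleftrightarrow> (\<forall>k. \<exists>N. \<forall>n\<ge>N. \<bar>(F x t - F (x - 1 / Suc n) t) * Suc n - z x t\<bar> < 1 / Suc k)" for x t
  have Qm: "{p \<in> space lborel\<^sub>2. Q (fst p) (snd p)} \<in> sets lborel\<^sub>2"
    unfolding Q_def by measurable
  \<comment> \<open>Differentiation works along lines of fixed \<open>t\<close>, whereas the product
    measure takes \<open>x\<close> as the outer variable; measurability of the set allows the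
    exchange.\<close>
  have "AE t in lborel. AE x in lborel. Q x t"
    unfolding Q_def LIMSEQ_iff_inverse_Suc[symmetric] F_def
    by (intro AE_I2 lebesgue_differentiation_backward[where M=M]) (use zb z0 in auto)
  then have "AE x in lborel. AE t in lborel. Q x t"
    using lborel_pair.AE_commute[OF Qm] by simp
  then have "AE p in lborel\<^sub>2. Q (fst p) (snd p)"
    by (intro lborel_pair.AE_pair_measure Qm) simp
  ultimately show ?thesis
    using P0 unfolding Q_def LIMSEQ_iff_inverse_Suc[symmetric]
  proof eventually_elim
    case (elim p)
    show ?case
    proof (cases "0 < fst p")
      case True
      then obtain N where N: "1 / Suc N < fst p" using nat_approx_posE by metis
      have "(F (fst p) (snd p) - F (fst p - 1 / Suc n) (snd p)) * Suc n = 0" if "n \<ge> N" for n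
      proof -
        have "1 / Suc n \<le> 1 / Suc N" using that by (simp add: frac_le)
        then have "0 < fst p - 1 / Suc n" using N by linarith
        then have "P (fst p - 1 / Suc n) (snd p) = P (fst p) (snd p)" using elim True by simp
        then show ?thesis by (simp add: P_def F_def)
      qed
      then have "(\<lambda>n. (F (fst p) (snd p) - F (fst p - 1 / Suc n) (snd p)) * Suc n) \<longlonglongrightarrow> 0"
        by (intro tendsto_eventually) (auto simp: eventually_sequentially)
      then show ?thesis using elim LIMSEQ_unique by blast
    qed (use z0 in auto)
  qed
qed

section \<open>Uniqueness of weak solutions\<close>

lemma strip_in_sets_lebesgue: "strip T \<in> sets lebesgue"
proof -
  have "open (strip T)" unfolding strip_def by (intro open_Times open_greaterThan open_greaterThanLessThan)
  then show ?thesis by (intro sets_completionI_sets) simp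
qed

lemma quadrant_in_sets_lebesgue: "quadrant \<in> sets lebesgue"
proof -
  have "closed quadrant" unfolding quadrant_def by (intro closed_Times closed_atLeast)
  then show ?thesis by (intro sets_completionI_sets) simp
qed

lemma diffusion_difference:
  assumes "d\<^sub>u > 0" "d\<^sub>v \<ge> 0" "r \<le> s"
  shows "0 \<le> diffusion d\<^sub>u d\<^sub>v s - diffusion d\<^sub>u d\<^sub>v r"
    and "diffusion d\<^sub>u d\<^sub>v s - diffusion d\<^sub>u d\<^sub>v r \<le> max d\<^sub>u d\<^sub>v * (s - r)"
proof -
  have L: "max d\<^sub>u d\<^sub>v \<ge> d\<^sub>u" "max d\<^sub>u d\<^sub>v \<ge> d\<^sub>v" by auto
  consider "0 \<le> r" | "r < 0" "0 \<le> s" | "s < 0" by linarith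
  then have "0 \<le> diffusion d\<^sub>u d\<^sub>v s - diffusion d\<^sub>u d\<^sub>v r \<and>
      diffusion d\<^sub>u d\<^sub>v s - diffusion d\<^sub>u d\<^sub>v r \<le> max d\<^sub>u d\<^sub>v * (s - r)"
  proof cases
    case 1
    then show ?thesis using assms mult_right_mono[OF L(1), of "s - r"] mult_left_mono[of r s d\<^sub>u]
      by (simp add: diffusion_def right_diff_distrib)
  next
    case 2
    have "d\<^sub>u * s + d\<^sub>v * (- r) \<le> max d\<^sub>u d\<^sub>v * s + max d\<^sub>u d\<^sub>v * (- r)"
      using 2 by (intro add_mono mult_right_mono L) auto
    moreover have "0 \<le> d\<^sub>u * s" "d\<^sub>v * r \<le> 0" using 2 assms by (auto simp: mult_nonneg_nonpos)
    ultimately show ?thesis using 2 by (simp add: diffusion_def right_diff_distrib)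
  next
    case 3
    then show ?thesis using assms mult_right_mono[OF L(2), of "s - r"] mult_left_mono[of r s d\<^sub>v]
      by (simp add: diffusion_def right_diff_distrib)
  qed
  then show "0 \<le> diffusion d\<^sub>u d\<^sub>v s - diffusion d\<^sub>u d\<^sub>v r"
    "diffusion d\<^sub>u d\<^sub>v s - diffusion d\<^sub>u d\<^sub>v r \<le> max d\<^sub>u d\<^sub>v * (s - r)" by auto
qed

lemma diffusion_lipschitz:
  assumes "d\<^sub>u > 0" "d\<^sub>v \<ge> 0"
  shows "\<bar>diffusion d\<^sub>u d\<^sub>v s - diffusion d\<^sub>u d\<^sub>v r\<bar> \<le> max d\<^sub>u d\<^sub>v * \<bar>s - r\<bar>"
  using diffusion_difference[OF assms, of r s] diffusion_difference[OF assms, of s r]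
  by (cases "r \<le> s") auto

text \<open>Monotonicity turns (s - r) E, with E the increment of the diffusion function, into a
  product of absolute values, and the Lipschitz bound replaces |s - r| by |E| / max. This is
  co-coercivity: unlike a lower bound by (s - r)^2 it holds for
  \<open>d\<^sub>v = 0\<close>.\<close>

lemma diffusion_strongly_monotone:
  assumes "d\<^sub>u > 0" "d\<^sub>v \<ge> 0"
  shows "1 / max d\<^sub>u d\<^sub>v * (diffusion d\<^sub>u d\<^sub>v s - diffusion d\<^sub>u d\<^sub>v r)\<^sup>2
    \<le> (s - r) * (diffusion d\<^sub>u d\<^sub>v s - diffusion d\<^sub>u d\<^sub>v r)"
proof -
  have L: "0 < max d\<^sub>u d\<^sub>v" using assms by auto
  define E where "E = diffusion d\<^sub>u d\<^sub>v s - diffusion d\<^sub>u d\<^sub>v r"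
  have "0 \<le> (s - r) * E"
    using diffusion_difference(1)[OF assms, of r s] diffusion_difference(1)[OF assms, of s r]
    by (cases "r \<le> s") (auto simp: E_def zero_le_mult_iff)
  then have "(s - r) * E = \<bar>s - r\<bar> * \<bar>E\<bar>" by (simp add: abs_mult[symmetric])
  moreover have "\<bar>E\<bar> * \<bar>E\<bar> \<le> (max d\<^sub>u d\<^sub>v * \<bar>s - r\<bar>) * \<bar>E\<bar>"
    unfolding E_def by (intro mult_right_mono diffusion_lipschitz assms) auto
  ultimately have "E\<^sup>2 \<le> max d\<^sub>u d\<^sub>v * ((s - r) * E)"
    by (simp add: power2_eq_square mult_ac)
  then show ?thesis using L unfolding E_def[symmetric] by (simp add: field_simps)
qed

lemma borel_measurable_diffusion[measurable]: "diffusion d\<^sub>u d\<^sub>v \<in> borel_measurable borel"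
  unfolding diffusion_def by measurable

text \<open>A Borel function bounded everywhere replaces the class of \<open>w\<close>, so that
  Fubini and pointwise bounds become available. Truncation at the essential bound changes values on
  a null set only; the extension by zero is the convention of the uniqueness argument.\<close>

lemma Linfty_quadrant_representative:
  assumes "Linfty_quadrant w"
  obtains g C where "case_prod g \<in> borel_measurable lborel\<^sub>2" "\<And>x t. \<bar>g x t\<bar> \<le> C"
    "\<And>x t. x \<le> 0 \<or> t \<le> 0 \<Longrightarrow> g x t = 0"
    "AE p in lebesgue. 0 < fst p \<and> 0 < snd p \<longrightarrow> w (fst p) (snd p) = g (fst p) (snd p)"
proof -
  note qs = quadrant_in_sets_lebesgue
  obtain C where C: "AE p in lebesgue_on quadrant. \<bar>case_prod w p\<bar> \<le> C"
    using assms unfolding Linfty_quadrant_def by (auto simp: case_prod_beta')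
  have wm: "case_prod w \<in> borel_measurable (lebesgue_on quadrant)"
    using assms unfolding Linfty_quadrant_def by simp
  then have "(\<lambda>p. indicator quadrant p *\<^sub>R case_prod w p) \<in> borel_measurable lebesgue"
    using qs by (subst (asm) borel_measurable_restrict_space_iff) auto
  then obtain g' where g': "g' \<in> borel_measurable lborel" "AE p in lborel. indicator quadrant p *\<^sub>R case_prod w p = g' p"
    using completion_ex_borel_measurable_real by blast
  have [measurable]: "g' \<in> borel_measurable lborel\<^sub>2" using g'(1) by (simp add: lborel_prod)
  define g where "g x t = (if 0 < x \<and> 0 < t then max (- \<bar>C\<bar>) (min \<bar>C\<bar> (g' (x, t))) else 0)" for x t
  have "case_prod g \<in> borel_measurable lborel\<^sub>2" unfolding g_def by measurable
  moreover have "\<bar>g x t\<bar> \<le> \<bar>C\<bar>" for x t by (auto simp: g_def)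
  moreover have "g x t = 0" if "x \<le> 0 \<or> t \<le> 0" for x t using that by (auto simp: g_def)
  moreover have "AE p in lebesgue. 0 < fst p \<and> 0 < snd p \<longrightarrow> w (fst p) (snd p) = g (fst p) (snd p)"
  proof -
    have "AE p in lebesgue. p \<in> quadrant \<longrightarrow> \<bar>case_prod w p\<bar> \<le> C"
      using C qs by (subst (asm) AE_restrict_space_iff) auto
    then show ?thesis using AE_completion[OF g'(2)]
    proof eventually_elim
      case (elim p)
      then show ?case by (cases p) (auto simp: g_def quadrant_def split: if_splits)
    qed
  qed
  ultimately show ?thesis by (rule that)
qed

text \<open>The Borel integrand vanishes off the strip: on the left and below because
  \<open>g\<close> and D(0) are zero, for \<open>T \<le> t\<close> because \<open>A\<close> and
  \<open>E\<close> are. The integral may therefore be taken over the whole plane.\<close>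

lemma integral_strip_eq:
  assumes w: "(\<lambda>(x, t). w x t) \<in> borel_measurable (lebesgue_on quadrant)"
    and g: "case_prod g \<in> borel_measurable lborel\<^sub>2"
    and g0: "\<And>x t. x \<le> 0 \<or> t \<le> 0 \<Longrightarrow> g x t = 0"
    and ae: "AE p in lebesgue. 0 < fst p \<and> 0 < snd p \<longrightarrow> w (fst p) (snd p) = g (fst p) (snd p)"
    and A: "case_prod A \<in> borel_measurable lborel\<^sub>2" "\<And>x t. T \<le> t \<Longrightarrow> A x t = 0"
    and E: "case_prod E \<in> borel_measurable lborel\<^sub>2" "\<And>x t. T \<le> t \<Longrightarrow> E x t = 0"
  shows "(LINT (x, t)|lebesgue_on (strip T). w x t * A x t + diffusion d\<^sub>u d\<^sub>v (w x t) * E x t)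
    = (\<integral>p. g (fst p) (snd p) * A (fst p) (snd p) + diffusion d\<^sub>u d\<^sub>v (g (fst p) (snd p)) * E (fst p) (snd p) \<partial>lborel\<^sub>2)"
proof -
  let ?k = "\<lambda>v p. v (fst p) (snd p) * A (fst p) (snd p) + diffusion d\<^sub>u d\<^sub>v (v (fst p) (snd p)) * E (fst p) (snd p)"
  note ss = strip_in_sets_lebesgue[of T]
  have sq: "strip T \<subseteq> quadrant" by (auto simp: strip_def quadrant_def)
  have [measurable]: "case_prod w \<in> borel_measurable (lebesgue_on (strip T))"
    using measurable_restrict_mono[OF w sq] by simp
  have Alb: "case_prod A \<in> borel_measurable (lebesgue_on (strip T))" "case_prod E \<in> borel_measurable (lebesgue_on (strip T))"
    using A(1) E(1) by (auto intro!: measurable_restrict_space1 measurable_completion simp: lborel_prod)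
  have "(\<lambda>p. case_prod w p * case_prod A p + diffusion d\<^sub>u d\<^sub>v (case_prod w p) * case_prod E p) \<in> borel_measurable (lebesgue_on (strip T))"
    using Alb by measurable
  then have km: "?k w \<in> borel_measurable (lebesgue_on (strip T))" by (simp add: case_prod_beta')
  note [measurable (raw)] = measurable_app2[OF g] measurable_app2[OF A(1)] measurable_app2[OF E(1)]
  have gm: "?k g \<in> borel_measurable lborel\<^sub>2" by measurable
  have gz: "indicator (strip T) p *\<^sub>R ?k g p = ?k g p" for p
  proof (cases "p \<in> strip T")
    case False
    then consider "fst p \<le> 0 \<or> snd p \<le> 0" | "T \<le> snd p" by (cases p) (auto simp: strip_def)
    then have "?k g p = 0" by cases (simp_all add: g0 A(2) E(2) diffusion_def)
    then show ?thesis by simp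
  qed simp
  have "(LINT (x, t)|lebesgue_on (strip T). w x t * A x t + diffusion d\<^sub>u d\<^sub>v (w x t) * E x t) = integral\<^sup>L (lebesgue_on (strip T)) (?k w)"
    by (simp add: case_prod_beta')
  also have "\<dots> = (\<integral>p. indicator (strip T) p *\<^sub>R ?k w p \<partial>lebesgue)"
    using ss by (subst integral_restrict_space) auto
  also have "\<dots> = (\<integral>p. ?k g p \<partial>lebesgue)"
  proof (rule integral_cong_AE)
    show "(\<lambda>p. indicator (strip T) p *\<^sub>R ?k w p) \<in> borel_measurable lebesgue"
      using km ss by (subst (asm) borel_measurable_restrict_space_iff) auto
    show "?k g \<in> borel_measurable lebesgue"
      using gm by (intro measurable_completion) (simp add: lborel_prod)
    show "AE p in lebesgue. indicator (strip T) p *\<^sub>R ?k w p = ?k g p"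
      using ae
    proof eventually_elim
      case (elim p)
      then show ?case by (subst gz[symmetric]) (cases p, auto simp: strip_def indicator_def)
    qed
  qed
  also have "\<dots> = (\<integral>p. ?k g p \<partial>lborel)"
    using gm by (intro integral_completion) (simp add: lborel_prod)
  finally show ?thesis unfolding lborel_prod .
qed

section \<open>Separated test functions built from iterated tail integrals\<close>

lemma tail_integral_has_derivative:
  fixes g :: "real \<Rightarrow> real"
  assumes g: "continuous_on UNIV g" and g0: "\<And>x. x \<notin> {0<..<R} \<Longrightarrow> g x = 0"
  shows "((\<lambda>x. \<integral>y. indicator {x<..} y * g y \<partial>lborel) has_real_derivative - g x) (at x)"
proof -
  \<comment> \<open>The right end of the interval lies beyond the support, so near \<open>x\<close>
    the tail is an integral over a compact interval and the fundamental theorem applies.\<close>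
  define a where "a = min x 0 - 1"
  define b where "b = max x R + 1"
  have ab: "a < x" "x < b" "a < 0" "R < b" by (auto simp: a_def b_def)
  have io: "g integrable_on {u..v}" for u v
    by (intro integrable_continuous_interval continuous_on_subset[OF g]) auto
  have eq: "(\<integral>s. indicator {y<..} s * g s \<partial>lborel) = integral {a..b} g - integral {a..y} g" if y: "a < y" "y < b" for y
  proof -
    have sm: "set_integrable lborel {y..b} g"
      by (intro borel_integrable_atLeastAtMost') (rule continuous_on_subset[OF g], simp)
    have "(\<integral>s. indicator {y<..} s * g s \<partial>lborel) = (\<integral>s. indicator {y..b} s * g s \<partial>lborel)"
    proof (rule integral_cong_AE)
      show "AE s in lborel. indicator {y<..} s * g s = indicator {y..b} s * g s"
        using AE_lborel_singleton[of y]
        by eventually_elim (use g0 y ab in \<open>auto simp: indicator_def\<close>)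
    qed (use borel_measurable_continuous_onI[OF g] in auto)
    also have "\<dots> = integral {y..b} g"
      using set_borel_integral_eq_integral(2)[OF sm] by (simp add: set_lebesgue_integral_def)
    also have "\<dots> = integral {a..b} g - integral {a..y} g"
      using Henstock_Kurzweil_Integration.integral_combine[of a y b g] io y by simp
    finally show ?thesis .
  qed
  have "((\<lambda>y. integral {a..y} g) has_real_derivative g x) (at x within {a..b})"
    by (rule integral_has_real_derivative) (use ab continuous_on_subset[OF g] in auto)
  then have "((\<lambda>y. integral {a..y} g) has_real_derivative g x) (at x)"
    using ab at_within_interior[of x "{a..b}"] by simp
  then have "((\<lambda>y. integral {a..b} g - integral {a..y} g) has_real_derivative - g x) (at x)"
    by (auto intro!: derivative_eq_intros)
  then show ?thesis
  proof (rule has_field_derivative_transform_within_open[where S="{a<..<b}"])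
    show "integral {a..b} g - integral {a..y} g = (\<integral>s. indicator {y<..} s * g s \<partial>lborel)" if "y \<in> {a<..<b}" for y
      using eq[of y] that by simp
  qed (use ab in auto)
qed

lemma weak_solutionD:
  assumes "weak_solution d\<^sub>u d\<^sub>v U\<^sub>0 V\<^sub>0 w" "T > 0" "test_function T \<psi> \<psi>x \<psi>xx \<psi>t"
  shows "(LINT (x, t)|lebesgue_on (strip T). w x t * \<psi>t x t + diffusion d\<^sub>u d\<^sub>v (w x t) * \<psi>xx x t)
        = - d\<^sub>u * U\<^sub>0 * (LINT t|lebesgue_on {0<..<T}. \<psi>x 0 t)
          - (LINT x|lebesgue_on {0<..}. initial_datum V\<^sub>0 x * \<psi> x 0)"
  using assms unfolding weak_solution_def by blast

lemma integrable_times_tensor: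
  fixes k :: "real \<Rightarrow> real \<Rightarrow> real"
  assumes k: "case_prod k \<in> borel_measurable lborel\<^sub>2" and kb: "\<And>x t. \<bar>k x t\<bar> \<le> C"
    and k0: "\<And>x t. x \<le> 0 \<or> t \<le> 0 \<Longrightarrow> k x t = 0"
    and f: "continuous_on UNIV f" "\<And>x. R \<le> x \<Longrightarrow> f x = 0" and e: "continuous_on UNIV e" "\<And>t. T \<le> t \<Longrightarrow> e t = 0"
  shows "integrable lborel\<^sub>2 (\<lambda>(x, t). k x t * (f x * e t))"
proof -
  note [measurable (raw)] = measurable_app2[OF k]
  have [measurable]: "f \<in> borel_measurable borel" "e \<in> borel_measurable borel"
    using f e by (auto intro: borel_measurable_continuous_onI)
  have "bounded (f ` {0..R})" "bounded (e ` {0..T})"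
    by (intro compact_imp_bounded compact_continuous_image continuous_on_subset[OF f(1)] continuous_on_subset[OF e(1)]; simp)+
  then obtain F E where "\<forall>y \<in> f ` {0..R}. \<bar>y\<bar> \<le> F" "\<forall>y \<in> e ` {0..T}. \<bar>y\<bar> \<le> E"
    unfolding bounded_iff real_norm_def by metis
  then have F: "\<And>x. x \<in> {0..R} \<Longrightarrow> \<bar>f x\<bar> \<le> F" and E: "\<And>t. t \<in> {0..T} \<Longrightarrow> \<bar>e t\<bar> \<le> E"
    by simp_all
  have C: "0 \<le> C" using kb[of 0 0] by linarith
  have z: "k x t * (f x * e t) = 0" if "x \<notin> {0..R} \<or> t \<notin> {0..T}" for x t
    using that k0[of x t] f(2)[of x] e(2)[of t] by auto
  show ?thesis
  proof (rule integrable_pair_bounded_support[where a=0 and b=R and c=0 and d=T])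
    show "\<bar>k x t * (f x * e t)\<bar> \<le> C * (\<bar>F\<bar> * \<bar>E\<bar>)" for x t
    proof (cases "x \<in> {0..R} \<and> t \<in> {0..T}")
      case True
      then show ?thesis unfolding abs_mult
        by (intro mult_mono kb order_trans[OF F abs_ge_self] order_trans[OF E abs_ge_self]) (use C in auto)
    next
      case False
      then have "\<bar>k x t * (f x * e t)\<bar> = 0" using z[of x t] by (metis abs_zero)
      moreover have "0 \<le> C * (\<bar>F\<bar> * \<bar>E\<bar>)" using C by simp
      ultimately show ?thesis by linarith
    qed
  qed (measurable, rule z)
qed

text \<open>Here \<phi>'' = h and \<Theta>' = - \<theta>. Since \<phi>(0) = int y h(y) dy, the
  moment condition is exactly the boundary condition at x = 0, and the terminal condition holds
  because \<theta> vanishes beyond \<open>T\<close>.\<close>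

lemma product_test_function:
  fixes h \<theta> \<Theta> H \<phi> :: "real \<Rightarrow> real"
  assumes h: "continuous_on UNIV h" and \<theta>: "continuous_on UNIV \<theta>"
    and h0: "\<And>x. x \<notin> {0<..<R} \<Longrightarrow> h x = 0" and \<theta>0: "\<And>t. t \<notin> {0<..<T} \<Longrightarrow> \<theta> t = 0"
    and pos: "0 < R" "0 < T" and m: "(\<integral>y. y * h y \<partial>lborel) = 0"
  defines "\<Theta> \<equiv> \<lambda>t. \<integral>s. indicator {t<..} s * \<theta> s \<partial>lborel"
    and "H \<equiv> \<lambda>x. \<integral>y. indicator {x<..} y * h y \<partial>lborel"
    and "\<phi> \<equiv> \<lambda>x. \<integral>y. indicator {x<..} y * ((y - x) * h y) \<partial>lborel"
  shows "test_function T (\<lambda>x t. \<phi> x * \<Theta> t) (\<lambda>x t. - H x * \<Theta> t) (\<lambda>x t. h x * \<Theta> t) (\<lambda>x t. - (\<phi> x * \<theta> t))"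
    and "continuous_on UNIV \<phi>" "continuous_on UNIV \<Theta>" "\<And>x. R \<le> x \<Longrightarrow> \<phi> x = 0" "\<And>t. T \<le> t \<Longrightarrow> \<Theta> t = 0"
proof -
  have [measurable]: "h \<in> borel_measurable borel" using h by (rule borel_measurable_continuous_onI)
  have yh: "continuous_on UNIV (\<lambda>y. y * h y)" by (intro continuous_intros h)
  have yh0: "x * h x = 0" if "x \<notin> {0<..<R}" for x using h0[OF that] by simp
  have "\<exists>K. \<forall>x. \<bar>h x\<bar> \<le> K" using continuous_vanishing_bounded[OF h h0] by metis
  then obtain K where K: "\<And>x. \<bar>h x\<bar> \<le> K" by blast
  have "\<exists>K. \<forall>x. \<bar>x * h x\<bar> \<le> K"
    by (rule continuous_vanishing_bounded[OF yh]) (use yh0 in \<open>blast+\<close>)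
  then obtain K' where K': "\<And>x. \<bar>x * h x\<bar> \<le> K'" by blast
  have "integrable lborel h"
  proof (rule integrable_of_bounded_vanishing[where f=h and K=K and a=0 and b=R])
    show "h x = 0" if "x \<notin> {0..R}" for x using that by (intro h0) auto
  qed (use K in auto)
  then have i1: "integrable lborel (\<lambda>y. indicator {x<..} y * h y)" for x
    using integrable_mult_indicator[of "{x<..}" lborel h] by simp
  have "integrable lborel (\<lambda>y. y * h y)"
  proof (rule integrable_of_bounded_vanishing[where f="\<lambda>y. y * h y" and K=K' and a=0 and b=R])
    show "x * h x = 0" if "x \<notin> {0..R}" for x using that by (intro yh0) auto
    show "\<bar>x * h x\<bar> \<le> K'" for x by (rule K')
  qed measurable
  then have i2: "integrable lborel (\<lambda>y. indicator {x<..} y * (y * h y))" for x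
    using integrable_mult_indicator[of "{x<..}" lborel "\<lambda>y. y * h y"] by simp
  \<comment> \<open>In this form \<phi>' = - x h - (H - x h) = - H, the terms x h
    cancelling.\<close>
  have \<phi>_eq: "\<phi> = (\<lambda>x. (\<integral>y. indicator {x<..} y * (y * h y) \<partial>lborel) - x * H x)"
  proof
    fix x
    have "\<phi> x = (\<integral>y. indicator {x<..} y * (y * h y) - x * (indicator {x<..} y * h y) \<partial>lborel)"
      unfolding \<phi>_def by (intro Bochner_Integration.integral_cong) (auto simp: algebra_simps)
    then show "\<phi> x = (\<integral>y. indicator {x<..} y * (y * h y) \<partial>lborel) - x * H x"
      using i1[of x] i2[of x] by (simp add: H_def)
  qed
  have dH: "(H has_real_derivative - h x) (at x)" for x
    unfolding H_def by (rule tail_integral_has_derivative[OF h h0])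
  have d\<Theta>: "(\<Theta> has_real_derivative - \<theta> t) (at t)" for t
    unfolding \<Theta>_def by (rule tail_integral_has_derivative[OF \<theta> \<theta>0])
  have d\<phi>: "(\<phi> has_real_derivative - H x) (at x)" for x
  proof -
    have "(\<phi> has_real_derivative - (x * h x) - (1 * H x + - h x * x)) (at x)"
      unfolding \<phi>_eq by (intro DERIV_diff DERIV_mult DERIV_ident tail_integral_has_derivative[OF yh yh0] dH)
    then show ?thesis by simp
  qed
  have cont: "continuous_on UNIV H" "continuous_on UNIV \<Theta>" "continuous_on UNIV \<phi>"
    using dH d\<Theta> d\<phi> by (meson DERIV_continuous continuous_at_imp_continuous_on)+
  have cp: "continuous_on S (\<lambda>(x, t). f x * g t)" if "continuous_on UNIV f" "continuous_on UNIV g" for f g :: "real \<Rightarrow> real" and S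
    unfolding case_prod_beta'
    by (intro continuous_on_mult continuous_on_compose2[OF that(1)] continuous_on_compose2[OF that(2)]
        continuous_on_fst continuous_on_snd continuous_on_id) auto
  have \<Theta>T: "\<Theta> t = 0" if "T \<le> t" for t
  proof -
    have "(\<lambda>s. indicator {t<..} s * \<theta> s) = (\<lambda>_. 0)" using \<theta>0 that by (auto simp: indicator_def)
    then show ?thesis by (simp add: \<Theta>_def)
  qed
  have \<phi>R: "\<phi> x = 0" if "R \<le> x" for x
  proof -
    have "(\<lambda>y. indicator {x<..} y * ((y - x) * h y)) = (\<lambda>_. 0)" using h0 that by (auto simp: indicator_def)
    then show ?thesis by (simp add: \<phi>_def)
  qed
  have \<phi>00: "\<phi> 0 = 0"
  proof -
    have "indicator {0<..} y * ((y - 0) * h y) = y * h y" for y using h0[of y] by (cases "0 < y") auto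
    then show ?thesis using m by (simp only: \<phi>_def)
  qed
  have "C21_on_closed_strip T (\<lambda>x t. \<phi> x * \<Theta> t) (\<lambda>x t. - H x * \<Theta> t) (\<lambda>x t. h x * \<Theta> t) (\<lambda>x t. - (\<phi> x * \<theta> t))"
    unfolding C21_on_closed_strip_def
  proof (intro conjI ballI)
    fix p
    show "case p of (x, t) \<Rightarrow> ((\<lambda>y. \<phi> y * \<Theta> t) has_real_derivative - H x * \<Theta> t) (at x within {0..}) \<and>
       ((\<lambda>y. - H y * \<Theta> t) has_real_derivative h x * \<Theta> t) (at x within {0..}) \<and>
       ((\<lambda>s. \<phi> x * \<Theta> s) has_real_derivative - (\<phi> x * \<theta> t)) (at t within {0..T})"
      by (auto intro!: derivative_eq_intros has_field_derivative_at_within[OF d\<phi>]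
          has_field_derivative_at_within[OF dH] has_field_derivative_at_within[OF d\<Theta>] split: prod.split)
  next
    show "continuous_on (closed_strip T) (\<lambda>(x, t). - H x * \<Theta> t)"
      by (intro cp continuous_on_minus cont)
    show "continuous_on (closed_strip T) (\<lambda>(x, t). - (\<phi> x * \<theta> t))"
      using cp[of "\<lambda>x. - \<phi> x" \<theta> "closed_strip T"] cont \<theta> by (simp add: continuous_on_minus)
  qed (intro cp cont h)+
  moreover have "closure {(x, t) \<in> closed_strip T. \<phi> x * \<Theta> t \<noteq> 0} \<subseteq> {0..R} \<times> {0..T}"
  proof (rule closure_minimal)
    show "{(x, t) \<in> closed_strip T. \<phi> x * \<Theta> t \<noteq> 0} \<subseteq> {0..R} \<times> {0..T}"
    proof
      fix p assume "p \<in> {(x, t) \<in> closed_strip T. \<phi> x * \<Theta> t \<noteq> 0}"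
      then show "p \<in> {0..R} \<times> {0..T}"
        using \<phi>R[of "fst p"] by (cases p; cases "R \<le> fst p") (auto simp: closed_strip_def)
    qed
  qed (intro closed_Times closed_atLeastAtMost)
  ultimately show "test_function T (\<lambda>x t. \<phi> x * \<Theta> t) (\<lambda>x t. - H x * \<Theta> t) (\<lambda>x t. h x * \<Theta> t) (\<lambda>x t. - (\<phi> x * \<theta> t))"
    unfolding test_function_def using \<Theta>T[of T] \<phi>00 pos by auto
  show "continuous_on UNIV \<phi>" "continuous_on UNIV \<Theta>" by (rule cont)+
  show "\<And>x. R \<le> x \<Longrightarrow> \<phi> x = 0" "\<And>t. T \<le> t \<Longrightarrow> \<Theta> t = 0" by (erule \<phi>R \<Theta>T)+
qed

text \<open>The data enter the weak form only through its right-hand side, which cancels in the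
  difference of two solutions; what remains is the separated weak form for \<open>z\<close> and
  \<open>Z\<close>.\<close>

lemma weak_solution_unique:
  assumes d: "d\<^sub>u > 0" "d\<^sub>v \<ge> 0"
    and w: "weak_solution d\<^sub>u d\<^sub>v U\<^sub>0 V\<^sub>0 w" and w': "weak_solution d\<^sub>u d\<^sub>v U\<^sub>0 V\<^sub>0 w'"
  shows "AE (x, t) in lebesgue_on quadrant. w x t = w' x t"
proof -
  let ?D = "diffusion d\<^sub>u d\<^sub>v"
  define L where "L = max d\<^sub>u d\<^sub>v"
  have L: "L > 0" using d by (auto simp: L_def)
  have "Linfty_quadrant w" "Linfty_quadrant w'" using w w' by (auto simp: weak_solution_def)
  obtain g C where gm: "case_prod g \<in> borel_measurable lborel\<^sub>2" and gb: "\<And>x t. \<bar>g x t\<bar> \<le> C"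
    and g0: "\<And>x t. x \<le> 0 \<or> t \<le> 0 \<Longrightarrow> g x t = 0"
    and gae: "AE p in lebesgue. 0 < fst p \<and> 0 < snd p \<longrightarrow> w (fst p) (snd p) = g (fst p) (snd p)"
    using Linfty_quadrant_representative[OF \<open>Linfty_quadrant w\<close>] by blast
  obtain g' C' where gm': "case_prod g' \<in> borel_measurable lborel\<^sub>2" and gb': "\<And>x t. \<bar>g' x t\<bar> \<le> C'"
    and g0': "\<And>x t. x \<le> 0 \<or> t \<le> 0 \<Longrightarrow> g' x t = 0"
    and gae': "AE p in lebesgue. 0 < fst p \<and> 0 < snd p \<longrightarrow> w' (fst p) (snd p) = g' (fst p) (snd p)"
    using Linfty_quadrant_representative[OF \<open>Linfty_quadrant w'\<close>] by blast
  note [measurable (raw)] = measurable_app2[OF gm] measurable_app2[OF gm']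
  define z where "z x t = g x t - g' x t" for x t
  define Z where "Z x t = ?D (g x t) - ?D (g' x t)" for x t
  have Cnn: "0 \<le> C + C'" using gb[of 0 0] gb'[of 0 0] by linarith
  have zb: "\<bar>z x t\<bar> \<le> C + C'" for x t using gb[of x t] gb'[of x t] by (simp add: z_def)
  have Zb: "\<bar>Z x t\<bar> \<le> L * (C + C')" for x t
    unfolding Z_def L_def
    by (rule order_trans[OF diffusion_lipschitz[OF d] mult_left_mono]) (use zb[of x t] d in \<open>auto simp: z_def\<close>)
  \<comment> \<open>The factor \<open>max 1 L\<close> provides one bound for \<open>z\<close> and
    for \<open>Z\<close>, and \<open>1 / L\<close> is the co-coercivity constant of the diffusion
    function.\<close>
  have "AE p in lborel\<^sub>2. z (fst p) (snd p) = 0"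
  proof (rule separated_weak_form_uniqueness[where Z=Z and M="max 1 L * (C + C')" and c="1 / L"])
    show "case_prod z \<in> borel_measurable lborel\<^sub>2" "case_prod Z \<in> borel_measurable lborel\<^sub>2"
      unfolding z_def Z_def by measurable
    show "\<bar>z x t\<bar> \<le> max 1 L * (C + C')" for x t
      using zb[of x t] mult_right_mono[OF max.cobounded1 Cnn, of 1 L] by simp
    show "\<bar>Z x t\<bar> \<le> max 1 L * (C + C')" for x t
      using Zb[of x t] mult_right_mono[OF max.cobounded2 Cnn, of L 1] by simp
    show "1 / L * (Z x t)\<^sup>2 \<le> z x t * Z x t" for x t
      unfolding z_def Z_def L_def by (rule diffusion_strongly_monotone[OF d])
    fix h \<theta> :: "real \<Rightarrow> real" and R T :: real
    assume h: "continuous_on UNIV h" and \<theta>: "continuous_on UNIV \<theta>"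
      and h0: "\<And>x. x \<notin> {0<..<R} \<Longrightarrow> h x = 0" and \<theta>0: "\<And>t. t \<notin> {0<..<T} \<Longrightarrow> \<theta> t = 0"
      and pos: "0 < R" "0 < T" and m: "(\<integral>y. y * h y \<partial>lborel) = 0"
    define \<Theta> where "\<Theta> = (\<lambda>t. \<integral>s. indicator {t<..} s * \<theta> s \<partial>lborel)"
    define H where "H = (\<lambda>x. \<integral>y. indicator {x<..} y * h y \<partial>lborel)"
    define \<phi> where "\<phi> = (\<lambda>x. \<integral>y. indicator {x<..} y * ((y - x) * h y) \<partial>lborel)"
    have ptf: "test_function T (\<lambda>x t. \<phi> x * \<Theta> t) (\<lambda>x t. - H x * \<Theta> t) (\<lambda>x t. h x * \<Theta> t) (\<lambda>x t. - (\<phi> x * \<theta> t))"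
      "continuous_on UNIV \<phi>" "continuous_on UNIV \<Theta>" "\<And>x. R \<le> x \<Longrightarrow> \<phi> x = 0" "\<And>t. T \<le> t \<Longrightarrow> \<Theta> t = 0"
      unfolding \<Theta>_def \<phi>_def H_def
      by ((rule product_test_function[where h=h and \<theta>=\<theta> and R=R and T=T]; (rule h \<theta> pos m | erule h0 \<theta>0 | assumption))+)
    have h0': "h x = 0" if "R \<le> x" for x using h0[of x] that by auto
    have \<theta>0': "\<theta> t = 0" if "T \<le> t" for t using \<theta>0[of t] that by auto
    have [measurable]: "h \<in> borel_measurable borel" "\<theta> \<in> borel_measurable borel"
       "\<phi> \<in> borel_measurable borel" "\<Theta> \<in> borel_measurable borel"
      using h \<theta> ptf by (auto intro: borel_measurable_continuous_onI)
    have Am: "case_prod (\<lambda>x t. - (\<phi> x * \<theta> t)) \<in> borel_measurable lborel\<^sub>2"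
      and Em: "case_prod (\<lambda>x t. h x * \<Theta> t) \<in> borel_measurable lborel\<^sub>2" by measurable
    have wm: "(\<lambda>(x, t). w x t) \<in> borel_measurable (lebesgue_on quadrant)"
      "(\<lambda>(x, t). w' x t) \<in> borel_measurable (lebesgue_on quadrant)"
      using \<open>Linfty_quadrant w\<close> \<open>Linfty_quadrant w'\<close> by (auto simp: Linfty_quadrant_def)
    let ?rhs = "- d\<^sub>u * U\<^sub>0 * (LINT t|lebesgue_on {0<..<T}. - H 0 * \<Theta> t)
          - (LINT x|lebesgue_on {0<..}. initial_datum V\<^sub>0 x * (\<phi> x * \<Theta> 0))"
    have "(LINT (x, t)|lebesgue_on (strip T). w x t * - (\<phi> x * \<theta> t) + ?D (w x t) * (h x * \<Theta> t)) = ?rhs"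
      by (rule weak_solutionD[OF w pos(2) ptf(1)])
    moreover have "(LINT (x, t)|lebesgue_on (strip T). w' x t * - (\<phi> x * \<theta> t) + ?D (w' x t) * (h x * \<Theta> t)) = ?rhs"
      by (rule weak_solutionD[OF w' pos(2) ptf(1)])
    ultimately have "(LINT (x, t)|lebesgue_on (strip T). w x t * - (\<phi> x * \<theta> t) + ?D (w x t) * (h x * \<Theta> t))
        = (LINT (x, t)|lebesgue_on (strip T). w' x t * - (\<phi> x * \<theta> t) + ?D (w' x t) * (h x * \<Theta> t))"
      by (rule trans[OF _ sym])
    then have eq: "(\<integral>p. g (fst p) (snd p) * - (\<phi> (fst p) * \<theta> (snd p)) + ?D (g (fst p) (snd p)) * (h (fst p) * \<Theta> (snd p)) \<partial>lborel\<^sub>2)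
      = (\<integral>p. g' (fst p) (snd p) * - (\<phi> (fst p) * \<theta> (snd p)) + ?D (g' (fst p) (snd p)) * (h (fst p) * \<Theta> (snd p)) \<partial>lborel\<^sub>2)"
      using integral_strip_eq[OF wm(1) gm g0 gae Am _ Em, of T d\<^sub>u d\<^sub>v] integral_strip_eq[OF wm(2) gm' g0' gae' Am _ Em, of T d\<^sub>u d\<^sub>v]
        ptf(5) \<theta>0' by simp
    have int: "integrable lborel\<^sub>2 (\<lambda>(x, t). v x t * - (\<phi> x * \<theta> t) + ?D (v x t) * (h x * \<Theta> t))"
      if vm: "case_prod v \<in> borel_measurable lborel\<^sub>2" and vb: "\<And>x t. \<bar>v x t\<bar> \<le> K"
        and v0: "\<And>x t. x \<le> 0 \<or> t \<le> 0 \<Longrightarrow> v x t = 0" for v K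
    proof -
      note [measurable (raw)] = measurable_app2[OF vm]
      have a: "integrable lborel\<^sub>2 (\<lambda>(x, t). v x t * (\<phi> x * \<theta> t))"
        by (rule integrable_times_tensor[OF vm vb v0 ptf(2,4) \<theta> \<theta>0'])
      have b: "integrable lborel\<^sub>2 (\<lambda>(x, t). ?D (v x t) * (h x * \<Theta> t))"
      proof (rule integrable_times_tensor[where k="\<lambda>x t. ?D (v x t)" and C="L * K", OF _ _ _ h h0' ptf(3,5)])
        show "\<bar>?D (v x t)\<bar> \<le> L * K" for x t
        proof -
          have "?D 0 = 0" by (simp add: diffusion_def)
          then have "\<bar>?D (v x t)\<bar> \<le> L * \<bar>v x t\<bar>"
            using diffusion_lipschitz[OF d, of "v x t" 0] by (simp add: L_def)
          also have "\<dots> \<le> L * K" using L by (intro mult_left_mono vb) auto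
          finally show ?thesis .
        qed
      qed (use v0 in \<open>auto simp: diffusion_def\<close>)
      show ?thesis using Bochner_Integration.integrable_diff[OF b a] by (simp add: case_prod_beta' algebra_simps)
    qed
    have "(\<integral>p. Z (fst p) (snd p) * (h (fst p) * \<Theta> (snd p)) - z (fst p) (snd p) * (\<phi> (fst p) * \<theta> (snd p)) \<partial>lborel\<^sub>2)
      = (\<integral>p. (g (fst p) (snd p) * - (\<phi> (fst p) * \<theta> (snd p)) + ?D (g (fst p) (snd p)) * (h (fst p) * \<Theta> (snd p)))
           - (g' (fst p) (snd p) * - (\<phi> (fst p) * \<theta> (snd p)) + ?D (g' (fst p) (snd p)) * (h (fst p) * \<Theta> (snd p))) \<partial>lborel\<^sub>2)"
      by (intro Bochner_Integration.integral_cong) (auto simp: z_def Z_def algebra_simps)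
    also have "\<dots> = 0"
      using int[OF gm gb g0] int[OF gm' gb' g0'] eq
      by (subst Bochner_Integration.integral_diff) (auto simp: case_prod_beta')
    finally show "(\<integral>p. Z (fst p) (snd p) * (h (fst p) * (\<integral>s. indicator {snd p<..} s * \<theta> s \<partial>lborel))
           - z (fst p) (snd p) * ((\<integral>y. indicator {fst p<..} y * ((y - fst p) * h y) \<partial>lborel) * \<theta> (snd p))
          \<partial>lborel\<^sub>2) = 0"
      unfolding \<Theta>_def \<phi>_def .
  qed (use g0 g0' L in \<open>auto simp: z_def Z_def\<close>)
  then have ae: "AE p in lebesgue. z (fst p) (snd p) = 0"
    unfolding lborel_prod by (rule AE_completion)
  have neg: "AE p::real \<times> real in lebesgue. fst p \<noteq> 0 \<and> snd p \<noteq> 0"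
    by (rule AE_completion[OF AE_off_axes])
  note qs = quadrant_in_sets_lebesgue
  have "AE p in lebesgue. p \<in> quadrant \<longrightarrow> w (fst p) (snd p) = w' (fst p) (snd p)"
    using ae neg gae gae'
  proof eventually_elim
    case (elim p)
    then show ?case by (cases p) (auto simp: quadrant_def z_def)
  qed
  then show ?thesis
    using qs by (subst AE_restrict_space_iff) (auto simp: case_prod_beta')
qed

section \<open>Self-similar weak solutions\<close>

lemma bounded_integral_eq_lborel:
  fixes f :: "real \<Rightarrow> real"
  assumes f[measurable]: "f \<in> borel_measurable lborel" and fb: "\<And>x. a < x \<Longrightarrow> x < b \<Longrightarrow> \<bar>f x\<bar> \<le> C"
    and I: "(f has_integral I) {a..b}"
  shows "(\<integral>x. indicator {a<..<b} x * f x \<partial>lborel) = I"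
proof -
  have "integrable lborel (\<lambda>x. indicator {a<..<b} x * f x)"
  proof (rule integrable_of_bounded_vanishing[where K="\<bar>C\<bar>" and a=a and b=b])
    show "\<bar>indicator {a<..<b} x * f x\<bar> \<le> \<bar>C\<bar>" for x
      using fb[of x] by (cases "x \<in> {a<..<b}") auto
  qed auto
  then have "set_integrable lborel {a<..<b} f" by (simp add: set_integrable_def)
  from set_borel_integral_eq_integral(2)[OF this] show ?thesis
    using integral_unique[OF I] by (simp add: set_lebesgue_integral_def flip: integral_open_interval_real)
qed

text \<open>Serves the chain rule along the rays x = eta sqrt t. An x-derivative at the single
  point, combined with a jointly continuous t-derivative nearby, already gives total
  differentiability.\<close>

lemma has_derivative_of_partials:
  fixes \<psi> \<psi>x \<psi>t :: "real \<Rightarrow> real \<Rightarrow> real"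
  assumes X: "open X" "open Y" "convex Y" "x \<in> X" "t \<in> Y"
    and dx: "((\<lambda>y. \<psi> y t) has_real_derivative \<psi>x x t) (at x)"
    and dt: "\<And>x t. x \<in> X \<Longrightarrow> t \<in> Y \<Longrightarrow> ((\<lambda>s. \<psi> x s) has_real_derivative \<psi>t x t) (at t)"
    and ct: "continuous_on UNIV (\<lambda>p. \<psi>t (fst p) (snd p))"
  shows "((\<lambda>p. \<psi> (fst p) (snd p)) has_derivative (\<lambda>h. \<psi>x x t * fst h + \<psi>t x t * snd h)) (at (x, t))"
proof -
  have "((\<lambda>(x, t). \<psi> x t) has_derivative (\<lambda>(tx, ty). \<psi>x x t * tx + blinfun_apply (blinfun_scaleR_left (\<psi>t x t)) ty)) (at (x, t) within X \<times> Y)"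
  proof (rule has_derivative_partialsI)
    show "((\<lambda>x. \<psi> x t) has_derivative (*) (\<psi>x x t)) (at x within X)"
      using dx unfolding has_field_derivative_def by (rule has_derivative_at_withinI)
    show "((\<lambda>y. \<psi> x y) has_derivative blinfun_apply (blinfun_scaleR_left (\<psi>t x y))) (at y within Y)"
      if "x \<in> X" "y \<in> Y" for x y
      using has_derivative_at_withinI[OF dt[OF that, unfolded has_field_derivative_def]]
      by (rule has_derivative_eq_rhs) (auto simp: mult.commute)
    have "isCont (\<lambda>p. \<psi>t (fst p) (snd p)) (x, t)"
      using ct by (simp add: continuous_on_eq_continuous_at)
    then have "continuous (at (x, t) within X \<times> Y) (\<lambda>p. \<psi>t (fst p) (snd p))"
      by (rule continuous_at_imp_continuous_at_within)
    then have "continuous (at (x, t) within X \<times> Y) (\<lambda>p. blinfun_scaleR_left (\<psi>t (fst p) (snd p)) :: real \<Rightarrow>\<^sub>L real)"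
      by (rule bounded_linear.continuous[OF bounded_linear_blinfun_scaleR_left])
    then show "continuous (at (x, t) within X \<times> Y) (\<lambda>(x, y). blinfun_scaleR_left (\<psi>t x y) :: real \<Rightarrow>\<^sub>L real)"
      by (simp add: case_prod_beta')
  qed (use X in auto)
  moreover have "at (x, t) within X \<times> Y = at (x, t)"
    using X by (intro at_within_open open_Times) auto
  ultimately show ?thesis by (simp add: case_prod_beta' mult.commute)
qed

lemma borel_measurable_pair_of_continuous:
  assumes "continuous_on UNIV (\<lambda>p::real\<times>real. \<psi> (fst p) (snd p) :: real)"
  shows "case_prod \<psi> \<in> borel_measurable lborel\<^sub>2"
  using borel_measurable_continuous_onI[OF assms] by (simp add: lborel_prod case_prod_beta')

lemma continuous_on_pair_app:
  assumes "continuous_on UNIV (\<lambda>p::real\<times>real. \<psi> (fst p) (snd p) :: real)"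
    "continuous_on S f" "continuous_on S g"
  shows "continuous_on S (\<lambda>x. \<psi> (f x) (g x))"
  using continuous_on_compose2[OF assms(1), of S "\<lambda>x. (f x, g x)"] assms(2,3)
  by (auto intro: continuous_on_Pair)

text \<open>On a ray x = eta sqrt t the factor \<open>f\<close> is constant, and with dx = sqrt t d
  eta the rest of the integrand is the t-derivative of \<open>\<Phi> \<eta>\<close>. The time
  integral reduces to the value at \<open>\<epsilon>\<close>, the value at \<open>T\<close> being
  zero. A positive \<open>\<epsilon>\<close> keeps the factor 1/(2t) bounded.\<close>

lemma self_similar_transport:
  fixes f :: "real \<Rightarrow> real" and \<psi> \<psi>x \<psi>t :: "real \<Rightarrow> real \<Rightarrow> real"
  assumes f[measurable]: "f \<in> borel_measurable borel" and fb: "\<And>\<eta>. \<bar>f \<eta>\<bar> \<le> M"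
    and c: "continuous_on UNIV (\<lambda>p. \<psi> (fst p) (snd p))" "continuous_on UNIV (\<lambda>p. \<psi>x (fst p) (snd p))"
      "continuous_on UNIV (\<lambda>p. \<psi>t (fst p) (snd p))"
    and b: "\<And>x t. \<bar>\<psi> x t\<bar> \<le> K" "\<And>x t. \<bar>\<psi>x x t\<bar> \<le> K" "\<And>x t. \<bar>\<psi>t x t\<bar> \<le> K"
    and z: "\<And>x t. R \<le> x \<Longrightarrow> \<psi> x t = 0" "\<And>x t. R \<le> x \<Longrightarrow> \<psi>x x t = 0" "\<And>x t. R \<le> x \<Longrightarrow> \<psi>t x t = 0"
    and dx: "\<And>x t. 0 < x \<Longrightarrow> 0 < t \<Longrightarrow> t < T \<Longrightarrow> ((\<lambda>y. \<psi> y t) has_real_derivative \<psi>x x t) (at x)"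
    and dt: "\<And>x t. 0 < x \<Longrightarrow> 0 < t \<Longrightarrow> t < T \<Longrightarrow> ((\<lambda>s. \<psi> x s) has_real_derivative \<psi>t x t) (at t)"
    and T0: "\<And>x. \<psi> x T = 0" and \<epsilon>: "0 < \<epsilon>" "\<epsilon> < T" and R: "0 < R"
  shows "(\<integral>t. indicator {\<epsilon><..<T} t * (\<integral>x. indicator {0<..<R} x * (f (x / sqrt t) * (\<psi>t x t + (\<psi> x t + x * \<psi>x x t) / (2 * t))) \<partial>lborel) \<partial>lborel)
    = - (\<integral>x. indicator {0<..<R} x * (f (x / sqrt \<epsilon>) * \<psi> x \<epsilon>) \<partial>lborel)"
proof -
  note [measurable (raw)] = measurable_app2[OF borel_measurable_pair_of_continuous[OF c(1)]]
    measurable_app2[OF borel_measurable_pair_of_continuous[OF c(2)]]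
    measurable_app2[OF borel_measurable_pair_of_continuous[OF c(3)]]
  have M: "0 \<le> M" using fb[of 0] by linarith
  have K: "0 \<le> K" using b(1)[of 0 0] by linarith
  \<comment> \<open>From time \<open>\<epsilon>\<close> on, all rays with
    \<open>N \<le> \<eta>\<close> lie beyond the support of the test function.\<close>
  define N where "N = R / sqrt \<epsilon>"
  have N: "0 < N" using R \<epsilon> by (simp add: N_def)
  define k where "k x t = \<psi>t x t + (\<psi> x t + x * \<psi>x x t) / (2 * t)" for x t
  define h where "h \<eta> t = sqrt t * k (\<eta> * sqrt t) t" for \<eta> t
  define \<Phi> where "\<Phi> \<eta> t = sqrt t * \<psi> (\<eta> * sqrt t) t" for \<eta> t
  have kz: "k x t = 0" if "R \<le> x" for x t using z[OF that] by (simp add: k_def)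
  have out: "R \<le> \<eta> * sqrt t" if "N \<le> \<eta>" "\<epsilon> \<le> t" for \<eta> t
  proof -
    have "R = N * sqrt \<epsilon>" using \<epsilon> by (simp add: N_def)
    also have "\<dots> \<le> \<eta> * sqrt t" using that N \<epsilon> by (intro mult_mono) auto
    finally show ?thesis .
  qed
  \<comment> \<open>The cut-offs \<open>x < R\<close> and \<open>\<eta> < N\<close> may differ, but
    only where \<open>v\<close> vanishes.\<close>
  have subst: "(\<integral>x. indicator {0<..<R} x * (f (x / sqrt t) * v x) \<partial>lborel) = (\<integral>\<eta>. indicator {0<..<N} \<eta> * (f \<eta> * (sqrt t * v (\<eta> * sqrt t))) \<partial>lborel)"
    if t: "\<epsilon> \<le> t" and vz: "\<And>x. R \<le> x \<Longrightarrow> v x = 0" for t and v :: "real \<Rightarrow> real"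
  proof -
    have st: "0 < sqrt t" using t \<epsilon> by simp
    have "(\<integral>x. indicator {0<..<R} x * (f (x / sqrt t) * v x) \<partial>lborel)
       = sqrt t * (\<integral>\<eta>. indicator {0<..<R} (sqrt t * \<eta>) * (f (sqrt t * \<eta> / sqrt t) * v (sqrt t * \<eta>)) \<partial>lborel)"
      by (subst lborel_integral_real_affine[where c="sqrt t" and t=0]) (use st in auto)
    also have "\<dots> = (\<integral>\<eta>. sqrt t * (indicator {0<..<R} (sqrt t * \<eta>) * (f (sqrt t * \<eta> / sqrt t) * v (sqrt t * \<eta>))) \<partial>lborel)" by simp
    also have "\<dots> = (\<integral>\<eta>. indicator {0<..<N} \<eta> * (f \<eta> * (sqrt t * v (\<eta> * sqrt t))) \<partial>lborel)"
    proof (rule Bochner_Integration.integral_cong)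
      fix \<eta>
      have "v (\<eta> * sqrt t) = 0" if "N \<le> \<eta> \<or> R \<le> \<eta> * sqrt t" using that out[OF _ t] vz by auto
      then show "sqrt t * (indicator {0<..<R} (sqrt t * \<eta>) * (f (sqrt t * \<eta> / sqrt t) * v (sqrt t * \<eta>))) = indicator {0<..<N} \<eta> * (f \<eta> * (sqrt t * v (\<eta> * sqrt t)))"
        using st by (cases "0 < \<eta>") (auto simp: indicator_def mult.commute zero_less_mult_iff not_less)
    qed simp
    finally show ?thesis .
  qed
  define F where "F t \<eta> = indicator {\<epsilon><..<T} t * (indicator {0<..<N} \<eta> * (f \<eta> * h \<eta> t))" for t \<eta>
  define C where "C = sqrt T * (K + (K + (N * sqrt T) * K) / (2 * \<epsilon>))"
  have C: "0 \<le> C" using K N \<epsilon> by (simp add: C_def)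
  have hb: "\<bar>h \<eta> t\<bar> \<le> C" if "0 < \<eta>" "\<eta> < N" "\<epsilon> < t" "t < T" for \<eta> t
  proof -
    have "\<bar>(\<psi> (\<eta> * sqrt t) t + \<eta> * sqrt t * \<psi>x (\<eta> * sqrt t) t) / (2 * t)\<bar> = \<bar>\<psi> (\<eta> * sqrt t) t + \<eta> * sqrt t * \<psi>x (\<eta> * sqrt t) t\<bar> / (2 * t)"
      using that \<epsilon> by simp
    also have "\<dots> \<le> (K + (N * sqrt T) * K) / (2 * \<epsilon>)"
    proof (rule frac_le)
      have "\<bar>\<eta> * sqrt t * \<psi>x (\<eta> * sqrt t) t\<bar> \<le> (N * sqrt T) * K"
        unfolding abs_mult using that \<epsilon> N K by (intro mult_mono b) auto
      then show "\<bar>\<psi> (\<eta> * sqrt t) t + \<eta> * sqrt t * \<psi>x (\<eta> * sqrt t) t\<bar> \<le> K + (N * sqrt T) * K"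
        using b(1)[of "\<eta> * sqrt t" t] by linarith
    qed (use that \<epsilon> K N in auto)
    finally have "\<bar>k (\<eta> * sqrt t) t\<bar> \<le> K + (K + (N * sqrt T) * K) / (2 * \<epsilon>)"
      using b(3)[of "\<eta> * sqrt t" t] unfolding k_def by linarith
    then show ?thesis unfolding h_def C_def abs_mult using that \<epsilon> by (intro mult_mono) auto
  qed
  have [measurable]: "(\<lambda>p. h (fst p) (snd p)) \<in> borel_measurable (borel \<Otimes>\<^sub>M borel)"
    unfolding h_def k_def by measurable
  have hm: "case_prod h \<in> borel_measurable lborel\<^sub>2"
    unfolding h_def k_def by measurable
  note [measurable (raw)] = measurable_app2[OF hm]
  have "integrable lborel\<^sub>2 (case_prod F)"
  proof (rule integrable_pair_bounded_support[where a=\<epsilon> and b=T and c=0 and d=N])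
    show "case_prod F \<in> borel_measurable lborel\<^sub>2" unfolding F_def by measurable
    show "\<bar>F t \<eta>\<bar> \<le> M * C" for t \<eta>
    proof (cases "\<epsilon> < t \<and> t < T \<and> 0 < \<eta> \<and> \<eta> < N")
      case True
      then have "\<bar>f \<eta>\<bar> * \<bar>h \<eta> t\<bar> \<le> M * C" using M by (intro mult_mono fb hb) auto
      then show ?thesis using True by (simp add: F_def abs_mult)
    qed (use M C in \<open>auto simp: F_def indicator_def\<close>)
  qed (auto simp: F_def indicator_def)
  then have fub: "(\<integral>\<eta>. \<integral>t. F t \<eta> \<partial>lborel \<partial>lborel) = (\<integral>t. \<integral>\<eta>. F t \<eta> \<partial>lborel \<partial>lborel)"
    by (rule lborel_pair.Fubini_integral)
  have "(\<integral>\<eta>. F t \<eta> \<partial>lborel) = indicator {\<epsilon><..<T} t * (\<integral>x. indicator {0<..<R} x * (f (x / sqrt t) * k x t) \<partial>lborel)" for t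
    using subst[of t "\<lambda>x. k x t"] kz by (cases "t \<in> {\<epsilon><..<T}") (auto simp: F_def h_def)
  moreover have "(\<integral>t. F t \<eta> \<partial>lborel) = - (indicator {0<..<N} \<eta> * (f \<eta> * (sqrt \<epsilon> * \<psi> (\<eta> * sqrt \<epsilon>) \<epsilon>)))" for \<eta>
  proof (cases "\<eta> \<in> {0<..<N}")
    case True
    have "((\<lambda>t. h \<eta> t) has_integral (\<Phi> \<eta> T - \<Phi> \<eta> \<epsilon>)) {\<epsilon>..T}"
    proof (rule fundamental_theorem_of_calculus_interior)
      show "continuous_on {\<epsilon>..T} (\<Phi> \<eta>)"
        unfolding \<Phi>_def by (intro continuous_intros continuous_on_pair_app[OF c(1)])
      fix t assume t: "t \<in> {\<epsilon><..<T}"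
      then have t0: "0 < t" "t < T" using \<epsilon> by auto
      have x0: "0 < \<eta> * sqrt t" using True t0 by simp
      have ds: "((\<lambda>s. \<eta> * sqrt s) has_real_derivative \<eta> / (2 * sqrt t)) (at t)"
        using t0 by (auto intro!: derivative_eq_intros simp: field_simps)
      \<comment> \<open>Both arguments move along the ray, so the partial derivatives are first
        combined into a total derivative.\<close>
      have A1: "((\<lambda>p. \<psi> (fst p) (snd p)) has_derivative (\<lambda>h. \<psi>x (\<eta> * sqrt t) t * fst h + \<psi>t (\<eta> * sqrt t) t * snd h)) (at (\<eta> * sqrt t, t))"
        by (rule has_derivative_of_partials[where X="{0<..}" and Y="{0<..<T}"]) (use x0 t0 dx dt c in auto)
      have A2: "((\<lambda>s. (\<eta> * sqrt s, s)) has_derivative (\<lambda>h. (\<eta> / (2 * sqrt t) * h, h))) (at t)"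
        by (intro has_derivative_Pair has_derivative_ident ds[unfolded has_field_derivative_def])
      have "((\<lambda>s. \<psi> (\<eta> * sqrt s) s) has_derivative (\<lambda>h. \<psi>x (\<eta> * sqrt t) t * (\<eta> / (2 * sqrt t) * h) + \<psi>t (\<eta> * sqrt t) t * h)) (at t)"
        using has_derivative_compose[OF A2 A1] unfolding fst_conv snd_conv .
      then have d1: "((\<lambda>s. \<psi> (\<eta> * sqrt s) s) has_real_derivative (\<psi>x (\<eta> * sqrt t) t * (\<eta> / (2 * sqrt t)) + \<psi>t (\<eta> * sqrt t) t)) (at t)"
        unfolding has_field_derivative_def by (rule has_derivative_eq_rhs) (auto simp: distrib_right mult.assoc)
      have "(\<Phi> \<eta> has_real_derivative (1 / (2 * sqrt t)) * \<psi> (\<eta> * sqrt t) t + (\<psi>x (\<eta> * sqrt t) t * (\<eta> / (2 * sqrt t)) + \<psi>t (\<eta> * sqrt t) t) * sqrt t) (at t)"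
        unfolding \<Phi>_def using t0
        by (intro DERIV_mult d1) (auto intro!: derivative_eq_intros simp: field_simps)
      also have "(1 / (2 * sqrt t)) * \<psi> (\<eta> * sqrt t) t + (\<psi>x (\<eta> * sqrt t) t * (\<eta> / (2 * sqrt t)) + \<psi>t (\<eta> * sqrt t) t) * sqrt t = h \<eta> t"
      proof -
        have alg: "(1 / (2 * r)) * a + (b * (\<eta> / (2 * r)) + c) * r = r * (c + (a + \<eta> * r * b) / (2 * s))"
          if "0 < r" "s = r * r" for a b c r s :: real
          using that by (simp add: field_simps)
        show ?thesis unfolding h_def k_def by (rule alg) (use t0 in auto)
      qed
      finally show "(\<Phi> \<eta> has_vector_derivative h \<eta> t) (at t)"
        by (simp add: has_real_derivative_iff_has_vector_derivative)
    qed (use \<epsilon> in simp)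
    then have "(\<integral>t. indicator {\<epsilon><..<T} t * h \<eta> t \<partial>lborel) = \<Phi> \<eta> T - \<Phi> \<eta> \<epsilon>"
      by (intro bounded_integral_eq_lborel[where C=C]) (use hb True in auto)
    moreover have "(\<integral>t. F t \<eta> \<partial>lborel) = f \<eta> * (\<integral>t. indicator {\<epsilon><..<T} t * h \<eta> t \<partial>lborel)"
      unfolding integral_mult_right_zero[symmetric]
      by (intro Bochner_Integration.integral_cong) (use True in \<open>auto simp: F_def\<close>)
    ultimately show ?thesis using True by (simp add: \<Phi>_def T0)
  qed (auto simp: F_def)
  ultimately have "(\<integral>t. indicator {\<epsilon><..<T} t * (\<integral>x. indicator {0<..<R} x * (f (x / sqrt t) * k x t) \<partial>lborel) \<partial>lborel)
      = - (\<integral>\<eta>. indicator {0<..<N} \<eta> * (f \<eta> * (sqrt \<epsilon> * \<psi> (\<eta> * sqrt \<epsilon>) \<epsilon>)) \<partial>lborel)"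
    using fub by simp
  also have "\<dots> = - (\<integral>x. indicator {0<..<R} x * (f (x / sqrt \<epsilon>) * \<psi> x \<epsilon>) \<partial>lborel)"
    using subst[of \<epsilon> "\<lambda>x. \<psi> x \<epsilon>"] z by simp
  finally show ?thesis unfolding k_def .
qed

text \<open>With r = sqrt t the integrand is the derivative of \<open>H\<close>: the product rule
  for g \<psi>x brings in \<open>p\<close>, which G \<psi> / r trades for \<open>f\<close>, and the
  derivative f/2 of \<open>G\<close> supplies the term with \<psi>. Because \<open>g\<close> and
  \<open>G\<close> are continuous across \<open>a\<close>, the interface contributes nothing even
  where \<open>f\<close> or \<open>p\<close> jumps. At \<open>R\<close> both terms vanish, and at 0
  only the term with \<open>g 0\<close> is left.\<close>

lemma self_similar_flux:
  fixes f g p G \<psi> \<psi>x \<psi>xx :: "real \<Rightarrow> real"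
  assumes fm[measurable]: "f \<in> borel_measurable borel" and fb: "\<And>\<eta>. \<bar>f \<eta>\<bar> \<le> M"
    and gm[measurable]: "g \<in> borel_measurable borel" and gb: "\<And>\<eta>. \<bar>g \<eta>\<bar> \<le> M'"
    and gc: "continuous_on {0..} g" and Gc: "continuous_on {0..} G"
    and dg: "\<And>\<eta>. 0 < \<eta> \<Longrightarrow> \<eta> \<noteq> a \<Longrightarrow> (g has_real_derivative p \<eta>) (at \<eta>)"
    and dG: "\<And>\<eta>. 0 < \<eta> \<Longrightarrow> \<eta> \<noteq> a \<Longrightarrow> (G has_real_derivative f \<eta> / 2) (at \<eta>)"
    and G: "\<And>\<eta>. 0 < \<eta> \<Longrightarrow> \<eta> \<noteq> a \<Longrightarrow> G \<eta> = p \<eta> + \<eta> * f \<eta> / 2"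
    and c: "continuous_on UNIV \<psi>" "continuous_on UNIV \<psi>x" "continuous_on UNIV \<psi>xx"
    and b: "\<And>x. \<bar>\<psi> x\<bar> \<le> K" "\<And>x. \<bar>\<psi>x x\<bar> \<le> K" "\<And>x. \<bar>\<psi>xx x\<bar> \<le> K"
    and d1: "\<And>x. 0 < x \<Longrightarrow> (\<psi> has_real_derivative \<psi>x x) (at x)"
    and d2: "\<And>x. 0 < x \<Longrightarrow> (\<psi>x has_real_derivative \<psi>xx x) (at x)"
    and z: "\<psi> R = 0" "\<psi>x R = 0" "\<psi> 0 = 0" and R: "0 < R" and t: "0 < t"
  shows "(\<integral>x. indicator {0<..<R} x * (g (x / sqrt t) * \<psi>xx x - f (x / sqrt t) * ((\<psi> x + x * \<psi>x x) / (2 * t))) \<partial>lborel)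
    = - g 0 * \<psi>x 0"
proof -
  define r where "r = sqrt t"
  have r: "0 < r" and t_eq: "t = r * r" using t by (auto simp: r_def)
  have [measurable]: "\<psi> \<in> borel_measurable borel" "\<psi>x \<in> borel_measurable borel" "\<psi>xx \<in> borel_measurable borel"
    using c by (auto intro: borel_measurable_continuous_onI)
  define H where "H x = g (x / r) * \<psi>x x - G (x / r) / r * \<psi> x" for x
  let ?h = "\<lambda>x. g (x / r) * \<psi>xx x - f (x / r) * ((\<psi> x + x * \<psi>x x) / (2 * t))"
  have "(?h has_integral (H R - H 0)) {0..R}"
  \<comment> \<open>At the exceptional point \<open>a * r\<close>, the position of the interface,
    continuity of \<open>H\<close> replaces differentiability.\<close>
  proof (rule fundamental_theorem_of_calculus_interior_strong[where S="{a * r}"])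
    show "continuous_on {0..R} H" unfolding H_def
      by (intro continuous_intros continuous_on_compose2[OF gc] continuous_on_compose2[OF Gc]
          continuous_on_subset[OF c(1)] continuous_on_subset[OF c(2)]) (use r in auto)
    fix x assume x: "x \<in> {0<..<R} - {a * r}"
    then have \<eta>: "0 < x / r" "x / r \<noteq> a" using r by (auto simp: field_simps)
    have dr: "((\<lambda>x. x / r) has_real_derivative 1 / r) (at x)"
      using r by (auto intro!: derivative_eq_intros)
    have e1: "((\<lambda>x. g (x / r)) has_real_derivative p (x / r) * (1 / r)) (at x)"
      by (rule DERIV_chain2[OF dg[OF \<eta>] dr])
    have e2: "((\<lambda>x. G (x / r)) has_real_derivative f (x / r) / 2 * (1 / r)) (at x)"
      by (rule DERIV_chain2[OF dG[OF \<eta>] dr])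
    have "(H has_real_derivative (p (x / r) * (1 / r) * \<psi>x x + \<psi>xx x * g (x / r))
        - (f (x / r) / 2 * (1 / r) / r * \<psi> x + \<psi>x x * (G (x / r) / r))) (at x)"
      unfolding H_def using x by (intro DERIV_diff DERIV_mult e1 d1 d2 DERIV_cdivide e2) auto
    also have "(p (x / r) * (1 / r) * \<psi>x x + \<psi>xx x * g (x / r)) - (f (x / r) / 2 * (1 / r) / r * \<psi> x + \<psi>x x * (G (x / r) / r)) = ?h x"
      unfolding G[OF \<eta>] t_eq using r by (simp add: field_simps)
    finally show "(H has_vector_derivative ?h x) (at x)"
      by (simp add: has_real_derivative_iff_has_vector_derivative)
  qed (use R in auto)
  moreover have "\<bar>?h x\<bar> \<le> M' * K + M * ((K + R * K) / (2 * t))" if "0 < x" "x < R" for x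
  proof -
    have M: "0 \<le> M" "0 \<le> M'" using fb[of 0] gb[of 0] by linarith+
    have K: "0 \<le> K" using b(1)[of 0] by linarith
    have "\<bar>x * \<psi>x x\<bar> \<le> R * K" unfolding abs_mult using that K by (intro mult_mono b) auto
    then have "\<bar>\<psi> x + x * \<psi>x x\<bar> \<le> K + R * K" using b(1)[of x] by linarith
    then have "\<bar>(\<psi> x + x * \<psi>x x) / (2 * t)\<bar> \<le> (K + R * K) / (2 * t)" using t by (simp add: divide_right_mono)
    then have "\<bar>f (x / r) * ((\<psi> x + x * \<psi>x x) / (2 * t))\<bar> \<le> M * ((K + R * K) / (2 * t))"
      unfolding abs_mult[of "f (x / r)"] using M by (intro mult_mono fb) auto
    moreover have "\<bar>g (x / r) * \<psi>xx x\<bar> \<le> M' * K"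
      unfolding abs_mult using M by (intro mult_mono gb b) auto
    ultimately show ?thesis by linarith
  qed
  ultimately have "(\<integral>x. indicator {0<..<R} x * ?h x \<partial>lborel) = H R - H 0"
    by (intro bounded_integral_eq_lborel) auto
  then show ?thesis unfolding r_def[symmetric] using z by (simp add: H_def)
qed

section \<open>Test functions on the closed strip and their extension to the plane\<close>

lemma integral_lebesgue_on_eq_lborel:
  fixes k k' :: "real \<Rightarrow> real"
  assumes S: "S \<in> sets borel" and k': "k' \<in> borel_measurable borel" and eq: "\<And>x. x \<in> S \<Longrightarrow> k x = k' x"
  shows "(LINT x|lebesgue_on S. k x) = (\<integral>x. indicator S x * k' x \<partial>lborel)"
proof -
  have "(LINT x|lebesgue_on S. k x) = (LINT x|lebesgue_on S. k' x)"
    by (intro Bochner_Integration.integral_cong) (auto simp: space_restrict_space eq)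
  also have "\<dots> = (\<integral>x. indicator S x *\<^sub>R k' x \<partial>lebesgue)"
    using S by (intro integral_restrict_space) auto
  also have "\<dots> = (\<integral>x. indicator S x *\<^sub>R k' x \<partial>lborel)"
    using S k' by (intro integral_completion) auto
  finally show ?thesis by simp
qed

lemma C21D:
  assumes "C21_on_closed_strip T \<psi> \<psi>x \<psi>xx \<psi>t" "0 \<le> x" "t \<in> {0..T}"
  shows "((\<lambda>y. \<psi> y t) has_real_derivative \<psi>x x t) (at x within {0..}) \<and>
        ((\<lambda>y. \<psi>x y t) has_real_derivative \<psi>xx x t) (at x within {0..}) \<and>
        ((\<lambda>s. \<psi> x s) has_real_derivative \<psi>t x t) (at t within {0..T})"
proof -
  have M: "(x, t) \<in> closed_strip T" using assms(2,3) by (simp add: closed_strip_def)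
  have F: "\<forall>(x, t)\<in>closed_strip T.
        ((\<lambda>y. \<psi> y t) has_real_derivative \<psi>x x t) (at x within {0..}) \<and>
        ((\<lambda>y. \<psi>x y t) has_real_derivative \<psi>xx x t) (at x within {0..}) \<and>
        ((\<lambda>s. \<psi> x s) has_real_derivative \<psi>t x t) (at t within {0..T})"
    using assms(1) unfolding C21_on_closed_strip_def by (elim conjE)
  from bspec[OF F M] show ?thesis unfolding prod.case .
qed

lemma test_function_support:
  assumes tf: "test_function T \<psi> \<psi>x \<psi>xx \<psi>t" and T: "0 < T"
  obtains R where "0 < R"
    "\<And>x t. R \<le> x \<Longrightarrow> t \<in> {0..T} \<Longrightarrow> \<psi> x t = 0 \<and> \<psi>x x t = 0 \<and> \<psi>xx x t = 0 \<and> \<psi>t x t = 0"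
proof -
  have C21: "C21_on_closed_strip T \<psi> \<psi>x \<psi>xx \<psi>t"
    and ex: "\<exists>J>0. closure {(x, t) \<in> closed_strip T. \<psi> x t \<noteq> 0} \<subseteq> {0..J} \<times> {0..T}"
    using tf unfolding test_function_def by - (elim conjE, assumption)+
  from ex obtain J where J: "J > 0" "closure {(x, t) \<in> closed_strip T. \<psi> x t \<noteq> 0} \<subseteq> {0..J} \<times> {0..T}"
    by (elim exE conjE)
  have C: "((\<lambda>y. \<psi> y t) has_real_derivative \<psi>x x t) (at x within {0..})"
    "((\<lambda>y. \<psi>x y t) has_real_derivative \<psi>xx x t) (at x within {0..})"
    "((\<lambda>s. \<psi> x s) has_real_derivative \<psi>t x t) (at t within {0..T})" if "0 \<le> x" "t \<in> {0..T}" for x t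
    using C21D[OF C21 that] by - (elim conjE, assumption)+
  have z: "\<psi> x t = 0" if "J < x" "t \<in> {0..T}" for x t
  proof (rule ccontr)
    assume "\<psi> x t \<noteq> 0"
    then have "(x, t) \<in> {(x, t) \<in> closed_strip T. \<psi> x t \<noteq> 0}" using that J(1) by (simp add: closed_strip_def)
    then have "(x, t) \<in> {0..J} \<times> {0..T}" by (rule subsetD[OF J(2) subsetD[OF closure_subset]])
    then show False using that by auto
  qed
  have deriv0: "d = 0" if "(h has_real_derivative d) (at x within {0..})" "J < x" "\<And>y. J < y \<Longrightarrow> h y = 0" for h d x
  proof -
    have "(h has_real_derivative d) (at x)"
      using that(1,2) J(1) at_within_interior[of x "{0..}"] by simp
    moreover have "(h has_real_derivative 0) (at x)"
      by (rule has_field_derivative_transform_within_open[where f="\<lambda>_. 0" and S="{J<..}"]) (use that in auto)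
    ultimately show ?thesis by (rule DERIV_unique)
  qed
  have zx: "\<psi>x x t = 0" if "J < x" "t \<in> {0..T}" for x t
    by (rule deriv0[OF C(1)[of x t]]) (use that J(1) z in auto)
  have zxx: "\<psi>xx x t = 0" if "J < x" "t \<in> {0..T}" for x t
    by (rule deriv0[OF C(2)[of x t]]) (use that J(1) zx in auto)
  \<comment> \<open>At \<open>t = 0\<close> and \<open>t = T\<close> the derivative is one-sided, so
    its uniqueness is taken within the closed time interval.\<close>
  have zt: "\<psi>t x t = 0" if "J < x" "t \<in> {0..T}" for x t
  proof -
    have "((\<lambda>s. \<psi> x s) has_vector_derivative \<psi>t x t) (at t within cbox 0 T)"
      using C(3)[of x t] that J(1) by (simp add: has_real_derivative_iff_has_vector_derivative)
    moreover have "((\<lambda>s. \<psi> x s) has_vector_derivative 0) (at t within cbox 0 T)"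
      by (rule has_vector_derivative_transform[where f="\<lambda>_. 0"]) (use that z in auto)
    ultimately show ?thesis
      using that T by (intro vector_derivative_unique_within_closed_interval[of 0 T t "\<lambda>s. \<psi> x s"]) auto
  qed
  \<comment> \<open>One unit beyond \<open>J\<close>, so that \<open>R \<le> x\<close> puts
    \<open>x\<close> into the open region where the derivatives vanish too.\<close>
  show ?thesis
    by (rule that[of "J + 1"]) (use J(1) z zx zxx zt in auto)
qed

text \<open>Extending from the closed strip to the plane by clamping the arguments keeps continuity, so that
  joint continuity on the whole plane is available for measurability and the chain rule.\<close>

definition clamp_extension :: "real \<Rightarrow> (real \<Rightarrow> real \<Rightarrow> real) \<Rightarrow> real \<Rightarrow> real \<Rightarrow> real" where
  "clamp_extension T k x t = k (max 0 x) (max 0 (min T t))"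

lemma clamp_extension_eq: "0 \<le> x \<Longrightarrow> t \<in> {0..T} \<Longrightarrow> clamp_extension T k x t = k x t"
  by (simp add: clamp_extension_def)

lemma continuous_clamp_extension:
  assumes "continuous_on (closed_strip T) (\<lambda>(x, t). k x t)" "0 < T"
  shows "continuous_on UNIV (\<lambda>p. clamp_extension T k (fst p) (snd p))"
proof -
  have "continuous_on UNIV (\<lambda>p. (\<lambda>(x, t). k x t) (max 0 (fst p), max 0 (min T (snd p))))"
    by (rule continuous_on_compose2[OF assms(1)]) (use assms(2) in \<open>auto intro!: continuous_intros simp: closed_strip_def\<close>)
  then show ?thesis by (simp add: clamp_extension_def)
qed

lemma clamp_extension_bounded:
  assumes c: "continuous_on (closed_strip T) (\<lambda>(x, t). k x t)" and T: "0 < T"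
    and z: "\<And>x t. R \<le> x \<Longrightarrow> t \<in> {0..T} \<Longrightarrow> k x t = 0"
  shows "\<exists>K. \<forall>x t. \<bar>clamp_extension T k x t\<bar> \<le> K"
proof -
  have "compact ((\<lambda>(x, t). k x t) ` ({0..R} \<times> {0..T}))"
    by (intro compact_continuous_image continuous_on_subset[OF c] compact_Times compact_Icc) (auto simp: closed_strip_def)
  then have "bounded ((\<lambda>(x, t). k x t) ` ({0..R} \<times> {0..T}))" by (rule compact_imp_bounded)
  then obtain K where "\<forall>y \<in> (\<lambda>(x, t). k x t) ` ({0..R} \<times> {0..T}). norm y \<le> K"
    unfolding bounded_iff ..
  then have K: "\<bar>k x t\<bar> \<le> K" if "x \<in> {0..R}" "t \<in> {0..T}" for x t
    using imageI[of "(x, t)" "{0..R} \<times> {0..T}" "\<lambda>(x, t). k x t"] that by simp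
  have "\<bar>clamp_extension T k x t\<bar> \<le> \<bar>K\<bar>" for x t
  proof (cases "R \<le> max 0 x")
    case True
    then show ?thesis using z[OF True, of "max 0 (min T t)"] T by (simp add: clamp_extension_def)
  next
    case False
    then have "\<bar>k (max 0 x) (max 0 (min T t))\<bar> \<le> K" using T by (intro K) auto
    then show ?thesis by (simp add: clamp_extension_def)
  qed
  then show ?thesis by blast
qed

text \<open>\<open>self_similar_flux\<close> at fixed time and \<open>self_similar_transport\<close>
  on (eps, T) are combined so that the terms (\<psi> + x \<psi>x) / (2t) cancel. The value
  \<open>g 0\<close> produces the Dirichlet term, and the limit of \<open>f\<close> at infinity
  produces the initial datum as eps tends to 0.\<close>

lemma self_similar_weak_solution:
  fixes f g p G :: "real \<Rightarrow> real" and d\<^sub>u d\<^sub>v U\<^sub>0 V\<^sub>0 :: real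
  defines "g \<equiv> \<lambda>\<eta>. diffusion d\<^sub>u d\<^sub>v (f \<eta>)"
  assumes d: "d\<^sub>u > 0" "d\<^sub>v \<ge> 0"
    and fm[measurable]: "f \<in> borel_measurable borel" and fb: "\<And>\<eta>. \<bar>f \<eta>\<bar> \<le> M"
    and gc: "continuous_on {0..} g" and Gc: "continuous_on {0..} G"
    and dg: "\<And>\<eta>. 0 < \<eta> \<Longrightarrow> \<eta> \<noteq> a \<Longrightarrow> (g has_real_derivative p \<eta>) (at \<eta>)"
    and dG: "\<And>\<eta>. 0 < \<eta> \<Longrightarrow> \<eta> \<noteq> a \<Longrightarrow> (G has_real_derivative f \<eta> / 2) (at \<eta>)"
    and G: "\<And>\<eta>. 0 < \<eta> \<Longrightarrow> \<eta> \<noteq> a \<Longrightarrow> G \<eta> = p \<eta> + \<eta> * f \<eta> / 2"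
    and g0: "g 0 = d\<^sub>u * U\<^sub>0" and flim: "(f \<longlongrightarrow> - V\<^sub>0) at_top"
  shows "weak_solution d\<^sub>u d\<^sub>v U\<^sub>0 V\<^sub>0 (\<lambda>x t. f (x / sqrt t))"
proof -
  have M: "0 \<le> M" using fb[of 0] by linarith
  have gm[measurable]: "g \<in> borel_measurable borel" unfolding g_def by measurable
  define M' where "M' = max d\<^sub>u d\<^sub>v * M"
  have gb: "\<bar>g \<eta>\<bar> \<le> M'" for \<eta>
  proof -
    have "diffusion d\<^sub>u d\<^sub>v 0 = 0" by (simp add: diffusion_def)
    then have "\<bar>g \<eta>\<bar> \<le> max d\<^sub>u d\<^sub>v * \<bar>f \<eta>\<bar>"
      unfolding g_def using diffusion_lipschitz[OF d, of "f \<eta>" 0] by simp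
    also have "\<dots> \<le> M'" unfolding M'_def using d by (intro mult_left_mono fb) auto
    finally show ?thesis .
  qed
  have M': "0 \<le> M'" using gb[of 0] by linarith
  have Li: "Linfty_quadrant (\<lambda>x t. f (x / sqrt t))"
    unfolding Linfty_quadrant_def
  proof (intro conjI exI)
    have "(\<lambda>p::real\<times>real. f (fst p / sqrt (snd p))) \<in> borel_measurable (borel \<Otimes>\<^sub>M borel)" by measurable
    then have "(\<lambda>p::real\<times>real. f (fst p / sqrt (snd p))) \<in> borel_measurable lborel" by (simp add: borel_prod)
    then show "(\<lambda>(x, t). f (x / sqrt t)) \<in> borel_measurable (lebesgue_on quadrant)"
      unfolding case_prod_beta' by (intro measurable_restrict_space1 measurable_completion)
    show "AE (x, t) in lebesgue_on quadrant. \<bar>f (x / sqrt t)\<bar> \<le> M"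
      using fb by (intro AE_I2) auto
  qed
  show ?thesis
    unfolding weak_solution_def
  proof (intro conjI Li allI impI)
    fix T :: real and \<psi> \<psi>x \<psi>xx \<psi>t
    assume T: "T > 0" and tf: "test_function T \<psi> \<psi>x \<psi>xx \<psi>t"
    have C21: "C21_on_closed_strip T \<psi> \<psi>x \<psi>xx \<psi>t"
      using tf unfolding test_function_def by - (elim conjE, assumption)
    have \<psi>T: "\<forall>x\<ge>0. \<psi> x T = 0" using tf unfolding test_function_def by - (elim conjE, assumption)
    have \<psi>0: "\<forall>t\<in>{0<..<T}. \<psi> 0 t = 0" using tf unfolding test_function_def by - (elim conjE, assumption)
    have cc: "continuous_on (closed_strip T) (\<lambda>(x, t). \<psi> x t)" "continuous_on (closed_strip T) (\<lambda>(x, t). \<psi>x x t)"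
      "continuous_on (closed_strip T) (\<lambda>(x, t). \<psi>xx x t)" "continuous_on (closed_strip T) (\<lambda>(x, t). \<psi>t x t)"
      using C21 unfolding C21_on_closed_strip_def by - (elim conjE, assumption)+
    obtain R where R: "0 < R" and
      Rz: "\<And>x t. R \<le> x \<Longrightarrow> t \<in> {0..T} \<Longrightarrow> \<psi> x t = 0 \<and> \<psi>x x t = 0 \<and> \<psi>xx x t = 0 \<and> \<psi>t x t = 0"
      using test_function_support[OF tf T] by metis
    define e where "e = clamp_extension T"
    have ez: "e k x t = 0" if "R \<le> x" "\<And>x t. R \<le> x \<Longrightarrow> t \<in> {0..T} \<Longrightarrow> k x t = 0" for k x t
      using that(1) R T unfolding e_def clamp_extension_def by (intro that(2)) auto
    have ee: "e k x t = k x t" if "0 \<le> x" "0 \<le> t" "t \<le> T" for k x t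
      using that unfolding e_def by (intro clamp_extension_eq) auto
    have ec: "continuous_on UNIV (\<lambda>p. e \<psi> (fst p) (snd p))" "continuous_on UNIV (\<lambda>p. e \<psi>x (fst p) (snd p))"
      "continuous_on UNIV (\<lambda>p. e \<psi>xx (fst p) (snd p))" "continuous_on UNIV (\<lambda>p. e \<psi>t (fst p) (snd p))"
      unfolding e_def by (intro continuous_clamp_extension cc T)+
    note [measurable (raw)] = measurable_app2[OF borel_measurable_pair_of_continuous[OF ec(1)]]
      measurable_app2[OF borel_measurable_pair_of_continuous[OF ec(2)]]
      measurable_app2[OF borel_measurable_pair_of_continuous[OF ec(3)]]
      measurable_app2[OF borel_measurable_pair_of_continuous[OF ec(4)]]
    obtain K1 K2 K3 K4 where K: "\<forall>x t. \<bar>e \<psi> x t\<bar> \<le> K1" "\<forall>x t. \<bar>e \<psi>x x t\<bar> \<le> K2" "\<forall>x t. \<bar>e \<psi>xx x t\<bar> \<le> K3" "\<forall>x t. \<bar>e \<psi>t x t\<bar> \<le> K4"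
    proof -
      have "\<exists>K. \<forall>x t. \<bar>e \<psi> x t\<bar> \<le> K" "\<exists>K. \<forall>x t. \<bar>e \<psi>x x t\<bar> \<le> K" "\<exists>K. \<forall>x t. \<bar>e \<psi>xx x t\<bar> \<le> K" "\<exists>K. \<forall>x t. \<bar>e \<psi>t x t\<bar> \<le> K"
        unfolding e_def by (intro clamp_extension_bounded[where R=R] cc T; simp add: Rz)+
      then show thesis using that by metis
    qed
    define K where "K = max (max K1 K2) (max K3 K4)"
    have b: "\<bar>e \<psi> x t\<bar> \<le> K" "\<bar>e \<psi>x x t\<bar> \<le> K" "\<bar>e \<psi>xx x t\<bar> \<le> K" "\<bar>e \<psi>t x t\<bar> \<le> K" for x t
      using K by (auto simp: K_def le_max_iff_disj)
    have K0: "0 \<le> K" using b(1)[of 0 0] by linarith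
    have z: "e \<psi> x t = 0" "e \<psi>x x t = 0" "e \<psi>xx x t = 0" "e \<psi>t x t = 0" if "R \<le> x" for x t
      using that by (auto intro!: ez simp: Rz)
    have dx: "((\<lambda>y. e \<psi> y t) has_real_derivative e \<psi>x x t) (at x)"
      and dxx: "((\<lambda>y. e \<psi>x y t) has_real_derivative e \<psi>xx x t) (at x)"
      and dt: "((\<lambda>s. e \<psi> x s) has_real_derivative e \<psi>t x t) (at t)" if xt: "0 < x" "0 < t" "t < T" for x t
    proof -
      have D: "((\<lambda>y. \<psi> y t) has_real_derivative \<psi>x x t) (at x within {0..})"
        "((\<lambda>y. \<psi>x y t) has_real_derivative \<psi>xx x t) (at x within {0..})"
        "((\<lambda>s. \<psi> x s) has_real_derivative \<psi>t x t) (at t within {0..T})"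
        using C21D[OF C21, of x t] xt by auto
      have ai: "at x within {0..} = at x" "at t within {0..T} = at t"
        using xt at_within_interior[of x "{0..}"] at_within_interior[of t "{0..T}"] by auto
      have es: "e \<psi>x x t = \<psi>x x t" "e \<psi>xx x t = \<psi>xx x t" "e \<psi>t x t = \<psi>t x t" using xt by (auto intro!: ee)
      show "((\<lambda>y. e \<psi> y t) has_real_derivative e \<psi>x x t) (at x)"
        unfolding es by (rule has_field_derivative_transform_within_open[OF D(1)[unfolded ai], of "{0<..}"]) (use xt ee in auto)
      show "((\<lambda>y. e \<psi>x y t) has_real_derivative e \<psi>xx x t) (at x)"
        unfolding es by (rule has_field_derivative_transform_within_open[OF D(2)[unfolded ai], of "{0<..}"]) (use xt ee in auto)
      show "((\<lambda>s. e \<psi> x s) has_real_derivative e \<psi>t x t) (at t)"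
        unfolding es by (rule has_field_derivative_transform_within_open[OF D(3)[unfolded ai], of "{0<..<T}"]) (use xt ee in auto)
    qed
    have T0: "e \<psi> x T = 0" for x using T \<psi>T by (simp add: e_def clamp_extension_def)
    have b0: "e \<psi> 0 t = 0" if "0 < t" "t < T" for t using that \<psi>0 ee[of 0 t \<psi>] by simp
    define I where "I t = (\<integral>x. indicator {0<..<R} x * (f (x / sqrt t) * e \<psi>t x t + g (x / sqrt t) * e \<psi>xx x t) \<partial>lborel)" for t
    \<comment> \<open>The transport integrand carries a factor 1/t, yet its x-integral equals
      \<open>j\<close> by \<open>j_eq\<close>, and \<open>j\<close> is bounded uniformly in
      \<open>t\<close>; this bound dominates the passage to t = 0.\<close>
    define j where "j t = I t + g 0 * e \<psi>x 0 t" for t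
    have Im[measurable]: "I \<in> borel_measurable borel"
      unfolding I_def by measurable
    have jm[measurable]: "j \<in> borel_measurable borel"
      unfolding j_def by measurable
    have qb: "\<bar>f y * e \<psi>t x t + g y * e \<psi>xx x t\<bar> \<le> M * K + M' * K" for x y t
    proof -
      have "\<bar>f y * e \<psi>t x t\<bar> \<le> M * K" "\<bar>g y * e \<psi>xx x t\<bar> \<le> M' * K"
        unfolding abs_mult using M M' by (intro mult_mono fb gb b; simp)+
      then show ?thesis by linarith
    qed
    have Ib: "\<bar>I t\<bar> \<le> (M * K + M' * K) * R" for t
    proof -
      have "\<bar>I t\<bar> \<le> (M * K + M' * K) * (R - 0)"
        unfolding I_def by (rule integral_interval_bound) (use qb R M M' K0 in auto)
      then show ?thesis by simp
    qed
    have jb: "\<bar>j t\<bar> \<le> (M * K + M' * K) * R + M' * K" for t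
    proof -
      have "\<bar>g 0 * e \<psi>x 0 t\<bar> \<le> M' * K" unfolding abs_mult using M' by (intro mult_mono gb b) auto
      then show ?thesis using Ib[of t] unfolding j_def by linarith
    qed
    \<comment> \<open>Subtracting the flux identity removes the term with \<open>g\<close> and its
      boundary value at once.\<close>
    have j_eq: "j t = (\<integral>x. indicator {0<..<R} x * (f (x / sqrt t) * (e \<psi>t x t + (e \<psi> x t + x * e \<psi>x x t) / (2 * t))) \<partial>lborel)"
      if t: "0 < t" "t < T" for t
    proof -
      let ?k = "\<lambda>x. (e \<psi> x t + x * e \<psi>x x t) / (2 * t)"
      let ?q = "\<lambda>x. f (x / sqrt t) * e \<psi>t x t + g (x / sqrt t) * e \<psi>xx x t"
      let ?l = "\<lambda>x. g (x / sqrt t) * e \<psi>xx x t - f (x / sqrt t) * ?k x"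
      have kb: "\<bar>?l x\<bar> \<le> M' * K + M * ((K + R * K) / (2 * t))" if "0 < x" "x < R" for x
      proof -
        have "\<bar>x * e \<psi>x x t\<bar> \<le> R * K" unfolding abs_mult using that K0 by (intro mult_mono b) auto
        then have "\<bar>e \<psi> x t + x * e \<psi>x x t\<bar> \<le> K + R * K" using b(1)[of x t] by linarith
        then have "\<bar>?k x\<bar> \<le> (K + R * K) / (2 * t)" using t by (simp add: divide_right_mono)
        then have "\<bar>f (x / sqrt t) * ?k x\<bar> \<le> M * ((K + R * K) / (2 * t))"
          unfolding abs_mult[of "f (x / sqrt t)"] using M by (intro mult_mono fb) auto
        moreover have "\<bar>g (x / sqrt t) * e \<psi>xx x t\<bar> \<le> M' * K"
          unfolding abs_mult using M' by (intro mult_mono gb b) auto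
        ultimately show ?thesis by linarith
      qed
      have il: "integrable lborel (\<lambda>x. indicator {0<..<R} x * ?l x)"
      proof (rule integrable_of_bounded_vanishing[where K="\<bar>M' * K + M * ((K + R * K) / (2 * t))\<bar>" and a=0 and b=R])
        show "\<bar>indicator {0<..<R} x * ?l x\<bar> \<le> \<bar>M' * K + M * ((K + R * K) / (2 * t))\<bar>" for x
          using kb[of x] by (cases "x \<in> {0<..<R}") auto
      qed auto
      have iq: "integrable lborel (\<lambda>x. indicator {0<..<R} x * ?q x)"
      proof (rule integrable_of_bounded_vanishing[where K="M * K + M' * K" and a=0 and b=R])
        show "\<bar>indicator {0<..<R} x * ?q x\<bar> \<le> M * K + M' * K" for x
          using qb[of "x / sqrt t" x t] M M' K0 by (cases "x \<in> {0<..<R}") auto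
      qed auto
      have flux: "(\<integral>x. indicator {0<..<R} x * ?l x \<partial>lborel) = - g 0 * e \<psi>x 0 t"
      proof (rule self_similar_flux[where a=a and G=G and p=p and K=K and M=M and M'=M'])
        show "continuous_on UNIV (\<lambda>x. e \<psi> x t)" "continuous_on UNIV (\<lambda>x. e \<psi>x x t)" "continuous_on UNIV (\<lambda>x. e \<psi>xx x t)"
          by (intro continuous_on_pair_app[OF ec(1)] continuous_on_pair_app[OF ec(2)] continuous_on_pair_app[OF ec(3)] continuous_intros)+
      qed (use fb gb gc Gc dg dG G b dx dxx t b0 z R in auto)
      have "j t = (\<integral>x. indicator {0<..<R} x * ?q x \<partial>lborel) - (\<integral>x. indicator {0<..<R} x * ?l x \<partial>lborel)"
        unfolding flux by (simp add: j_def I_def)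
      also have "\<dots> = (\<integral>x. indicator {0<..<R} x * ?q x - indicator {0<..<R} x * ?l x \<partial>lborel)"
        by (rule Bochner_Integration.integral_diff[symmetric, OF iq il])
      also have "\<dots> = (\<integral>x. indicator {0<..<R} x * (f (x / sqrt t) * (e \<psi>t x t + ?k x)) \<partial>lborel)"
        by (intro Bochner_Integration.integral_cong refl) (simp add: algebra_simps)
      finally show ?thesis .
    qed
    have lhs: "(LINT (x, t)|lebesgue_on (strip T). f (x / sqrt t) * \<psi>t x t + diffusion d\<^sub>u d\<^sub>v (f (x / sqrt t)) * \<psi>xx x t)
        = (\<integral>t. indicator {0<..<T} t * I t \<partial>lborel)"
    proof -
      \<comment> \<open>Cut off at the axes and at \<open>T\<close>, the data are Borel on the plane
        and the integrand has bounded support, so Fubini applies.\<close>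
      define v where "v x t = (if 0 < x \<and> 0 < t then f (x / sqrt t) else 0)" for x t
      define A where "A x t = (if t < T then e \<psi>t x t else 0)" for x t
      define E where "E x t = (if t < T then e \<psi>xx x t else 0)" for x t
      have vm: "case_prod v \<in> borel_measurable lborel\<^sub>2" unfolding v_def by measurable
      have Am: "case_prod A \<in> borel_measurable lborel\<^sub>2" unfolding A_def by measurable
      have Em: "case_prod E \<in> borel_measurable lborel\<^sub>2" unfolding E_def by measurable
      note [measurable (raw)] = measurable_app2[OF vm] measurable_app2[OF Am] measurable_app2[OF Em]
      define k where "k x t = v x t * A x t + diffusion d\<^sub>u d\<^sub>v (v x t) * E x t" for x t
      have km: "case_prod k \<in> borel_measurable lborel\<^sub>2" unfolding k_def by measurable
      have k_eq: "k x t = (if 0 < x \<and> x < R \<and> 0 < t \<and> t < T then f (x / sqrt t) * e \<psi>t x t + g (x / sqrt t) * e \<psi>xx x t else 0)" for x t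
        using z[of x t] by (auto simp: k_def v_def A_def E_def g_def diffusion_def not_less)
      have ik: "integrable lborel\<^sub>2 (case_prod k)"
        by (rule integrable_pair_bounded_support[where K="M * K + M' * K" and a=0 and b=R and c=0 and d=T])
           (use km qb M M' K0 in \<open>auto simp: k_eq\<close>)
      have "(LINT (x, t)|lebesgue_on (strip T). f (x / sqrt t) * \<psi>t x t + diffusion d\<^sub>u d\<^sub>v (f (x / sqrt t)) * \<psi>xx x t)
          = (LINT (x, t)|lebesgue_on (strip T). f (x / sqrt t) * A x t + diffusion d\<^sub>u d\<^sub>v (f (x / sqrt t)) * E x t)"
        by (intro Bochner_Integration.integral_cong)
           (auto simp: space_restrict_space strip_def A_def E_def ee)
      also have "\<dots> = (\<integral>p. v (fst p) (snd p) * A (fst p) (snd p) + diffusion d\<^sub>u d\<^sub>v (v (fst p) (snd p)) * E (fst p) (snd p) \<partial>lborel\<^sub>2)"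
      proof (rule integral_strip_eq)
        show "(\<lambda>(x, t). f (x / sqrt t)) \<in> borel_measurable (lebesgue_on quadrant)"
          using Li by (simp add: Linfty_quadrant_def)
      qed (use vm Am Em in \<open>auto simp: v_def A_def E_def\<close>)
      also have "\<dots> = integral\<^sup>L lborel\<^sub>2 (case_prod k)" by (simp add: k_def case_prod_beta')
      also have "\<dots> = (\<integral>t. \<integral>x. k x t \<partial>lborel \<partial>lborel)"
        by (rule lborel_pair.integral_snd[OF ik, symmetric])
      also have "(\<lambda>t. \<integral>x. k x t \<partial>lborel) = (\<lambda>t. indicator {0<..<T} t * I t)"
      proof
        fix t
        show "(\<integral>x. k x t \<partial>lborel) = indicator {0<..<T} t * I t"
          unfolding I_def integral_mult_right_zero[symmetric]
          by (intro Bochner_Integration.integral_cong) (auto simp: k_eq indicator_def)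
      qed
      finally show ?thesis .
    qed
    have lim: "(\<integral>t. indicator {0<..<T} t * j t \<partial>lborel) = V\<^sub>0 * (\<integral>x. indicator {0<..<R} x * e \<psi> x 0 \<partial>lborel)"
    proof -
      \<comment> \<open>The summand 2 keeps \<open>\<epsilon> n\<close> strictly below
        \<open>T\<close> also for \<open>n = 0\<close>.\<close>
      define \<epsilon> where "\<epsilon> n = T / (real n + 2)" for n :: nat
      have \<epsilon>: "0 < \<epsilon> n" "\<epsilon> n < T" for n using T by (auto simp: \<epsilon>_def field_simps intro: add_pos_nonneg)
      have \<epsilon>0: "\<epsilon> \<longlonglongrightarrow> 0" 
        using LIMSEQ_ignore_initial_segment[OF lim_const_over_n[of T], of 2] by (simp add: \<epsilon>_def[abs_def] add.commute)
      have l1: "(\<lambda>n. \<integral>t. indicator {\<epsilon> n<..<T} t * j t \<partial>lborel) \<longlonglongrightarrow> (\<integral>t. indicator {0<..<T} t * j t \<partial>lborel)"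
      proof (rule integral_dominated_convergence[where w="\<lambda>t. ((M * K + M' * K) * R + M' * K) * indicator {0<..<T} t"])
        show "AE t in lborel. (\<lambda>n. indicator {\<epsilon> n<..<T} t * j t) \<longlonglongrightarrow> indicator {0<..<T} t * j t"
        proof (rule AE_I2)
          fix t
          have "eventually (\<lambda>n. indicator {\<epsilon> n<..<T} t * j t = indicator {0<..<T} t * j t) sequentially"
          proof (cases "0 < t")
            case True
            then have "eventually (\<lambda>n. \<epsilon> n < t) sequentially" using order_tendstoD(2)[OF \<epsilon>0] by simp
            then show ?thesis by eventually_elim (use True in \<open>auto simp: indicator_def\<close>)
          next
            case False
            then have "\<not> \<epsilon> n < t" for n using \<epsilon>(1)[of n] by linarith
            then show ?thesis using False by (simp add: indicator_def)
          qed
          then show "(\<lambda>n. indicator {\<epsilon> n<..<T} t * j t) \<longlonglongrightarrow> indicator {0<..<T} t * j t"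
            by (rule tendsto_eventually)
        qed
        show "AE t in lborel. norm (indicator {\<epsilon> n<..<T} t * j t) \<le> ((M * K + M' * K) * R + M' * K) * indicator {0<..<T} t" for n
          using jb \<epsilon>(1)[of n] M M' K0 R by (intro AE_I2) (auto simp: indicator_def)
        show "integrable lborel (\<lambda>t. ((M * K + M' * K) * R + M' * K) * indicator {0<..<T} t)"
          by (intro integrable_mult_right integrable_real_indicator) (use T in auto)
      qed auto
      have eq: "(\<integral>t. indicator {\<epsilon> n<..<T} t * j t \<partial>lborel) = - (\<integral>x. indicator {0<..<R} x * (f (x / sqrt (\<epsilon> n)) * e \<psi> x (\<epsilon> n)) \<partial>lborel)" for n
      proof -
        have "(\<integral>t. indicator {\<epsilon> n<..<T} t * j t \<partial>lborel) = (\<integral>t. indicator {\<epsilon> n<..<T} t * (\<integral>x. indicator {0<..<R} x * (f (x / sqrt t) * (e \<psi>t x t + (e \<psi> x t + x * e \<psi>x x t) / (2 * t))) \<partial>lborel) \<partial>lborel)"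
        proof (rule Bochner_Integration.integral_cong)
          fix t
          show "indicator {\<epsilon> n<..<T} t * j t = indicator {\<epsilon> n<..<T} t * (\<integral>x. indicator {0<..<R} x * (f (x / sqrt t) * (e \<psi>t x t + (e \<psi> x t + x * e \<psi>x x t) / (2 * t))) \<partial>lborel)"
            using j_eq[of t] \<epsilon>(1)[of n] by (cases "t \<in> {\<epsilon> n<..<T}") auto
        qed simp
        also have "\<dots> = - (\<integral>x. indicator {0<..<R} x * (f (x / sqrt (\<epsilon> n)) * e \<psi> x (\<epsilon> n)) \<partial>lborel)"
          by (rule self_similar_transport[OF fm fb ec(1,2,4) b(1,2,4) z(1,2,4) dx dt T0 \<epsilon> R])
        finally show ?thesis .
      qed
      \<comment> \<open>For fixed x > 0 the argument x / sqrt eps tends to infinity, so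
        \<open>f\<close> tends to \<open>- V\<^sub>0\<close>: this is where the initial condition
        comes from.\<close>
      have l2: "(\<lambda>n. \<integral>x. indicator {0<..<R} x * (f (x / sqrt (\<epsilon> n)) * e \<psi> x (\<epsilon> n)) \<partial>lborel) \<longlonglongrightarrow> (\<integral>x. indicator {0<..<R} x * (- V\<^sub>0 * e \<psi> x 0) \<partial>lborel)"
      proof (rule integral_dominated_convergence[where w="\<lambda>x. (M * K) * indicator {0<..<R} x"])
        show "AE x in lborel. (\<lambda>n. indicator {0<..<R} x * (f (x / sqrt (\<epsilon> n)) * e \<psi> x (\<epsilon> n))) \<longlonglongrightarrow> indicator {0<..<R} x * (- V\<^sub>0 * e \<psi> x 0)"
        proof (rule AE_I2)
          fix x
          show "(\<lambda>n. indicator {0<..<R} x * (f (x / sqrt (\<epsilon> n)) * e \<psi> x (\<epsilon> n))) \<longlonglongrightarrow> indicator {0<..<R} x * (- V\<^sub>0 * e \<psi> x 0)"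
          proof (cases "0 < x")
            case True
            have "filterlim (\<lambda>n. inverse (sqrt (\<epsilon> n))) at_top sequentially"
              using tendsto_real_sqrt[OF \<epsilon>0] \<epsilon>(1) by (intro filterlim_inverse_at_top) auto
            then have "filterlim (\<lambda>n. x * inverse (sqrt (\<epsilon> n))) at_top sequentially"
              by (rule filterlim_tendsto_pos_mult_at_top[OF tendsto_const True])
            then have "filterlim (\<lambda>n. x / sqrt (\<epsilon> n)) at_top sequentially" by (simp add: divide_inverse)
            then have "(\<lambda>n. f (x / sqrt (\<epsilon> n))) \<longlonglongrightarrow> - V\<^sub>0" by (rule filterlim_compose[OF flim])
            moreover have "continuous_on UNIV (\<lambda>t. e \<psi> x t)"
              by (intro continuous_on_pair_app[OF ec(1)] continuous_intros)
            then have "isCont (\<lambda>t. e \<psi> x t) 0" by (simp add: continuous_on_eq_continuous_at)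
            then have "(\<lambda>n. e \<psi> x (\<epsilon> n)) \<longlonglongrightarrow> e \<psi> x 0" using \<epsilon>0 by (rule isCont_tendsto_compose)
            ultimately show ?thesis by (intro tendsto_intros)
          qed simp
        qed
        show "AE x in lborel. norm (indicator {0<..<R} x * (f (x / sqrt (\<epsilon> n)) * e \<psi> x (\<epsilon> n))) \<le> (M * K) * indicator {0<..<R} x" for n
        proof (rule AE_I2)
          fix x
          have "\<bar>f (x / sqrt (\<epsilon> n)) * e \<psi> x (\<epsilon> n)\<bar> \<le> M * K"
            unfolding abs_mult using M by (intro mult_mono fb b) auto
          then show "norm (indicator {0<..<R} x * (f (x / sqrt (\<epsilon> n)) * e \<psi> x (\<epsilon> n))) \<le> (M * K) * indicator {0<..<R} x"
            by (cases "x \<in> {0<..<R}") auto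
        qed
        show "integrable lborel (\<lambda>x. (M * K) * indicator {0<..<R} x)"
          by (intro integrable_mult_right integrable_real_indicator) (use R in auto)
      qed auto
      have "(\<integral>t. indicator {0<..<T} t * j t \<partial>lborel) = - (\<integral>x. indicator {0<..<R} x * (- V\<^sub>0 * e \<psi> x 0) \<partial>lborel)"
        using LIMSEQ_unique[OF l1[unfolded eq] tendsto_minus[OF l2]] .
      also have "(\<integral>x. indicator {0<..<R} x * (- V\<^sub>0 * e \<psi> x 0) \<partial>lborel) = (\<integral>x. - V\<^sub>0 * (indicator {0<..<R} x * e \<psi> x 0) \<partial>lborel)"
        by (intro Bochner_Integration.integral_cong) auto
      finally show ?thesis by simp
    qed
    have r1: "(LINT t|lebesgue_on {0<..<T}. \<psi>x 0 t) = (\<integral>t. indicator {0<..<T} t * e \<psi>x 0 t \<partial>lborel)"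
      by (rule integral_lebesgue_on_eq_lborel) (auto simp: ee)
    have r2: "(LINT x|lebesgue_on {0<..}. initial_datum V\<^sub>0 x * \<psi> x 0) = - V\<^sub>0 * (\<integral>x. indicator {0<..<R} x * e \<psi> x 0 \<partial>lborel)"
    proof -
      have "(LINT x|lebesgue_on {0<..}. initial_datum V\<^sub>0 x * \<psi> x 0) = (\<integral>x. indicator {0<..} x * (- V\<^sub>0 * e \<psi> x 0) \<partial>lborel)"
        by (rule integral_lebesgue_on_eq_lborel) (use T in \<open>auto simp: ee initial_datum_def\<close>)
      also have "\<dots> = (\<integral>x. - V\<^sub>0 * (indicator {0<..<R} x * e \<psi> x 0) \<partial>lborel)"
        by (intro Bochner_Integration.integral_cong) (auto simp: indicator_def z)
      finally show ?thesis by simp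
    qed
    have i1: "integrable lborel (\<lambda>t. indicator {0<..<T} t * I t)"
      by (rule integrable_of_bounded_vanishing[where K="(M * K + M' * K) * R" and a=0 and b=T])
         (use Ib M M' K0 R in \<open>auto simp: indicator_def\<close>)
    have i2: "integrable lborel (\<lambda>t. indicator {0<..<T} t * e \<psi>x 0 t)"
      by (rule integrable_of_bounded_vanishing[where K=K and a=0 and b=T])
         (use b K0 in \<open>auto simp: indicator_def\<close>)
    have "(\<integral>t. indicator {0<..<T} t * I t \<partial>lborel) = (\<integral>t. indicator {0<..<T} t * j t \<partial>lborel) - g 0 * (\<integral>t. indicator {0<..<T} t * e \<psi>x 0 t \<partial>lborel)"
      using i1 i2 by (simp add: j_def distrib_left mult.left_commute)
    then show "(LINT (x, t)|lebesgue_on (strip T). f (x / sqrt t) * \<psi>t x t + diffusion d\<^sub>u d\<^sub>v (f (x / sqrt t)) * \<psi>xx x t)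
        = - d\<^sub>u * U\<^sub>0 * (LINT t|lebesgue_on {0<..<T}. \<psi>x 0 t) - (LINT x|lebesgue_on {0<..}. initial_datum V\<^sub>0 x * \<psi> x 0)"
      unfolding lhs r1 r2 lim g0 by (simp add: algebra_simps)
  qed
qed

section \<open>The interface equation\<close>

text \<open>Up to a factor, the derivative of the profile in a phase with coefficient
  \<open>d\<close>: it solves d p' + (s/2) p = 0. For \<open>d = 0\<close> division by zero makes it
  the constant 1, so continuity holds for every \<open>d\<close>.\<close>

definition gauss :: "real \<Rightarrow> real \<Rightarrow> real" where
  "gauss d s = exp (- (s\<^sup>2 / (4 * d)))"

lemma gauss_pos: "0 < gauss d s" by (simp add: gauss_def)

lemma continuous_gauss: "continuous_on S (gauss d)"
  unfolding gauss_def by (cases "d = 0") (auto intro!: continuous_intros)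

lemma gauss_integrable_interval: "gauss d integrable_on {a..b}"
  by (intro integrable_continuous_interval continuous_gauss)

lemma gauss_le_exp:
  assumes d: "d > 0"
  shows "gauss d s \<le> exp d * exp (- s)"
proof -
  \<comment> \<open>The tangent of s^2 / (4d) at s = 2d has slope 1 and is s - d; hence the factor
    \<open>exp d\<close>.\<close>
  have "0 \<le> (s - 2 * d)\<^sup>2" by simp
  then have "4 * d * (s - d) \<le> s\<^sup>2" by (simp add: power2_eq_square algebra_simps)
  then have "s - d \<le> s\<^sup>2 / (4 * d)" using d by (simp add: field_simps)
  then show ?thesis by (simp add: gauss_def flip: exp_add)
qed

lemma exp_tail_has_integral:
  fixes a C :: real
  shows "((\<lambda>s. C * exp (- s)) has_integral C * exp (- a)) {a..}"
  using has_integral_mult_right[OF has_integral_exp_minus_to_infinity[of 1 a], of C] by simp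

lemma gauss_integrable_tail:
  assumes d: "d > 0"
  shows "gauss d integrable_on {a..}"
proof (rule measurable_bounded_by_integrable_imp_integrable[where g="\<lambda>s. exp d * exp (- s)"])
  show "gauss d \<in> borel_measurable (lebesgue_on {a..})"
    by (intro continuous_imp_measurable_on_sets_lebesgue continuous_gauss) simp
  show "(\<lambda>s. exp d * exp (- s)) integrable_on {a..}"
    using exp_tail_has_integral[of "exp d" a] by (rule has_integral_integrable)
  show "norm (gauss d s) \<le> exp d * exp (- s)" for s
    using gauss_le_exp[OF d, of s] gauss_pos[of d s] by simp
qed simp

lemma gauss_integral_pos:
  assumes "a < b"
  shows "0 < integral {a..b} (gauss d)"
proof -
  have "0 < (b - a) * 1" using assms by simp
  have c: "continuous_on {a..b} (gauss d)" by (rule continuous_gauss)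
  obtain m where m: "m \<in> {a..b}" "\<And>x. x \<in> {a..b} \<Longrightarrow> gauss d m \<le> gauss d x"
    using continuous_attains_inf[OF compact_Icc _ c] assms by fastforce
  have "gauss d m * (b - a) = integral {a..b} (\<lambda>_. gauss d m)" using assms by simp
  also have "\<dots> \<le> integral {a..b} (gauss d)"
    by (rule integral_le) (use m gauss_integrable_interval in auto)
  finally have "gauss d m * (b - a) \<le> integral {a..b} (gauss d)" .
  moreover have "0 < gauss d m * (b - a)" using assms gauss_pos by simp
  ultimately show ?thesis by linarith
qed

lemma gauss_tail_split:
  assumes d: "d > 0" and ab: "a \<le> b"
  shows "integral {a..} (gauss d) = integral {a..b} (gauss d) + integral {b..} (gauss d)"
proof -
  have "{a..b} \<union> {b..} = {a..}" "{a..b} \<inter> {b..} = {b}" using ab by auto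
  then have "((gauss d) has_integral (integral {a..b} (gauss d) + integral {b..} (gauss d))) {a..}"
    using has_integral_Un[OF integrable_integral[OF gauss_integrable_interval[of d a b]] integrable_integral[OF gauss_integrable_tail[OF d, of b]]]
    by simp
  then show ?thesis by (rule integral_unique)
qed

lemma gauss_tail_pos:
  assumes d: "d > 0"
  shows "0 < integral {a..} (gauss d)"
proof -
  have "0 \<le> integral {a+1..} (gauss d)"
    by (rule integral_nonneg[OF gauss_integrable_tail[OF d]]) (use gauss_pos less_imp_le in blast)
  then show ?thesis using gauss_tail_split[OF d, of a "a + 1"] gauss_integral_pos[of a "a + 1" d] by simp
qed

lemma gauss_integral_has_derivative:
  assumes "0 < x"
  shows "((\<lambda>y. integral {0..y} (gauss d)) has_real_derivative gauss d x) (at x)"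
proof -
  have "((\<lambda>y. integral {0..y} (gauss d)) has_real_derivative gauss d x) (at x within {0..x+1})"
    by (rule integral_has_real_derivative[OF continuous_gauss]) (use assms in auto)
  then show ?thesis using assms at_within_interior[of x "{0..x+1}"] by simp
qed

lemma continuous_gauss_integral: "continuous_on {0..} (\<lambda>y. integral {0..y} (gauss d))"
proof -
  have "continuous (at x within {0..}) (\<lambda>y. integral {0..y} (gauss d))" if "0 \<le> x" for x
  proof -
    have "((\<lambda>y. integral {0..y} (gauss d)) has_real_derivative gauss d x) (at x within {0..x+1})"
      by (rule integral_has_real_derivative[OF continuous_gauss]) (use that in auto)
    then have "continuous (at x within {0..x+1}) (\<lambda>y. integral {0..y} (gauss d))"
      by (rule DERIV_continuous)
    moreover have "at x within {0..x+1} = at x within {0..}"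
      by (rule at_within_nhd[where S="{..<x+1}"]) auto
    ultimately show ?thesis by simp
  qed
  then show ?thesis by (simp add: continuous_on_eq_continuous_within)
qed

lemma gauss_tail_eq: "d > 0 \<Longrightarrow> 0 \<le> y \<Longrightarrow> integral {y..} (gauss d) = integral {0..} (gauss d) - integral {0..y} (gauss d)"
  using gauss_tail_split[of d 0 y] by simp

lemma gauss_tail_has_derivative:
  assumes d: "d > 0" and x: "0 < x"
  shows "((\<lambda>y. integral {y..} (gauss d)) has_real_derivative - gauss d x) (at x)"
proof -
  have "((\<lambda>y. integral {0..} (gauss d) - integral {0..y} (gauss d)) has_real_derivative 0 - gauss d x) (at x)"
    by (intro DERIV_diff DERIV_const gauss_integral_has_derivative x)
  then have "((\<lambda>y. integral {0..} (gauss d) - integral {0..y} (gauss d)) has_real_derivative - gauss d x) (at x)" by simp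
  then show ?thesis
  proof (rule has_field_derivative_transform_within_open[where S="{0<..}"])
    show "integral {0..} (gauss d) - integral {0..y} (gauss d) = integral {y..} (gauss d)" if "y \<in> {0<..}" for y
      using gauss_tail_eq[OF d, of y] that by simp
  qed (use x in auto)
qed

lemma continuous_gauss_tail: "d > 0 \<Longrightarrow> continuous_on {0..} (\<lambda>y. integral {y..} (gauss d))"
proof -
  assume d: "d > 0"
  have "continuous_on {0..} (\<lambda>y. integral {0..} (gauss d) - integral {0..y} (gauss d))"
    by (intro continuous_intros continuous_gauss_integral)
  then show ?thesis
  proof (rule continuous_on_eq)
    show "integral {0..} (gauss d) - integral {0..y} (gauss d) = integral {y..} (gauss d)" if "y \<in> {0..}" for y
      using gauss_tail_eq[OF d, of y] that by simp
  qed
qed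

lemma exp_uminus_tendsto: "((\<lambda>y::real. C * exp (- y)) \<longlongrightarrow> 0) at_top"
  by (intro tendsto_mult_right_zero filterlim_compose[OF exp_at_bot filterlim_uminus_at_bot_at_top])

lemma gauss_tendsto: "d > 0 \<Longrightarrow> (gauss d \<longlongrightarrow> 0) at_top"
  by (rule tendsto_sandwich[OF _ _ tendsto_const exp_uminus_tendsto[of "exp d"]])
     (simp_all add: always_eventually gauss_le_exp less_imp_le[OF gauss_pos])

lemma gauss_tail_tendsto:
  assumes d: "d > 0"
  shows "((\<lambda>y. integral {y..} (gauss d)) \<longlongrightarrow> 0) at_top"
proof (rule tendsto_sandwich[where f="\<lambda>_. 0" and h="\<lambda>y. exp d * exp (- y)"])
  show "eventually (\<lambda>y. 0 \<le> integral {y..} (gauss d)) at_top"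
    using gauss_tail_pos[OF d] less_imp_le by (intro always_eventually) blast
  show "eventually (\<lambda>y. integral {y..} (gauss d) \<le> exp d * exp (- y)) at_top"
  proof (intro always_eventually allI)
    fix y
    show "integral {y..} (gauss d) \<le> exp d * exp (- y)"
      by (rule has_integral_le[OF integrable_integral[OF gauss_integrable_tail[OF d]] exp_tail_has_integral])
         (rule gauss_le_exp[OF d])
  qed
qed (simp, rule exp_uminus_tendsto)

section \<open>The two sides of the interface equation as functions of its unknown\<close>

definition left_ratio :: "real \<Rightarrow> real \<Rightarrow> real" where
  "left_ratio d b = integral {0..b} (gauss d) / gauss d b"

text \<open>The Mills ratio of the Gaussian: dividing by \<open>gauss d b\<close> supplies the
  factor e^(b^2/(4d)) of the interface equation.\<close>

definition right_ratio :: "real \<Rightarrow> real \<Rightarrow> real" where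
  "right_ratio d b = integral {b..} (gauss d) / gauss d b"

lemma exp_quotient_gauss: "exp ((b\<^sup>2 - s\<^sup>2) / (4 * d)) = 1 / gauss d b * gauss d s"
proof -
  have "exp ((b\<^sup>2 - s\<^sup>2) / (4 * d)) = exp (b\<^sup>2 / (4 * d)) * exp (- (s\<^sup>2 / (4 * d)))"
    by (simp add: diff_divide_distrib flip: exp_add)
  also have "exp (b\<^sup>2 / (4 * d)) = 1 / gauss d b"
    by (simp add: gauss_def exp_minus inverse_eq_divide)
  finally show ?thesis by (simp add: gauss_def)
qed

lemma left_ratio_eq: "integral {0..b} (\<lambda>s. exp ((b\<^sup>2 - s\<^sup>2) / (4 * d))) = left_ratio d b"
  unfolding exp_quotient_gauss by (simp add: left_ratio_def)

lemma right_ratio_eq: "integral {b..} (\<lambda>s. exp ((b\<^sup>2 - s\<^sup>2) / (4 * d))) = right_ratio d b"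
  unfolding exp_quotient_gauss by (simp add: right_ratio_def)

lemma gauss_antimono: "d > 0 \<Longrightarrow> 0 \<le> x \<Longrightarrow> x \<le> y \<Longrightarrow> gauss d y \<le> gauss d x"
  by (simp add: gauss_def divide_right_mono power_mono)

text \<open>The numerator strictly increases with the endpoint while the denominator does not
  increase.\<close>

lemma left_ratio_strict_mono:
  assumes d: "d > 0" and xy: "0 \<le> x" "x < y"
  shows "left_ratio d x < left_ratio d y"
proof -
  have "integral {0..y} (gauss d) = integral {0..x} (gauss d) + integral {x..y} (gauss d)"
    using Henstock_Kurzweil_Integration.integral_combine[of 0 x y "gauss d"] gauss_integrable_interval xy by simp
  then have lt: "integral {0..x} (gauss d) < integral {0..y} (gauss d)"
    using gauss_integral_pos[OF xy(2), of d] by simp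
  have nn: "0 \<le> integral {0..x} (gauss d)"
    by (rule integral_nonneg[OF gauss_integrable_interval]) (use gauss_pos less_imp_le in blast)
  show ?thesis unfolding left_ratio_def
    using lt nn gauss_antimono[OF d xy(1) less_imp_le[OF xy(2)]] gauss_pos[of d y]
    by (intro frac_less) auto
qed

text \<open>On [0, b] the Gaussian is at least its value at \<open>b\<close>. This linear lower
  bound forces the change of sign in both root equations.\<close>

lemma left_ratio_ge:
  assumes d: "d > 0" and b: "0 \<le> b"
  shows "b \<le> left_ratio d b"
proof -
  have "b * gauss d b = integral {0..b} (\<lambda>_. gauss d b)" using b by simp
  also have "\<dots> \<le> integral {0..b} (gauss d)"
    by (rule integral_le) (use gauss_integrable_interval gauss_antimono[OF d] in auto)
  finally show ?thesis unfolding left_ratio_def using gauss_pos[of d b] by (simp add: field_simps)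
qed

lemma continuous_left_ratio: "continuous_on {0..} (left_ratio d)"
  unfolding left_ratio_def
  by (intro continuous_on_divide continuous_gauss_integral continuous_gauss ballI)
     (metis gauss_pos less_irrefl)

lemma continuous_right_ratio: "d > 0 \<Longrightarrow> continuous_on {0..} (right_ratio d)"
  unfolding right_ratio_def
  by (intro continuous_on_divide continuous_gauss_tail continuous_gauss ballI)
     (assumption, metis gauss_pos less_irrefl)

lemma gauss_has_derivative: "d > 0 \<Longrightarrow> (gauss d has_real_derivative - (b / (2 * d)) * gauss d b) (at b)"
proof -
  assume d: "d > 0"
  have "((\<lambda>s. - (s\<^sup>2 / (4 * d))) has_real_derivative - (2 * b / (4 * d))) (at b)"
    using d by (auto intro!: derivative_eq_intros)
  then have "((\<lambda>s. exp (- (s\<^sup>2 / (4 * d)))) has_real_derivative exp (- (b\<^sup>2 / (4 * d))) * - (2 * b / (4 * d))) (at b)"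
    by (rule DERIV_chain2[OF DERIV_exp])
  then show ?thesis using d by (simp add: gauss_def[abs_def] mult.commute)
qed

text \<open>The classical bound for the Mills ratio. With the factor \<open>b\<close> frozen,
  \<open>h\<close> has derivative - (y - b) gauss(y), which is nonpositive for
  \<open>b \<le> y\<close>, and tends to 0 at infinity; hence \<open>h b\<close> is
  nonnegative.\<close>

lemma gauss_tail_bound:
  assumes d: "d > 0" and b: "0 < b"
  shows "b * integral {b..} (gauss d) \<le> 2 * d * gauss d b"
proof -
  define h where "h y = 2 * d * gauss d y - b * integral {y..} (gauss d)" for y
  have "h y \<le> h b" if "b \<le> y" for y
  proof (rule DERIV_nonpos_imp_nonincreasing[OF that])
    fix s assume s: "b \<le> s" "s \<le> y"
    have "(h has_real_derivative 2 * d * (- (s / (2 * d)) * gauss d s) - b * (- gauss d s)) (at s)"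
      unfolding h_def using s b by (intro DERIV_diff DERIV_cmult gauss_has_derivative gauss_tail_has_derivative d) auto
    moreover have "2 * d * (- (s / (2 * d)) * gauss d s) - b * (- gauss d s) = - ((s - b) * gauss d s)"
      using d by (simp add: field_simps)
    moreover have "0 \<le> (s - b) * gauss d s" using s gauss_pos[of d s] by simp
    ultimately show "\<exists>D. (h has_real_derivative D) (at s) \<and> D \<le> 0" by auto
  qed
  moreover have "(h \<longlongrightarrow> 2 * d * 0 - b * 0) at_top"
    unfolding h_def by (intro tendsto_intros gauss_tendsto gauss_tail_tendsto d)
  ultimately have "0 \<le> h b"
    using tendsto_upperbound[of h 0 at_top "h b"] by (auto simp: eventually_at_top_linorder)
  then show ?thesis by (simp add: h_def)
qed

text \<open>For the tail \<open>I\<close> and the density \<open>q\<close> at \<open>b\<close>, the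
  derivative of the ratio is - 1 + b I / (2 d q), nonpositive by
  \<open>gauss_tail_bound\<close>.\<close>

lemma right_ratio_antimono:
  assumes d: "d > 0" and xy: "0 < x" "x \<le> y"
  shows "right_ratio d y \<le> right_ratio d x"
proof (rule DERIV_nonpos_imp_nonincreasing[OF xy(2)])
  fix b assume "x \<le> b" "b \<le> y"
  then have b: "0 < b" using xy by linarith
  define I where "I = integral {b..} (gauss d)"
  define q where "q = gauss d b"
  have q: "q > 0" using gauss_pos by (simp add: q_def)
  have "(right_ratio d has_real_derivative (- q * q - I * (- (b / (2 * d)) * q)) / (q * q)) (at b)"
    unfolding right_ratio_def I_def q_def
    using gauss_pos[of d b] by (intro DERIV_divide gauss_tail_has_derivative gauss_has_derivative d b) auto
  moreover have "(- q * q - I * (- (b / (2 * d)) * q)) / (q * q) \<le> 0"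
  proof -
    have "I * (b / (2 * d)) \<le> q" using gauss_tail_bound[OF d b] d by (simp add: I_def q_def field_simps)
    then have "I * (b / (2 * d)) * q \<le> q * q" using q by (intro mult_right_mono) auto
    then show ?thesis using q by (simp add: divide_nonpos_pos)
  qed
  ultimately show "\<exists>D. (right_ratio d has_real_derivative D) (at b) \<and> D \<le> 0" by blast
qed

text \<open>Intermediate values on [0, b] give a root, and the strict sign at 0 makes it positive.
  Monotonicity is asked for x > 0, the range of \<open>right_ratio_antimono\<close>.\<close>

lemma unique_root:
  fixes \<Phi> :: "real \<Rightarrow> real"
  assumes c: "continuous_on {0..} \<Phi>" and mono: "\<And>x y. 0 < x \<Longrightarrow> x < y \<Longrightarrow> \<Phi> x < \<Phi> y"
    and neg: "\<Phi> 0 < 0" and pos: "0 < b" "0 \<le> \<Phi> b"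
  obtains a where "0 < a" "\<And>x. 0 < x \<Longrightarrow> \<Phi> x = 0 \<longleftrightarrow> x = a"
proof -
  obtain a where a: "0 \<le> a" "\<Phi> a = 0"
    using IVT'[of \<Phi> 0 0 b] neg pos continuous_on_subset[OF c, of "{0..b}"] by auto
  have "a \<noteq> 0" using a neg by auto
  then have a0: "0 < a" using a by simp
  moreover have "\<Phi> x = 0 \<longleftrightarrow> x = a" if "0 < x" for x
    using mono[OF that, of a] mono[OF a0, of x] a(2) by (cases x a rule: linorder_cases) auto
  ultimately show ?thesis by (rule that)
qed

lemma diff_less_le_mono:
  fixes a b c d :: real
  shows "a < b \<Longrightarrow> d \<le> c \<Longrightarrow> a - c < b - d"
  by simp

lemma stefan_root:
  assumes d: "d\<^sub>u > 0" "d\<^sub>v > 0" and UV: "U > 0" "V > 0"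
  obtains a where "0 < a" "\<And>b. 0 < b \<Longrightarrow> d\<^sub>u * U * right_ratio d\<^sub>v b = d\<^sub>v * V * left_ratio d\<^sub>u b \<longleftrightarrow> b = a"
proof -
  define \<Phi> where "\<Phi> b = d\<^sub>v * V * left_ratio d\<^sub>u b - d\<^sub>u * U * right_ratio d\<^sub>v b" for b
  \<comment> \<open>For b \<ge> 1 the Mills ratio is at most its value at 1 and
    \<open>left_ratio\<close> is at least b, so \<open>\<Phi>\<close> is nonnegative once
    \<open>d\<^sub>v * V * b\<close> reaches
    \<open>d\<^sub>u * U * right_ratio d\<^sub>v 1\<close>.\<close>
  define b where "b = max 1 (d\<^sub>u * U * right_ratio d\<^sub>v 1 / (d\<^sub>v * V))"
  have b: "1 \<le> b" "d\<^sub>u * U * right_ratio d\<^sub>v 1 / (d\<^sub>v * V) \<le> b" by (auto simp: b_def)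
  have dV: "0 < d\<^sub>v * V" "0 < d\<^sub>u * U" using d UV by auto
  obtain a where a: "0 < a" "\<And>x. 0 < x \<Longrightarrow> \<Phi> x = 0 \<longleftrightarrow> x = a"
  proof (rule unique_root[of \<Phi> b])
    show "continuous_on {0..} \<Phi>" unfolding \<Phi>_def
      by (intro continuous_intros continuous_left_ratio continuous_right_ratio d)
    show "\<Phi> x < \<Phi> y" if "0 < x" "x < y" for x y
      unfolding \<Phi>_def using left_ratio_strict_mono[OF d(1), of x y] right_ratio_antimono[OF d(2), of x y] that dV
      by (intro diff_less_le_mono mult_strict_left_mono mult_left_mono) auto
    show "\<Phi> 0 < 0" using dV gauss_tail_pos[OF d(2), of 0] gauss_pos[of d\<^sub>v 0]
      by (simp add: \<Phi>_def left_ratio_def right_ratio_def)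
    have "d\<^sub>u * U * right_ratio d\<^sub>v b \<le> d\<^sub>u * U * right_ratio d\<^sub>v 1"
      using right_ratio_antimono[OF d(2), of 1 b] b dV by (intro mult_left_mono) auto
    also have "\<dots> \<le> d\<^sub>v * V * b" using b(2) dV by (simp add: pos_divide_le_eq mult.commute)
    also have "\<dots> \<le> d\<^sub>v * V * left_ratio d\<^sub>u b"
      using left_ratio_ge[OF d(1), of b] b dV by (intro mult_left_mono) auto
    finally show "0 \<le> \<Phi> b" by (simp add: \<Phi>_def)
  qed (use b in auto)
  have "d\<^sub>u * U * right_ratio d\<^sub>v b = d\<^sub>v * V * left_ratio d\<^sub>u b \<longleftrightarrow> \<Phi> b = 0" for b
    by (auto simp: \<Phi>_def)
  then show ?thesis using a by (intro that[of a]) metis+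
qed

lemma stefan_root_degenerate:
  assumes d: "d\<^sub>u > 0" and UV: "U > 0" "V > 0"
  obtains a where "0 < a" "\<And>b. 0 < b \<Longrightarrow> U = V * b / (2 * d\<^sub>u) * left_ratio d\<^sub>u b \<longleftrightarrow> b = a"
proof -
  define \<Phi> where "\<Phi> b = V * b / (2 * d\<^sub>u) * left_ratio d\<^sub>u b - U" for b
  \<comment> \<open>As \<open>left_ratio\<close> is at least b \<ge> 1, it is enough that
    \<open>V * b / (2 * d\<^sub>u)\<close> reaches \<open>U\<close>.\<close>
  define b where "b = max 1 (U * (2 * d\<^sub>u) / V)"
  have b: "1 \<le> b" "U * (2 * d\<^sub>u) / V \<le> b" by (auto simp: b_def)
  obtain a where a: "0 < a" "\<And>x. 0 < x \<Longrightarrow> \<Phi> x = 0 \<longleftrightarrow> x = a"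
  proof (rule unique_root[of \<Phi> b])
    show "continuous_on {0..} \<Phi>" unfolding \<Phi>_def
      using d by (intro continuous_intros continuous_left_ratio) auto
    show "\<Phi> x < \<Phi> y" if xy: "0 < x" "x < y" for x y
    proof -
      have "V * x / (2 * d\<^sub>u) * left_ratio d\<^sub>u x < V * y / (2 * d\<^sub>u) * left_ratio d\<^sub>u y"
        using left_ratio_strict_mono[OF d, of x y] left_ratio_ge[OF d, of x] xy UV d
        by (intro mult_strict_mono divide_strict_right_mono mult_strict_left_mono) auto
      then show ?thesis by (simp add: \<Phi>_def)
    qed
    show "\<Phi> 0 < 0" using UV by (simp add: \<Phi>_def)
    have "U \<le> V * b / (2 * d\<^sub>u) * 1" using b(2) d UV by (simp add: field_simps)
    also have "\<dots> \<le> V * b / (2 * d\<^sub>u) * left_ratio d\<^sub>u b"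
      using left_ratio_ge[OF d, of b] b d UV by (intro mult_left_mono) auto
    finally show "0 \<le> \<Phi> b" by (simp add: \<Phi>_def)
  qed (use b in auto)
  have "U = V * b / (2 * d\<^sub>u) * left_ratio d\<^sub>u b \<longleftrightarrow> \<Phi> b = 0" for b
    unfolding \<Phi>_def by linarith
  then show ?thesis using a by (intro that[of a]) metis+
qed

section \<open>The profile and the free boundary\<close>

definition inner_profile :: "real \<Rightarrow> real \<Rightarrow> real \<Rightarrow> real \<Rightarrow> real" where
  "inner_profile d U a \<eta> = U * (1 - integral {0..\<eta>} (gauss d) / integral {0..a} (gauss d))"

definition outer_profile :: "real \<Rightarrow> real \<Rightarrow> real \<Rightarrow> real \<Rightarrow> real" where
  "outer_profile d V a \<eta> = - V * (1 - integral {\<eta>..} (gauss d) / integral {a..} (gauss d))"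

lemma continuous_inner_profile: "continuous_on {0..} (inner_profile d U a)"
  unfolding inner_profile_def divide_inverse
  by (intro continuous_intros continuous_gauss_integral)

lemma inner_profile_has_derivative:
  assumes "0 < \<eta>"
  shows "(inner_profile d U a has_real_derivative - (U * gauss d \<eta> / integral {0..a} (gauss d))) (at \<eta>)"
proof -
  have "(inner_profile d U a has_real_derivative U * (0 - gauss d \<eta> / integral {0..a} (gauss d))) (at \<eta>)"
    unfolding inner_profile_def
    by (intro DERIV_cmult DERIV_diff DERIV_const DERIV_cdivide gauss_integral_has_derivative assms)
  then show ?thesis by simp
qed

lemma gauss_integral_nonneg: "0 \<le> integral {x..y} (gauss d)"
  by (rule integral_nonneg[OF gauss_integrable_interval]) (simp add: gauss_pos less_imp_le)

text \<open>For negative \<eta> the integral over the empty interval is 0 and the profile equals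
  \<open>U\<close>, so the first two bounds cover the whole half-line
  \<open>\<eta> \<le> a\<close>.\<close>

lemma inner_profile_bounds:
  assumes a: "0 < a" and U: "0 < U" and \<eta>: "\<eta> \<le> a"
  shows "0 \<le> inner_profile d U a \<eta>" "inner_profile d U a \<eta> \<le> U" "0 \<le> \<eta> \<Longrightarrow> \<eta> < a \<Longrightarrow> 0 < inner_profile d U a \<eta>"
proof -
  have La: "0 < integral {0..a} (gauss d)" by (rule gauss_integral_pos[OF a])
  have sp: "integral {0..a} (gauss d) = integral {0..\<eta>} (gauss d) + integral {\<eta>..a} (gauss d)" if "0 \<le> \<eta>"
    using Henstock_Kurzweil_Integration.integral_combine[of 0 \<eta> a "gauss d"] gauss_integrable_interval \<eta> that by simp
  have le: "integral {0..\<eta>} (gauss d) \<le> integral {0..a} (gauss d)"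
    using sp gauss_integral_nonneg[of \<eta> a d] La by (cases "0 \<le> \<eta>") auto
  have q: "integral {0..\<eta>} (gauss d) / integral {0..a} (gauss d) \<le> 1" "0 \<le> integral {0..\<eta>} (gauss d) / integral {0..a} (gauss d)"
    using La le gauss_integral_nonneg[of 0 \<eta> d] by simp_all
  show "0 \<le> inner_profile d U a \<eta>" unfolding inner_profile_def using q U by simp
  show "inner_profile d U a \<eta> \<le> U" unfolding inner_profile_def using q U by simp
  assume h: "0 \<le> \<eta>" "\<eta> < a"
  then have "integral {0..\<eta>} (gauss d) / integral {0..a} (gauss d) < 1"
    using sp gauss_integral_pos[OF h(2), of d] La by simp
  then show "0 < inner_profile d U a \<eta>" unfolding inner_profile_def using U by simp
qed

lemma outer_profile_bounds:
  assumes d: "d > 0" and V: "0 < V" and \<eta>: "a < \<eta>"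
  shows "- V \<le> outer_profile d V a \<eta>" "outer_profile d V a \<eta> < 0"
proof -
  have T: "0 < integral {a..} (gauss d)" "0 < integral {\<eta>..} (gauss d)" by (rule gauss_tail_pos[OF d])+
  have "integral {\<eta>..} (gauss d) < integral {a..} (gauss d)"
    using gauss_tail_split[OF d less_imp_le[OF \<eta>]] gauss_integral_pos[OF \<eta>, of d] by simp
  then have q: "integral {\<eta>..} (gauss d) / integral {a..} (gauss d) < 1" "0 < integral {\<eta>..} (gauss d) / integral {a..} (gauss d)"
    using T by simp_all
  have "V * (1 - integral {\<eta>..} (gauss d) / integral {a..} (gauss d)) \<le> V * 1" using q V by (intro mult_left_mono) auto
  then show "- V \<le> outer_profile d V a \<eta>" by (simp add: outer_profile_def)
  have "0 < V * (1 - integral {\<eta>..} (gauss d) / integral {a..} (gauss d))" using q V by simp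
  then show "outer_profile d V a \<eta> < 0" by (simp add: outer_profile_def)
qed

lemma outer_profile_has_derivative:
  assumes "d > 0" "0 < \<eta>"
  shows "(outer_profile d V a has_real_derivative - (V * gauss d \<eta> / integral {a..} (gauss d))) (at \<eta>)"
proof -
  have "(outer_profile d V a has_real_derivative - V * (0 - - gauss d \<eta> / integral {a..} (gauss d))) (at \<eta>)"
    unfolding outer_profile_def
    by (intro DERIV_cmult DERIV_diff DERIV_const DERIV_cdivide gauss_tail_has_derivative assms)
  then show ?thesis by simp
qed

text \<open>The flux condition \<open>match\<close> says that \<open>D(f)' + \<eta> f / 2\<close> is continuous at the interface; for
  \<open>d\<^sub>v = 0\<close> the jump of \<open>f\<close> enters it (Rankine--Hugoniot).\<close>

lemma glued_profile_weak_solution: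
  fixes r q :: "real \<Rightarrow> real"
  assumes d: "d\<^sub>u > 0" "d\<^sub>v \<ge> 0" and UV: "U\<^sub>0 > 0" "V\<^sub>0 > 0" and a: "0 < a"
    and rm: "continuous_on {a..} r" and rb: "\<And>\<eta>. a < \<eta> \<Longrightarrow> - V\<^sub>0 \<le> r \<eta> \<and> r \<eta> \<le> 0"
    and ra: "d\<^sub>v * r a = 0"
    and dr: "\<And>\<eta>. a < \<eta> \<Longrightarrow> ((\<lambda>\<eta>. d\<^sub>v * r \<eta>) has_real_derivative q \<eta>) (at \<eta>)"
    and qc: "continuous_on {a..} q"
    and dq: "\<And>\<eta>. a < \<eta> \<Longrightarrow> ((\<lambda>\<eta>. q \<eta> + \<eta> * r \<eta> / 2) has_real_derivative r \<eta> / 2) (at \<eta>)"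
    and match: "- (d\<^sub>u * U\<^sub>0 * gauss d\<^sub>u a / integral {0..a} (gauss d\<^sub>u)) = q a + a * r a / 2"
    and rlim: "(r \<longlongrightarrow> - V\<^sub>0) at_top"
  shows "weak_solution d\<^sub>u d\<^sub>v U\<^sub>0 V\<^sub>0 (\<lambda>x t. (\<lambda>\<eta>. if \<eta> \<le> a then inner_profile d\<^sub>u U\<^sub>0 a \<eta> else r \<eta>) (x / sqrt t))"
proof -
  let ?l = "inner_profile d\<^sub>u U\<^sub>0 a"
  define f where "f \<eta> = (if \<eta> \<le> a then ?l \<eta> else r \<eta>)" for \<eta>
  define L where "L = integral {0..a} (gauss d\<^sub>u)"
  have L: "0 < L" unfolding L_def by (rule gauss_integral_pos[OF a])
  define pl where "pl \<eta> = - (d\<^sub>u * U\<^sub>0 * gauss d\<^sub>u \<eta> / L)" for \<eta>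
  define p where "p \<eta> = (if \<eta> \<le> a then pl \<eta> else q \<eta>)" for \<eta>
  define G where "G \<eta> = (if \<eta> \<le> a then pl \<eta> + \<eta> * ?l \<eta> / 2 else q \<eta> + \<eta> * r \<eta> / 2)" for \<eta>
  have la: "?l a = 0" using L by (simp add: inner_profile_def L_def)
  \<comment> \<open>The sign of \<open>f\<close> on each side of \<open>a\<close> selects the branch
    of the diffusion function; where \<open>r\<close> is 0 both branches give 0.\<close>
  have g: "diffusion d\<^sub>u d\<^sub>v (f \<eta>) = (if \<eta> \<le> a then d\<^sub>u * ?l \<eta> else d\<^sub>v * r \<eta>)" for \<eta>
    using inner_profile_bounds(1)[OF a UV(1), of \<eta> d\<^sub>u] rb[of \<eta>]
    by (cases "r \<eta> = 0") (auto simp: f_def diffusion_def)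
  have dl: "(?l has_real_derivative - (U\<^sub>0 * gauss d\<^sub>u \<eta> / L)) (at \<eta>)" if "0 < \<eta>" for \<eta>
    unfolding L_def by (rule inner_profile_has_derivative[OF that])
  have "weak_solution d\<^sub>u d\<^sub>v U\<^sub>0 V\<^sub>0 (\<lambda>x t. f (x / sqrt t))"
  proof (rule self_similar_weak_solution[OF d, where p=p and G=G and a=a and M="max U\<^sub>0 V\<^sub>0"])
    show "f \<in> borel_measurable borel"
    proof -
      \<comment> \<open>Clamping the argument makes each piece continuous on the whole line; it does
        not alter \<open>?l\<close>, which is constant on the negative axis.\<close>
      have "(\<lambda>\<eta>. ?l (max 0 \<eta>)) \<in> borel_measurable borel" "(\<lambda>\<eta>. r (max a \<eta>)) \<in> borel_measurable borel"
        by (intro borel_measurable_continuous_onI continuous_on_compose2[OF continuous_inner_profile]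
            continuous_on_compose2[OF rm] continuous_intros; auto)+
      then have "(\<lambda>\<eta>. if \<eta> \<le> a then ?l (max 0 \<eta>) else r (max a \<eta>)) \<in> borel_measurable borel" by measurable
      also have "(\<lambda>\<eta>. if \<eta> \<le> a then ?l (max 0 \<eta>) else r (max a \<eta>)) = f"
      proof
        fix \<eta>
        show "(if \<eta> \<le> a then ?l (max 0 \<eta>) else r (max a \<eta>)) = f \<eta>"
          by (cases "0 \<le> \<eta>") (auto simp: f_def inner_profile_def max_def)
      qed
      finally show ?thesis .
    qed
    show "\<bar>f \<eta>\<bar> \<le> max U\<^sub>0 V\<^sub>0" for \<eta>
      using inner_profile_bounds(1,2)[OF a UV(1), of \<eta> d\<^sub>u] rb[of \<eta>] by (auto simp: f_def)
    show "continuous_on {0..} (\<lambda>\<eta>. diffusion d\<^sub>u d\<^sub>v (f \<eta>))"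
      unfolding g
    proof (rule continuous_on_cases_le[where h="\<lambda>\<eta>. \<eta>"])
      show "continuous_on {t \<in> {0..}. t \<le> a} (\<lambda>\<eta>. d\<^sub>u * ?l \<eta>)"
        by (intro continuous_intros continuous_on_subset[OF continuous_inner_profile]) auto
      show "continuous_on {t \<in> {0..}. a \<le> t} (\<lambda>\<eta>. d\<^sub>v * r \<eta>)"
        by (intro continuous_intros continuous_on_subset[OF rm]) auto
    qed (use la ra in \<open>auto intro: continuous_intros\<close>)
    show "continuous_on {0..} G"
      unfolding G_def
    proof (rule continuous_on_cases_le[where h="\<lambda>\<eta>. \<eta>"])
      show "continuous_on {t \<in> {0..}. t \<le> a} (\<lambda>\<eta>. pl \<eta> + \<eta> * ?l \<eta> / 2)"
        unfolding pl_def divide_inverse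
        by (intro continuous_intros continuous_gauss continuous_on_subset[OF continuous_inner_profile]) auto
      show "continuous_on {t \<in> {0..}. a \<le> t} (\<lambda>\<eta>. q \<eta> + \<eta> * r \<eta> / 2)"
        unfolding divide_inverse
        by (intro continuous_intros continuous_on_subset[OF rm] continuous_on_subset[OF qc]) auto
      show "pl t + t * ?l t / 2 = q t + t * r t / 2" if "t \<in> {0..}" "t = a" for t
        unfolding that(2) using match la by (simp add: pl_def L_def)
    qed (auto intro: continuous_intros)
    show "((\<lambda>\<eta>. diffusion d\<^sub>u d\<^sub>v (f \<eta>)) has_real_derivative p \<eta>) (at \<eta>)" if \<eta>: "0 < \<eta>" "\<eta> \<noteq> a" for \<eta>
    proof (cases "\<eta> < a")
      case True
      have "((\<lambda>\<eta>. d\<^sub>u * ?l \<eta>) has_real_derivative d\<^sub>u * - (U\<^sub>0 * gauss d\<^sub>u \<eta> / L)) (at \<eta>)"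
        by (intro DERIV_cmult dl \<eta>)
      then have "((\<lambda>\<eta>. d\<^sub>u * ?l \<eta>) has_real_derivative p \<eta>) (at \<eta>)" using True by (simp add: p_def pl_def mult.assoc)
      then show ?thesis
        by (rule has_field_derivative_transform_within_open[where S="{0<..<a}"]) (use True \<eta> in \<open>auto simp: g\<close>)
    next
      case False
      then have gt: "a < \<eta>" using \<eta> by simp
      then have "((\<lambda>\<eta>. d\<^sub>v * r \<eta>) has_real_derivative p \<eta>) (at \<eta>)" using dr[OF gt] by (simp add: p_def)
      then show ?thesis
        by (rule has_field_derivative_transform_within_open[where S="{a<..}"]) (use gt in \<open>auto simp: g\<close>)
    qed
    show "(G has_real_derivative f \<eta> / 2) (at \<eta>)" if \<eta>: "0 < \<eta>" "\<eta> \<noteq> a" for \<eta>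
    proof (cases "\<eta> < a")
      case True
      \<comment> \<open>The Gaussian solves the profile equation: its derivative cancels the term
        \<eta> f' / 2, and f / 2 is left.\<close>
      have "((\<lambda>\<eta>. - (d\<^sub>u * U\<^sub>0 / L * gauss d\<^sub>u \<eta>) + \<eta> * ?l \<eta> / 2) has_real_derivative
          - (d\<^sub>u * U\<^sub>0 / L * (- (\<eta> / (2 * d\<^sub>u)) * gauss d\<^sub>u \<eta>)) + (1 * ?l \<eta> + - (U\<^sub>0 * gauss d\<^sub>u \<eta> / L) * \<eta>) / 2) (at \<eta>)"
        by (intro DERIV_add DERIV_minus DERIV_cmult gauss_has_derivative d DERIV_cdivide DERIV_mult DERIV_ident dl \<eta>)
      also have "- (d\<^sub>u * U\<^sub>0 / L * (- (\<eta> / (2 * d\<^sub>u)) * gauss d\<^sub>u \<eta>)) + (1 * ?l \<eta> + - (U\<^sub>0 * gauss d\<^sub>u \<eta> / L) * \<eta>) / 2 = ?l \<eta> / 2"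
        using d L by (simp add: field_simps)
      also have "?l \<eta> = f \<eta>" using True by (simp add: f_def)
      finally have "((\<lambda>\<eta>. - (d\<^sub>u * U\<^sub>0 / L * gauss d\<^sub>u \<eta>) + \<eta> * ?l \<eta> / 2) has_real_derivative f \<eta> / 2) (at \<eta>)" .
      then show ?thesis
        by (rule has_field_derivative_transform_within_open[where S="{0<..<a}"]) (use True \<eta> in \<open>auto simp: G_def pl_def\<close>)
    next
      case False
      then have gt: "a < \<eta>" using \<eta> by simp
      then have "((\<lambda>\<eta>. q \<eta> + \<eta> * r \<eta> / 2) has_real_derivative f \<eta> / 2) (at \<eta>)" using dq[OF gt] by (simp add: f_def)
      then show ?thesis
        by (rule has_field_derivative_transform_within_open[where S="{a<..}"]) (use gt in \<open>auto simp: G_def\<close>)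
    qed
    show "G \<eta> = p \<eta> + \<eta> * f \<eta> / 2" for \<eta> by (simp add: G_def p_def f_def)
    show "diffusion d\<^sub>u d\<^sub>v (f 0) = d\<^sub>u * U\<^sub>0" unfolding g using a by (simp add: inner_profile_def)
    show "(f \<longlongrightarrow> - V\<^sub>0) at_top"
    proof (rule Lim_transform_eventually[OF rlim])
      show "eventually (\<lambda>\<eta>. r \<eta> = f \<eta>) at_top"
        using eventually_gt_at_top[of a] by eventually_elim (simp add: f_def)
    qed
  qed
  then show ?thesis by (simp add: f_def[abs_def])
qed

text \<open>Otherwise continuity gives an open box inside the strip lying between the two curves
  near \<open>t0\<close>, and such a box is not null. The maximum with 0 is due to the strip
  containing only points with x > 0.\<close>

lemma strip_gap_empty:
  fixes \<alpha> \<beta> :: "real \<Rightarrow> real"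
  assumes ae: "AE (x, t) in lebesgue_on (strip T). \<not> (\<alpha> t < x \<and> x < \<beta> t)"
    and c: "isCont \<alpha> t0" "isCont \<beta> t0" and t0: "0 < t0" "t0 < T"
  shows "\<beta> t0 \<le> max (\<alpha> t0) 0"
proof (rule ccontr)
  assume "\<not> \<beta> t0 \<le> max (\<alpha> t0) 0"
  define l where "l = max (\<alpha> t0) 0"
  have lt: "l < \<beta> t0" "0 \<le> l" "\<alpha> t0 \<le> l" using \<open>\<not> \<beta> t0 \<le> max (\<alpha> t0) 0\<close> by (auto simp: l_def)
  \<comment> \<open>\<open>u\<close> and \<open>v\<close> divide the gap between \<open>l\<close>
    and \<open>\<beta> t0\<close> into thirds, leaving a margin for continuity on both
    sides.\<close>
  define u where "u = (2 * l + \<beta> t0) / 3"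
  define v where "v = (l + 2 * \<beta> t0) / 3"
  have uv: "0 < u" "u < v" "\<alpha> t0 < u" "v < \<beta> t0" using lt by (auto simp: u_def v_def)
  have "eventually (\<lambda>t. \<alpha> t < u) (nhds t0)" "eventually (\<lambda>t. v < \<beta> t) (nhds t0)"
    using c uv by (auto simp: isCont_def tendsto_at_iff_tendsto_nhds intro: order_tendstoD)
  then have "eventually (\<lambda>t. \<alpha> t < u \<and> v < \<beta> t) (nhds t0)" by (rule eventually_conj)
  then obtain W where W: "open W" "t0 \<in> W" "\<And>t. t \<in> W \<Longrightarrow> \<alpha> t < u \<and> v < \<beta> t"
    unfolding eventually_nhds by blast
  define S where "S = {u<..<v} \<times> (W \<inter> {0<..<T})"
  have "open S" unfolding S_def by (intro open_Times open_Int W open_greaterThanLessThan)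
  moreover have "((u + v) / 2, t0) \<in> S" using uv W t0 by (simp add: S_def)
  ultimately have "\<not> negligible S" by (intro open_not_negligible) auto
  note ss = strip_in_sets_lebesgue[of T]
  have "AE p in lebesgue. p \<in> strip T \<longrightarrow> \<not> (\<alpha> (snd p) < fst p \<and> fst p < \<beta> (snd p))"
    using ae ss by (subst (asm) AE_restrict_space_iff) (auto simp: case_prod_beta')
  then have "AE p in lebesgue. p \<notin> S"
  proof eventually_elim
    case (elim p)
    show ?case
    proof
      assume "p \<in> S"
      then have "p \<in> strip T" "\<alpha> (snd p) < fst p" "fst p < \<beta> (snd p)"
        using W(3)[of "snd p"] uv by (auto simp: S_def strip_def)
      then show False using elim by blast
    qed
  qed
  then have "S \<in> null_sets lebesgue"
    using \<open>open S\<close> by (subst AE_iff_null_sets) (auto intro: sets_completionI_sets)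
  then show False using \<open>\<not> negligible S\<close> by (simp add: negligible_iff_null_sets)
qed

text \<open>Between \<open>\<xi>\<close> and the curve a sqrt t the two sign conditions would make
  \<open>w\<close> positive and negative at once, so \<open>strip_gap_empty\<close> applies with the
  curves in either order. Since a sqrt t is positive for t > 0, the maximum with 0 there still gives
  equality; the end times follow by continuity.\<close>

lemma free_boundary_self_similar:
  assumes T: "0 < T" and a: "0 < a"
    and pos: "\<And>\<eta>. 0 < \<eta> \<Longrightarrow> \<eta> < a \<Longrightarrow> 0 < f \<eta>" and neg: "\<And>\<eta>. a < \<eta> \<Longrightarrow> f \<eta> < 0"
    and w: "AE (x, t) in lebesgue_on (strip T). w x t = f (x / sqrt t)"
  shows "free_boundary T w \<xi> \<longleftrightarrow> (\<forall>t\<in>{0..T}. \<xi> t = a * sqrt t)"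
proof
  note ss = strip_in_sets_lebesgue[of T]
  have w': "AE p in lebesgue. p \<in> strip T \<longrightarrow> w (fst p) (snd p) = f (fst p / sqrt (snd p))"
    using w ss by (subst (asm) AE_restrict_space_iff) (auto simp: case_prod_beta')
  have c: "continuous_on {0..T} (\<lambda>t. a * sqrt t)" by (intro continuous_intros)
  {
    assume \<xi>: "\<forall>t\<in>{0..T}. \<xi> t = a * sqrt t"
    have "AE p in lebesgue. p \<in> strip T \<longrightarrow> (fst p < \<xi> (snd p) \<longrightarrow> 0 < w (fst p) (snd p)) \<and> (\<xi> (snd p) < fst p \<longrightarrow> w (fst p) (snd p) < 0)"
      using w'
    proof eventually_elim
      case (elim p)
      show ?case
      proof
        assume p: "p \<in> strip T"
        then have "0 < fst p" "0 < snd p" "snd p < T" by (auto simp: strip_def)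
        then have "\<xi> (snd p) = a * sqrt (snd p)" "0 < fst p / sqrt (snd p)"
          "fst p < a * sqrt (snd p) \<longleftrightarrow> fst p / sqrt (snd p) < a" "a * sqrt (snd p) < fst p \<longleftrightarrow> a < fst p / sqrt (snd p)"
          using \<xi> by (auto simp: pos_divide_less_eq pos_less_divide_eq)
        then show "(fst p < \<xi> (snd p) \<longrightarrow> 0 < w (fst p) (snd p)) \<and> (\<xi> (snd p) < fst p \<longrightarrow> w (fst p) (snd p) < 0)"
          using elim p pos neg by simp
      qed
    qed
    then show "free_boundary T w \<xi>"
      unfolding free_boundary_def using ss \<xi> continuous_on_cong[of "{0..T}" "{0..T}" \<xi> "\<lambda>t. a * sqrt t"] c
      by (subst AE_restrict_space_iff) (auto simp: case_prod_beta')
  next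
    assume fb: "free_boundary T w \<xi>"
    then have \<xi>c: "continuous_on {0..T} \<xi>"
      and ae: "AE p in lebesgue. p \<in> strip T \<longrightarrow> (fst p < \<xi> (snd p) \<longrightarrow> 0 < w (fst p) (snd p)) \<and> (\<xi> (snd p) < fst p \<longrightarrow> w (fst p) (snd p) < 0)"
      unfolding free_boundary_def using ss by (auto simp: case_prod_beta' AE_restrict_space_iff)
    have ae1: "AE p in lebesgue. p \<in> strip T \<longrightarrow> \<not> (a * sqrt (snd p) < fst p \<and> fst p < \<xi> (snd p)) \<and> \<not> (\<xi> (snd p) < fst p \<and> fst p < a * sqrt (snd p))"
      using w' ae
    proof eventually_elim
      case (elim p)
      show ?case
      proof
        assume p: "p \<in> strip T"
        then have "0 < fst p" "0 < snd p" by (auto simp: strip_def)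
        then have e: "0 < fst p / sqrt (snd p)"
          "fst p < a * sqrt (snd p) \<longleftrightarrow> fst p / sqrt (snd p) < a" "a * sqrt (snd p) < fst p \<longleftrightarrow> a < fst p / sqrt (snd p)"
          by (auto simp: pos_divide_less_eq pos_less_divide_eq)
        show "\<not> (a * sqrt (snd p) < fst p \<and> fst p < \<xi> (snd p)) \<and> \<not> (\<xi> (snd p) < fst p \<and> fst p < a * sqrt (snd p))"
          unfolding e(2,3) using elim p pos[OF e(1)] neg[of "fst p / sqrt (snd p)"] by force
      qed
    qed
    have A1: "AE (x, t) in lebesgue_on (strip T). \<not> (a * sqrt t < x \<and> x < \<xi> t)"
      and A2: "AE (x, t) in lebesgue_on (strip T). \<not> (\<xi> t < x \<and> x < a * sqrt t)"
      using ae1 ss by (auto simp: AE_restrict_space_iff case_prod_beta' elim!: eventually_mono)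
    have eq: "\<xi> t = a * sqrt t" if t: "0 < t" "t < T" for t
    proof -
      have ci: "isCont \<xi> t" "isCont (\<lambda>t. a * sqrt t) t"
        using \<xi>c c t by (auto intro!: continuous_on_interior[of "{0..T}"])
      have "0 < a * sqrt t" using a t by simp
      then show ?thesis
        using strip_gap_empty[OF A1 ci(2,1) t] strip_gap_empty[OF A2 ci t] by (simp add: max_def split: if_splits)
    qed
    show "\<forall>t\<in>{0..T}. \<xi> t = a * sqrt t"
    proof
      fix t assume t: "t \<in> {0..T}"
      have cl: "closure {0<..<T} = {0..T}" using T by (rule closure_greaterThanLessThan)
      have "\<xi> t - a * sqrt t = 0"
        by (rule continuous_constant_on_closure[of "{0<..<T}" "\<lambda>t. \<xi> t - a * sqrt t"])
           (use cl t eq in \<open>auto intro!: continuous_intros \<xi>c\<close>)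
      then show "\<xi> t = a * sqrt t" by simp
    qed
  }
qed

text \<open>Both pieces vanish at \<open>a\<close>, so \<open>match\<close> equates the diffusive
  fluxes. Up to sign it is \<open>root\<close> multiplied by
  \<open>gauss d\<^sub>u a * gauss d\<^sub>v a / (L * R)\<close>.\<close>

lemma two_phase_weak_solution:
  assumes d: "d\<^sub>u > 0" "d\<^sub>v > 0" and UV: "U\<^sub>0 > 0" "V\<^sub>0 > 0" and a: "0 < a"
    and root: "d\<^sub>u * U\<^sub>0 * right_ratio d\<^sub>v a = d\<^sub>v * V\<^sub>0 * left_ratio d\<^sub>u a"
  shows "weak_solution d\<^sub>u d\<^sub>v U\<^sub>0 V\<^sub>0
    (\<lambda>x t. (\<lambda>\<eta>. if \<eta> \<le> a then inner_profile d\<^sub>u U\<^sub>0 a \<eta> else outer_profile d\<^sub>v V\<^sub>0 a \<eta>) (x / sqrt t))"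
proof -
  define L where "L = integral {0..a} (gauss d\<^sub>u)"
  define R where "R = integral {a..} (gauss d\<^sub>v)"
  let ?r = "outer_profile d\<^sub>v V\<^sub>0 a"
  let ?q = "\<lambda>\<eta>. - (d\<^sub>v * V\<^sub>0 / R * gauss d\<^sub>v \<eta>)"
  have L: "0 < L" unfolding L_def by (rule gauss_integral_pos[OF a])
  have R: "0 < R" unfolding R_def by (rule gauss_tail_pos[OF d(2)])
  have dr: "(?r has_real_derivative - (V\<^sub>0 * gauss d\<^sub>v \<eta> / R)) (at \<eta>)" if "a < \<eta>" for \<eta>
    unfolding R_def using that a by (intro outer_profile_has_derivative d) auto
  have ra: "?r a = 0" using R by (simp add: outer_profile_def R_def)
  show ?thesis
  proof (rule glued_profile_weak_solution[where q="?q"])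
    show "continuous_on {a..} ?r"
      unfolding outer_profile_def divide_inverse
      by (intro continuous_intros continuous_on_subset[OF continuous_gauss_tail[OF d(2)]]) (use a in auto)
    show "- V\<^sub>0 \<le> ?r \<eta> \<and> ?r \<eta> \<le> 0" if "a < \<eta>" for \<eta>
      using outer_profile_bounds[OF d(2) UV(2) that] by simp
    show "((\<lambda>\<eta>. d\<^sub>v * ?r \<eta>) has_real_derivative ?q \<eta>) (at \<eta>)" if "a < \<eta>" for \<eta>
      using DERIV_cmult[OF dr[OF that], of d\<^sub>v] by (simp add: mult.assoc)
    show "continuous_on {a..} ?q"
      unfolding divide_inverse by (intro continuous_intros continuous_gauss)
    show "((\<lambda>\<eta>. ?q \<eta> + \<eta> * ?r \<eta> / 2) has_real_derivative ?r \<eta> / 2) (at \<eta>)" if \<eta>: "a < \<eta>" for \<eta>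
    proof -
      have "((\<lambda>\<eta>. ?q \<eta> + \<eta> * ?r \<eta> / 2) has_real_derivative
          - (d\<^sub>v * V\<^sub>0 / R * (- (\<eta> / (2 * d\<^sub>v)) * gauss d\<^sub>v \<eta>)) + (1 * ?r \<eta> + - (V\<^sub>0 * gauss d\<^sub>v \<eta> / R) * \<eta>) / 2) (at \<eta>)"
        by (intro DERIV_add DERIV_minus DERIV_cmult gauss_has_derivative d DERIV_cdivide DERIV_mult DERIV_ident dr \<eta>)
      also have "- (d\<^sub>v * V\<^sub>0 / R * (- (\<eta> / (2 * d\<^sub>v)) * gauss d\<^sub>v \<eta>)) + (1 * ?r \<eta> + - (V\<^sub>0 * gauss d\<^sub>v \<eta> / R) * \<eta>) / 2 = ?r \<eta> / 2"
        using d R by (simp add: field_simps)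
      finally show ?thesis .
    qed
    show "- (d\<^sub>u * U\<^sub>0 * gauss d\<^sub>u a / integral {0..a} (gauss d\<^sub>u)) = ?q a + a * ?r a / 2"
      using root L R gauss_pos[of d\<^sub>u a] gauss_pos[of d\<^sub>v a]
      unfolding ra L_def[symmetric] left_ratio_def right_ratio_def R_def[symmetric]
      by (simp add: field_simps)
    have "((\<lambda>\<eta>. - V\<^sub>0 * (1 - integral {\<eta>..} (gauss d\<^sub>v) / R)) \<longlongrightarrow> - V\<^sub>0 * (1 - 0 / R)) at_top"
      using R by (intro tendsto_intros gauss_tail_tendsto d) auto
    then show "(?r \<longlongrightarrow> - V\<^sub>0) at_top" by (simp add: outer_profile_def[abs_def] R_def)
  qed (use d UV a ra in auto)
qed

text \<open>With \<open>d\<^sub>v = 0\<close> nothing diffuses outside, so the outer flux is 0. D(f)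
  is continuous although \<open>f\<close> jumps from 0 to \<open>- V\<^sub>0\<close>, and
  \<open>match\<close> is the Stefan condition: the moving jump takes up the whole incoming
  flux.\<close>

lemma one_phase_weak_solution:
  assumes d: "d\<^sub>u > 0" and UV: "U\<^sub>0 > 0" "V\<^sub>0 > 0" and a: "0 < a"
    and root: "U\<^sub>0 = V\<^sub>0 * a / (2 * d\<^sub>u) * left_ratio d\<^sub>u a"
  shows "weak_solution d\<^sub>u 0 U\<^sub>0 V\<^sub>0
    (\<lambda>x t. (\<lambda>\<eta>. if \<eta> \<le> a then inner_profile d\<^sub>u U\<^sub>0 a \<eta> else - V\<^sub>0) (x / sqrt t))"
proof (rule glued_profile_weak_solution[where q="\<lambda>_. 0" and r="\<lambda>_. - V\<^sub>0"])
  define L where "L = integral {0..a} (gauss d\<^sub>u)"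
  have L: "0 < L" unfolding L_def by (rule gauss_integral_pos[OF a])
  have "U\<^sub>0 * (2 * d\<^sub>u) * gauss d\<^sub>u a = V\<^sub>0 * a * L"
    using root d gauss_pos[of d\<^sub>u a] unfolding left_ratio_def L_def[symmetric] by (simp add: field_simps)
  then show "- (d\<^sub>u * U\<^sub>0 * gauss d\<^sub>u a / integral {0..a} (gauss d\<^sub>u)) = 0 + a * - V\<^sub>0 / 2"
    unfolding L_def[symmetric] using L by (simp add: field_simps)
  show "((\<lambda>\<eta>. 0 + \<eta> * - V\<^sub>0 / 2) has_real_derivative - V\<^sub>0 / 2) (at \<eta>)" for \<eta>
    by (auto intro!: derivative_eq_intros)
qed (use d UV a in auto)

text \<open>Uniqueness transfers the profile of one explicit solution to every weak solution; the
  free boundary is then read off the signs of the profile.\<close>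

lemma self_similar_characterization:
  assumes d: "d\<^sub>u > 0" "d\<^sub>v \<ge> 0" and a: "0 < a"
    and sol: "weak_solution d\<^sub>u d\<^sub>v U\<^sub>0 V\<^sub>0 (\<lambda>x t. f (x / sqrt t))"
    and pos: "\<And>\<eta>. 0 < \<eta> \<Longrightarrow> \<eta> < a \<Longrightarrow> 0 < f \<eta>" and neg: "\<And>\<eta>. a < \<eta> \<Longrightarrow> f \<eta> < 0"
    and w: "weak_solution d\<^sub>u d\<^sub>v U\<^sub>0 V\<^sub>0 w" and T: "T > 0"
  shows "(AE (x, t) in lebesgue_on (strip T). w x t = f (x / sqrt t)) \<and>
    (\<forall>\<xi>. free_boundary T w \<xi> \<longleftrightarrow> (\<forall>t\<in>{0..T}. \<xi> t = a * sqrt t))"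
proof -
  note ss = strip_in_sets_lebesgue[of T]
  note qs = quadrant_in_sets_lebesgue
  have "AE p in lebesgue. p \<in> quadrant \<longrightarrow> w (fst p) (snd p) = f (fst p / sqrt (snd p))"
    using weak_solution_unique[OF d w sol] qs by (subst (asm) AE_restrict_space_iff) (auto simp: case_prod_beta')
  then have ae: "AE (x, t) in lebesgue_on (strip T). w x t = f (x / sqrt t)"
    using ss by (subst AE_restrict_space_iff) (auto simp: case_prod_beta' strip_def quadrant_def elim!: eventually_mono)
  have "free_boundary T w \<xi> \<longleftrightarrow> (\<forall>t\<in>{0..T}. \<xi> t = a * sqrt t)" for \<xi>
    by (rule free_boundary_self_similar[where f=f, OF T a _ _ ae]) (fact pos neg)+
  with ae show ?thesis by blast
qed

theorem theorem3p16:
  fixes d\<^sub>u d\<^sub>v U\<^sub>0 V\<^sub>0 :: real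
  assumes "d\<^sub>u > 0" and "d\<^sub>v \<ge> 0" and "U\<^sub>0 > 0" and "V\<^sub>0 > 0"
  shows "(\<exists>w. weak_solution d\<^sub>u d\<^sub>v U\<^sub>0 V\<^sub>0 w) \<and>
    (\<forall>w w'. weak_solution d\<^sub>u d\<^sub>v U\<^sub>0 V\<^sub>0 w \<longrightarrow> weak_solution d\<^sub>u d\<^sub>v U\<^sub>0 V\<^sub>0 w' \<longrightarrow>
       (AE (x, t) in lebesgue_on quadrant. w x t = w' x t)) \<and>
    (\<exists>(f :: real \<Rightarrow> real) (a :: real). a > 0 \<and>
       (\<forall>w. weak_solution d\<^sub>u d\<^sub>v U\<^sub>0 V\<^sub>0 w \<longrightarrow>
          (\<forall>T>0. (AE (x, t) in lebesgue_on (strip T). w x t = f (x / sqrt t)) \<and>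
                 (\<forall>\<xi>. free_boundary T w \<xi> \<longleftrightarrow> (\<forall>t\<in>{0..T}. \<xi> t = a * sqrt t)))) \<and>
       (d\<^sub>v > 0 \<longrightarrow>
          (\<forall>b>0. d\<^sub>u * U\<^sub>0 * integral {b..} (\<lambda>s. exp ((b\<^sup>2 - s\<^sup>2) / (4 * d\<^sub>v)))
                   = d\<^sub>v * V\<^sub>0 * integral {0..b} (\<lambda>s. exp ((b\<^sup>2 - s\<^sup>2) / (4 * d\<^sub>u)))
                 \<longleftrightarrow> b = a) \<and>
          (\<forall>\<eta>\<ge>0. f \<eta> =
             (if \<eta> \<le> a
              then U\<^sub>0 * (1 - integral {0..\<eta>} (\<lambda>s. exp (- (s\<^sup>2 / (4 * d\<^sub>u))))
                              / integral {0..a} (\<lambda>s. exp (- (s\<^sup>2 / (4 * d\<^sub>u)))))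
              else - V\<^sub>0 * (1 - integral {\<eta>..} (\<lambda>s. exp (- (s\<^sup>2 / (4 * d\<^sub>v))))
                                / integral {a..} (\<lambda>s. exp (- (s\<^sup>2 / (4 * d\<^sub>v)))))))) \<and>
       (d\<^sub>v = 0 \<longrightarrow>
          (\<forall>b>0. U\<^sub>0 = V\<^sub>0 * b / (2 * d\<^sub>u) * integral {0..b} (\<lambda>s. exp ((b\<^sup>2 - s\<^sup>2) / (4 * d\<^sub>u)))
                 \<longleftrightarrow> b = a) \<and>
          (\<forall>\<eta>\<ge>0. f \<eta> =
             (if \<eta> \<le> a
              then U\<^sub>0 * (1 - integral {0..\<eta>} (\<lambda>s. exp (- (s\<^sup>2 / (4 * d\<^sub>u))))
                              / integral {0..a} (\<lambda>s. exp (- (s\<^sup>2 / (4 * d\<^sub>u)))))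
              else - V\<^sub>0))))"
proof -
  have gauss: "(\<lambda>s. exp (- (s\<^sup>2 / (4 * d)))) = gauss d" for d :: real
    by (simp add: gauss_def[abs_def])
  have unique: "\<forall>w w'. weak_solution d\<^sub>u d\<^sub>v U\<^sub>0 V\<^sub>0 w \<longrightarrow> weak_solution d\<^sub>u d\<^sub>v U\<^sub>0 V\<^sub>0 w' \<longrightarrow>
      (AE (x, t) in lebesgue_on quadrant. w x t = w' x t)"
    using weak_solution_unique[OF assms(1,2)] by blast
  show ?thesis
  proof (cases "d\<^sub>v = 0")
    case True
    obtain a where a: "0 < a"
      and root: "\<And>b. 0 < b \<Longrightarrow> U\<^sub>0 = V\<^sub>0 * b / (2 * d\<^sub>u) * left_ratio d\<^sub>u b \<longleftrightarrow> b = a"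
      using stefan_root_degenerate[OF assms(1,3,4)] by blast
    define f where "f \<eta> = (if \<eta> \<le> a then inner_profile d\<^sub>u U\<^sub>0 a \<eta> else - V\<^sub>0)" for \<eta>
    have sol: "weak_solution d\<^sub>u d\<^sub>v U\<^sub>0 V\<^sub>0 (\<lambda>x t. f (x / sqrt t))"
      using one_phase_weak_solution[OF assms(1,3,4) a] root[OF a] True unfolding f_def by blast
    have char: "\<forall>w. weak_solution d\<^sub>u d\<^sub>v U\<^sub>0 V\<^sub>0 w \<longrightarrow> (\<forall>T>0.
        (AE (x, t) in lebesgue_on (strip T). w x t = f (x / sqrt t)) \<and>
        (\<forall>\<xi>. free_boundary T w \<xi> \<longleftrightarrow> (\<forall>t\<in>{0..T}. \<xi> t = a * sqrt t)))"
    proof (intro allI impI)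
      fix w and T :: real assume "weak_solution d\<^sub>u d\<^sub>v U\<^sub>0 V\<^sub>0 w" "0 < T"
      then show "(AE (x, t) in lebesgue_on (strip T). w x t = f (x / sqrt t)) \<and>
        (\<forall>\<xi>. free_boundary T w \<xi> \<longleftrightarrow> (\<forall>t\<in>{0..T}. \<xi> t = a * sqrt t))"
        by (intro self_similar_characterization[OF assms(1,2) a sol])
           (use inner_profile_bounds(3)[OF a assms(3)] assms(4) in \<open>auto simp: f_def\<close>)
    qed
    have roots: "\<forall>b>0. U\<^sub>0 = V\<^sub>0 * b / (2 * d\<^sub>u) * integral {0..b} (\<lambda>s. exp ((b\<^sup>2 - s\<^sup>2) / (4 * d\<^sub>u))) \<longleftrightarrow> b = a"
      unfolding left_ratio_eq using root by blast
    show ?thesis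
      by (rule conjI[OF _ conjI[OF unique]], rule exI, rule sol, rule exI[of _ f], rule exI[of _ a],
          intro conjI, rule a, rule char, use True in simp, intro impI conjI, rule roots)
         (simp add: f_def inner_profile_def gauss)
  next
    case False
    then have dv: "d\<^sub>v > 0" using assms(2) by simp
    obtain a where a: "0 < a"
      and root: "\<And>b. 0 < b \<Longrightarrow> d\<^sub>u * U\<^sub>0 * right_ratio d\<^sub>v b = d\<^sub>v * V\<^sub>0 * left_ratio d\<^sub>u b \<longleftrightarrow> b = a"
      using stefan_root[OF assms(1) dv assms(3,4)] by blast
    define f where "f \<eta> = (if \<eta> \<le> a then inner_profile d\<^sub>u U\<^sub>0 a \<eta> else outer_profile d\<^sub>v V\<^sub>0 a \<eta>)" for \<eta>
    have sol: "weak_solution d\<^sub>u d\<^sub>v U\<^sub>0 V\<^sub>0 (\<lambda>x t. f (x / sqrt t))"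
      using two_phase_weak_solution[OF assms(1) dv assms(3,4) a] root[OF a] unfolding f_def by blast
    have char: "\<forall>w. weak_solution d\<^sub>u d\<^sub>v U\<^sub>0 V\<^sub>0 w \<longrightarrow> (\<forall>T>0.
        (AE (x, t) in lebesgue_on (strip T). w x t = f (x / sqrt t)) \<and>
        (\<forall>\<xi>. free_boundary T w \<xi> \<longleftrightarrow> (\<forall>t\<in>{0..T}. \<xi> t = a * sqrt t)))"
    proof (intro allI impI)
      fix w and T :: real assume "weak_solution d\<^sub>u d\<^sub>v U\<^sub>0 V\<^sub>0 w" "0 < T"
      then show "(AE (x, t) in lebesgue_on (strip T). w x t = f (x / sqrt t)) \<and>
        (\<forall>\<xi>. free_boundary T w \<xi> \<longleftrightarrow> (\<forall>t\<in>{0..T}. \<xi> t = a * sqrt t))"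
        by (intro self_similar_characterization[OF assms(1,2) a sol])
           (use inner_profile_bounds(3)[OF a assms(3)] outer_profile_bounds(2)[OF dv assms(4)] in \<open>auto simp: f_def\<close>)
    qed
    have roots: "\<forall>b>0. d\<^sub>u * U\<^sub>0 * integral {b..} (\<lambda>s. exp ((b\<^sup>2 - s\<^sup>2) / (4 * d\<^sub>v)))
        = d\<^sub>v * V\<^sub>0 * integral {0..b} (\<lambda>s. exp ((b\<^sup>2 - s\<^sup>2) / (4 * d\<^sub>u))) \<longleftrightarrow> b = a"
      unfolding left_ratio_eq right_ratio_eq using root by blast
    show ?thesis
      by (rule conjI[OF _ conjI[OF unique]], rule exI, rule sol, rule exI[of _ f], rule exI[of _ a],
          intro conjI, rule a, rule char, intro impI conjI, rule roots)
         (simp add: f_def inner_profile_def outer_profile_def gauss, use False in simp)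
  qed
qed

end
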